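(* Let $C$ be a smooth projective curve of genus $g\geq1$ over an algebraically closed field $k$, $P$ a point of $C$, and $d\geq1$ an integer. Let $A_d=R_d/(x,z)$ with $\mathfrak a=(A_d)_+$, and let $\mathbf v=(v_1,\dots,v_s)$ be the vector of weights of the remaining variables $y_1,\dots,y_s$ in a minimal weighted presentation $S_d=k[\tilde x,\tilde z,y_1,\dots,y_s]\to R_d$ (notation in the context). The condition $\mathfrak a^2=0$ can be detected in the following cases: (a) $\mathfrak a^2=0$ if and only if $s=e_d-1$, that is, $\mathbf v$ has maximal possible length. (b) If $2v_1>q_d+\lceil F(P)/d\rceil$, then $\mathfrak a^2=0$. (c) If $P$ is ordinary, then $\mathfrak a^2=0$ if and only if $d\mid g$ or $d\mid(g+1)$.
   Context: The section ring is $R_d=\bigoplus_{m\geq 0}H^0(C,\mathcal{O}_C(mdP))$, graded by $m$. The Weierstrass semigroup of $P$ is $H(P)=\{-\operatorname{ord}_P(f)\mid f\in k(C)^\times\text{ regular away from }P\}\subseteq\mathbb{Z}_{\ge0}$; $G(P)=\mathbb{Z}_{\ge0}\setminus H(P)$ (of cardinality $g$); the Frobenius number is $F(P)=\max G(P)$; $P$ is ordinary if $G(P)=\{1,\dots,g\}$. Set $q_d=\min\{q\geq1\mid qd\in H(P)\}$ and $e_d=q_dd$. Let $x\in(R_d)_1=H^0(C,\mathcal{O}_C(dP))$ be the image of $1\in k=H^0(C,\mathcal O_C)$ under the natural inclusion $H^0(C,\mathcal{O}_C)\subset H^0(C,\mathcal{O}_C(dP))$, and let $z\in(R_d)_{q_d}=H^0(C,\mathcal{O}_C(e_dP))$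 be an element corresponding to a rational function with pole order exactly $e_d$ at $P$. The elements $x,z$ can be completed to a minimal homogeneous $k$-algebra generating set of $R_d$, giving a minimal weighted presentation $S_d=k[\tilde x,\tilde z,y_1,\dots,y_s]\twoheadrightarrow R_d$ with $\tilde x\mapsto x$, $\tilde z\mapsto z$, $\deg\tilde x=1$, $\deg\tilde z=q_d$, $\deg y_a=v_a$, and $v_1\leq\cdots\leq v_s$. (Minimal means that the images of the variables form a basis of $(R_d)_+/((R_d)_+)^2$.) Put $A_d=R_d/(x,z)$ and let $\mathfrak a=(A_d)_+$ be its ideal of positive-degree elements. *)

theory Defs
  imports
    "HOL-Computational_Algebra.Polynomial"
    "HOL-Library.Poly_Mapping"
    "HOL-Library.Function_Algebras"
    "HOL-Algebra.QuotRing"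
    "HOL-Algebra.Ideal_Product"
begin

section \<open>Multivariate polynomials\<close>

text \<open>Monomials are finitely supported exponent functions and polynomials are finitely
  supported coefficient functions on monomials.\<close>

type_synonym ('v, 'k) mpol = "('v \<Rightarrow>\<^sub>0 nat) \<Rightarrow>\<^sub>0 'k"

text \<open>Evaluation at \<open>x\<close> with values in an algebra whose structure map is \<open>h\<close>.\<close>

definition mpol_eval ::
  "('k::zero \<Rightarrow> 'r::comm_ring_1) \<Rightarrow> ('v \<Rightarrow> 'r) \<Rightarrow> ('v, 'k) mpol \<Rightarrow> 'r" where
  "mpol_eval h x F =
     (\<Sum>m\<in>Poly_Mapping.keys F. h (Poly_Mapping.lookup F m) *
        (\<Prod>i\<in>Poly_Mapping.keys m. x i ^ Poly_Mapping.lookup m i))"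

definition homogeneous :: "nat \<Rightarrow> ('v, 'k::zero) mpol \<Rightarrow> bool" where
  "homogeneous e F \<longleftrightarrow>
     (\<forall>m\<in>Poly_Mapping.keys F. (\<Sum>i\<in>Poly_Mapping.keys m. Poly_Mapping.lookup m i) = e)"

definition mpols_in :: "'v set \<Rightarrow> ('v, 'k::zero) mpol set" where
  "mpols_in I = {F. \<forall>m\<in>Poly_Mapping.keys F. Poly_Mapping.keys m \<subseteq> I}"


section \<open>Finite bases of quotient spaces\<close>

text \<open>For a subspace \<open>W\<close> of \<open>V\<close>, the classes of the family \<open>b\<close>, indexed by \<open>I\<close>, form a
  basis of \<open>V / W\<close>.\<close>

definition basis_mod ::
  "('k::zero \<Rightarrow> 'v::ab_group_add \<Rightarrow> 'v) \<Rightarrow> 'v set \<Rightarrow> 'v set \<Rightarrow> 'i set \<Rightarrow> ('i \<Rightarrow> 'v) \<Rightarrow> bool" where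
  "basis_mod scl V W I b \<longleftrightarrow>
     finite I \<and> (\<forall>i\<in>I. b i \<in> V) \<and>
     (\<forall>v\<in>V. \<exists>c. v - (\<Sum>i\<in>I. scl (c i) (b i)) \<in> W) \<and>
     (\<forall>c. (\<Sum>i\<in>I. scl (c i) (b i)) \<in> W \<longrightarrow> (\<forall>i\<in>I. c i = 0))"

definition quotient_has_dim ::
  "('k::zero \<Rightarrow> 'v::ab_group_add \<Rightarrow> 'v) \<Rightarrow> 'v set \<Rightarrow> 'v set \<Rightarrow> nat \<Rightarrow> bool" where
  "quotient_has_dim scl V W n \<longleftrightarrow> (\<exists>b. basis_mod scl V W {..<n} b)"

text \<open>The ring structure inherited by a subset of a type-class ring.\<close>

definition subring_on :: "'a::comm_ring_1 set \<Rightarrow> 'a ring" where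
  "subring_on A =
     \<lparr>carrier = A, monoid.mult = (*), one = 1, ring.zero = 0, add = (+)\<rparr>"


section \<open>Projective varieties and their function fields\<close>

text \<open>Points of projective space are classes of nonzero coordinate vectors up to scaling; the
  homogeneous coordinates are indexed by the finite type \<open>'n\<close>.\<close>

definition proj_point :: "('n \<Rightarrow> 'k::field) \<Rightarrow> ('n \<Rightarrow> 'k) set" where
  "proj_point p = {(\<lambda>i. c * p i) | c. c \<noteq> 0}"

definition proj_space :: "('n \<Rightarrow> 'k::field) set set" where
  "proj_space = {proj_point p | p. p \<noteq> (\<lambda>_. 0)}"

definition vanishes_at :: "('n, 'k::field) mpol \<Rightarrow> ('n \<Rightarrow> 'k) set \<Rightarrow> bool" where
  "vanishes_at F Q \<longleftrightarrow> (\<forall>p\<in>Q. mpol_eval (\<lambda>c. c) p F = 0)"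

definition algebraic_set :: "('n \<Rightarrow> 'k::field) set set \<Rightarrow> bool" where
  "algebraic_set Z \<longleftrightarrow>
     (\<exists>T. (\<forall>F\<in>T. \<exists>e. homogeneous e F) \<and> Z = {Q \<in> proj_space. \<forall>F\<in>T. vanishes_at F Q})"

text \<open>A projective variety together with its function field, which is the type \<open>'K\<close>.
  \<open>scalar\<close> is the inclusion of the ground field, and \<open>gcoord\<close> is a vector of homogeneous
  coordinates of the generic point (for instance the classes of \<open>T\<^sub>i / T\<^sub>j\<close>, for a fixed
  coordinate \<open>T\<^sub>j\<close> not vanishing identically).\<close>

record ('k, 'K, 'n) variety =
  points :: "('n \<Rightarrow> 'k) set set"
  scalar :: "'k \<Rightarrow> 'K"
  gcoord :: "'n \<Rightarrow> 'K"

abbreviation generic_value ::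
  "('k::field, 'K::field, 'n::finite) variety \<Rightarrow> ('n, 'k) mpol \<Rightarrow> 'K" where
  "generic_value X F \<equiv> mpol_eval (scalar X) (gcoord X) F"

abbreviation scl :: "('k::field, 'K::field, 'n::finite) variety \<Rightarrow> 'k \<Rightarrow> 'K \<Rightarrow> 'K" where
  "scl X c f \<equiv> scalar X c * f"

text \<open>The third condition says that a form vanishes at the generic point iff it lies in the
  homogeneous ideal of the variety. So \<open>F / G\<close> maps to the quotient of the generic values,
  injectively, on the fractions of forms of equal degree in the homogeneous coordinate ring; by
  the last condition this identifies the function field with \<open>'K\<close>. As \<open>'K\<close> is a field, the
  homogeneous ideal is prime, i.e. the variety is nonempty and irreducible.\<close>

definition projective_variety :: "('k::field, 'K::field, 'n::finite) variety \<Rightarrow> bool" where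
  "projective_variety X \<longleftrightarrow>
     algebraic_set (points X) \<and>
     (scalar X 1 = 1 \<and>
      (\<forall>a b. scalar X (a + b) = scalar X a + scalar X b) \<and>
      (\<forall>a b. scalar X (a * b) = scalar X a * scalar X b)) \<and>
     (\<forall>e F. homogeneous e F \<longrightarrow>
        (generic_value X F = 0 \<longleftrightarrow> (\<forall>Q\<in>points X. vanishes_at F Q))) \<and>
     (\<forall>f. \<exists>e F G. homogeneous e F \<and> homogeneous e G \<and> generic_value X G \<noteq> 0 \<and>
        f = generic_value X F / generic_value X G)"

definition local_ring ::
  "('k::field, 'K::field, 'n::finite) variety \<Rightarrow> ('n \<Rightarrow> 'k) set \<Rightarrow> 'K set" where
  "local_ring X Q =
     {generic_value X F / generic_value X G | F G.
        \<exists>e. homogeneous e F \<and> homogeneous e G \<and> \<not> vanishes_at G Q}"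

definition local_max_ideal ::
  "('k::field, 'K::field, 'n::finite) variety \<Rightarrow> ('n \<Rightarrow> 'k) set \<Rightarrow> 'K set" where
  "local_max_ideal X Q =
     {generic_value X F / generic_value X G | F G.
        \<exists>e. homogeneous e F \<and> homogeneous e G \<and> \<not> vanishes_at G Q \<and> vanishes_at F Q}"

text \<open>The dimension is the transcendence degree of the function field over the ground field.\<close>

definition alg_independent ::
  "('k::field, 'K::field, 'n::finite) variety \<Rightarrow> 'i set \<Rightarrow> ('i \<Rightarrow> 'K) \<Rightarrow> bool" where
  "alg_independent X I x \<longleftrightarrow> (\<forall>F\<in>mpols_in I. mpol_eval (scalar X) x F = 0 \<longrightarrow> F = 0)"

definition has_dimension :: "('k::field, 'K::field, 'n::finite) variety \<Rightarrow> nat \<Rightarrow> bool" where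
  "has_dimension X n \<longleftrightarrow>
     (\<exists>x. alg_independent X {..<n} x) \<and> \<not> (\<exists>x. alg_independent X {..<Suc n} x)"

text \<open>Smoothness at \<open>Q\<close>: the Zariski cotangent space of \<open>Q\<close> has the dimension of the variety,
  i.e. the local ring is regular; over an algebraically closed field this is smoothness over the
  ground field.\<close>

definition smooth_projective_curve :: "('k::field, 'K::field, 'n::finite) variety \<Rightarrow> bool" where
  "smooth_projective_curve X \<longleftrightarrow>
     projective_variety X \<and> has_dimension X 1 \<and>
     (\<forall>Q\<in>points X.
        quotient_has_dim (scl X) (local_max_ideal X Q)
          (ideal_prod (subring_on (local_ring X Q)) (local_max_ideal X Q) (local_max_ideal X Q))
          1)"


section \<open>Genus\<close>

text \<open>The genus is the dimension of \<open>H\<^sup>1(C, O\<^sub>C)\<close>. The constant sheaf \<open>K\<close> and the direct sum of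
  the skyscraper sheaves \<open>K / O\<^sub>Q\<close> are flasque, and form a resolution of \<open>O\<^sub>C\<close>; hence
  \<open>H\<^sup>1(C, O\<^sub>C)\<close> is the cokernel of the diagonal map from \<open>K\<close> to the direct sum of the \<open>K / O\<^sub>Q\<close>.
  Elements of the direct sum are represented by families that are regular at almost all points;
  values outside of the curve are irrelevant modulo the subspace divided out.\<close>

definition repartitions ::
  "('k::field, 'K::field, 'n::finite) variety \<Rightarrow> (('n \<Rightarrow> 'k) set \<Rightarrow> 'K) set" where
  "repartitions X = {r. finite {Q \<in> points X. r Q \<notin> local_ring X Q}}"

definition principal_repartitions ::
  "('k::field, 'K::field, 'n::finite) variety \<Rightarrow> (('n \<Rightarrow> 'k) set \<Rightarrow> 'K) set" where
  "principal_repartitions X =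
     {r \<in> repartitions X. \<exists>f. \<forall>Q\<in>points X. r Q - f \<in> local_ring X Q}"

definition has_genus :: "('k::field, 'K::field, 'n::finite) variety \<Rightarrow> nat \<Rightarrow> bool" where
  "has_genus X g \<longleftrightarrow>
     quotient_has_dim (\<lambda>c r Q. scl X c (r Q)) (repartitions X) (principal_repartitions X) g"


section \<open>Orders, Weierstrass semigroup and section ring\<close>

definition uniformizer ::
  "('k::field, 'K::field, 'n::finite) variety \<Rightarrow> ('n \<Rightarrow> 'k) set \<Rightarrow> 'K \<Rightarrow> bool" where
  "uniformizer X Q t \<longleftrightarrow> local_max_ideal X Q = {t * a | a. a \<in> local_ring X Q}"

text \<open>Only meaningful for \<open>f \<noteq> 0\<close>.\<close>

definition ord_at ::
  "('k::field, 'K::field, 'n::finite) variety \<Rightarrow> ('n \<Rightarrow> 'k) set \<Rightarrow> 'K \<Rightarrow> int" where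
  "ord_at X Q f =
     (THE n. \<exists>t u. uniformizer X Q t \<and> u \<noteq> 0 \<and> u \<in> local_ring X Q \<and>
        inverse u \<in> local_ring X Q \<and> f = u * t powi n)"

text \<open>The space of global sections of \<open>O\<^sub>C(n P)\<close>, a subsheaf of the constant sheaf \<open>K\<close>.\<close>

definition H0 ::
  "('k::field, 'K::field, 'n::finite) variety \<Rightarrow> ('n \<Rightarrow> 'k) set \<Rightarrow> nat \<Rightarrow> 'K set" where
  "H0 X P n =
     {f. f = 0 \<or> (ord_at X P f \<ge> - int n \<and> (\<forall>Q\<in>points X - {P}. ord_at X Q f \<ge> 0))}"

definition weierstrass_semigroup ::
  "('k::field, 'K::field, 'n::finite) variety \<Rightarrow> ('n \<Rightarrow> 'k) set \<Rightarrow> nat set" where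
  "weierstrass_semigroup X P =
     {n. \<exists>f. f \<noteq> 0 \<and> (\<forall>Q\<in>points X - {P}. f \<in> local_ring X Q) \<and> int n = - ord_at X P f}"

definition gaps ::
  "('k::field, 'K::field, 'n::finite) variety \<Rightarrow> ('n \<Rightarrow> 'k) set \<Rightarrow> nat set" where
  "gaps X P = - weierstrass_semigroup X P"

definition frobenius_number ::
  "('k::field, 'K::field, 'n::finite) variety \<Rightarrow> ('n \<Rightarrow> 'k) set \<Rightarrow> nat" where
  "frobenius_number X P = Max (gaps X P)"

definition ordinary_point ::
  "('k::field, 'K::field, 'n::finite) variety \<Rightarrow> ('n \<Rightarrow> 'k) set \<Rightarrow> bool" where
  "ordinary_point X P \<longleftrightarrow> (\<exists>g. has_genus X g \<and> gaps X P = {1..g})"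

definition qd ::
  "('k::field, 'K::field, 'n::finite) variety \<Rightarrow> ('n \<Rightarrow> 'k) set \<Rightarrow> nat \<Rightarrow> nat" where
  "qd X P d = (LEAST q. q \<ge> 1 \<and> q * d \<in> weierstrass_semigroup X P)"

definition ed ::
  "('k::field, 'K::field, 'n::finite) variety \<Rightarrow> ('n \<Rightarrow> 'k) set \<Rightarrow> nat \<Rightarrow> nat" where
  "ed X P d = qd X P d * d"

text \<open>The section ring is realised inside \<open>K[t]\<close>: the degree \<open>m\<close> piece is
  \<open>H\<^sup>0(C, O\<^sub>C(m d P)) t\<^sup>m\<close>. Thus elements of the direct sum are the polynomials whose \<open>m\<close>-th
  coefficient is a section of \<open>O\<^sub>C(m d P)\<close>.\<close>

definition section_piece ::
  "('k::field, 'K::field, 'n::finite) variety \<Rightarrow> ('n \<Rightarrow> 'k) set \<Rightarrow> nat \<Rightarrow> nat \<Rightarrow> 'K poly set" where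
  "section_piece X P d m = {Polynomial.monom f m | f. f \<in> H0 X P (m * d)}"

definition section_carrier ::
  "('k::field, 'K::field, 'n::finite) variety \<Rightarrow> ('n \<Rightarrow> 'k) set \<Rightarrow> nat \<Rightarrow> 'K poly set" where
  "section_carrier X P d = {p. \<forall>m. Polynomial.coeff p m \<in> H0 X P (m * d)}"

definition section_ring ::
  "('k::field, 'K::field, 'n::finite) variety \<Rightarrow> ('n \<Rightarrow> 'k) set \<Rightarrow> nat \<Rightarrow> 'K poly ring" where
  "section_ring X P d = subring_on (section_carrier X P d)"

definition irrelevant_ideal ::
  "('k::field, 'K::field, 'n::finite) variety \<Rightarrow> ('n \<Rightarrow> 'k) set \<Rightarrow> nat \<Rightarrow> 'K poly set" where
  "irrelevant_ideal X P d = {p \<in> section_carrier X P d. Polynomial.coeff p 0 = 0}"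

text \<open>The element \<open>x\<close>: the function \<open>1\<close>, placed in degree \<open>1\<close>.\<close>

definition x_section :: "'K::field poly" where
  "x_section = Polynomial.monom 1 1"

definition z_section ::
  "('k::field, 'K::field, 'n::finite) variety \<Rightarrow> ('n \<Rightarrow> 'k) set \<Rightarrow> nat \<Rightarrow> 'K poly \<Rightarrow> bool" where
  "z_section X P d z \<longleftrightarrow>
     (\<exists>f\<in>H0 X P (qd X P d * d). f \<noteq> 0 \<and> ord_at X P f = - int (ed X P d) \<and>
        z = Polynomial.monom f (qd X P d))"


section \<open>Minimal weighted presentations and the quotient ring\<close>

datatype pvar = XV | ZV | YV nat

fun pvar_image :: "'K::field poly \<Rightarrow> (nat \<Rightarrow> 'K poly) \<Rightarrow> pvar \<Rightarrow> 'K poly" where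
  "pvar_image z y XV = x_section"
| "pvar_image z y ZV = z"
| "pvar_image z y (YV a) = y a"

definition pvars :: "nat \<Rightarrow> pvar set" where
  "pvars s = {XV, ZV} \<union> YV ` {1..s}"

text \<open>\<open>y a\<close> is the image of the variable \<open>y\<^sub>a\<close>, of weight \<open>v a\<close>, for \<open>1 \<le> a \<le> s\<close>. The
  presentation is the surjective evaluation map defined on the polynomials in the variables
  \<open>pvars s\<close>; it is graded because the \<open>y a\<close> are homogeneous of degree \<open>v a\<close>.\<close>

definition minimal_presentation ::
  "('k::field, 'K::field, 'n::finite) variety \<Rightarrow> ('n \<Rightarrow> 'k) set \<Rightarrow> nat \<Rightarrow> 'K poly \<Rightarrow>
     nat \<Rightarrow> (nat \<Rightarrow> nat) \<Rightarrow> (nat \<Rightarrow> 'K poly) \<Rightarrow> bool" where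
  "minimal_presentation X P d z s v y \<longleftrightarrow>
     (\<forall>a\<in>{1..s}. y a \<in> section_piece X P d (v a)) \<and>
     mono_on {1..s} v \<and>
     mpol_eval (\<lambda>c. [:scalar X c:]) (pvar_image z y) ` mpols_in (pvars s)
       = section_carrier X P d \<and>
     basis_mod (\<lambda>c. Polynomial.smult (scalar X c))
       (irrelevant_ideal X P d)
       (ideal_prod (section_ring X P d) (irrelevant_ideal X P d) (irrelevant_ideal X P d))
       (pvars s) (pvar_image z y)"

definition A_ideal ::
  "('k::field, 'K::field, 'n::finite) variety \<Rightarrow> ('n \<Rightarrow> 'k) set \<Rightarrow> nat \<Rightarrow> 'K poly \<Rightarrow> 'K poly set"
  where "A_ideal X P d z = genideal (section_ring X P d) {x_section, z}"

definition A_ring ::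
  "('k::field, 'K::field, 'n::finite) variety \<Rightarrow> ('n \<Rightarrow> 'k) set \<Rightarrow> nat \<Rightarrow> 'K poly \<Rightarrow>
     'K poly set ring" where
  "A_ring X P d z = section_ring X P d Quot A_ideal X P d z"

definition A_plus ::
  "('k::field, 'K::field, 'n::finite) variety \<Rightarrow> ('n \<Rightarrow> 'k) set \<Rightarrow> nat \<Rightarrow> 'K poly \<Rightarrow>
     'K poly set set" where
  "A_plus X P d z =
     (\<lambda>p. A_ideal X P d z +>\<^bsub>section_ring X P d\<^esub> p) ` irrelevant_ideal X P d"

definition A_plus_square_zero ::
  "('k::field, 'K::field, 'n::finite) variety \<Rightarrow> ('n \<Rightarrow> 'k) set \<Rightarrow> nat \<Rightarrow> 'K poly \<Rightarrow> bool" where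
  "A_plus_square_zero X P d z \<longleftrightarrow>
     ideal_prod (A_ring X P d z) (A_plus X P d z) (A_plus X P d z) = {\<zero>\<^bsub>A_ring X P d z\<^esub>}"

end

theory Submission
  imports Defs
begin

text \<open>
  Only the pole orders at \<open>P\<close> matter. The smoothness assumption makes every local ring a discrete
  valuation ring: its maximal ideal is finitely generated, hence principal by Nakayama's lemma
  (\<open>ex_uniformizer\<close>), and no nonzero function is divisible by all powers of a uniformizer since the
  function field has transcendence degree one (\<open>not_infinitely_divisible\<close>). So \<open>ord_at\<close> is a
  valuation with residue field \<open>k\<close>. That functions without poles are constant can be read off from
  the presentation, whose generators all have positive degree, and the semigroup \<open>H\<close> of pole
  orders has at most \<open>g\<close> gaps because repartitions with gaps as pole orders are independent modulo
  the principal ones (\<open>card_gaps_le_genus\<close>).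

  Write \<open>e = q d\<close>. A function of pole order \<open>h\<close> appears in the section ring first in degree
  \<open>\<lceil>h / d\<rceil>\<close>. Dividing by \<open>x\<close> removes it from the higher degrees, and dividing by \<open>z\<close> removes it
  altogether if \<open>h - e\<close> is a pole order. So \<open>A = R / (x, z)\<close> has a basis indexed by the Apery set
  of the \<open>h \<in> H\<close> with \<open>h - e \<notin> H\<close>, the element for \<open>h\<close> being of degree \<open>\<lceil>h / d\<rceil>\<close>. The Apery set has
  one element in each residue class modulo \<open>e\<close>, so the ideal \<open>\<aa>\<close> of positive degree has dimension
  \<open>e - 1\<close> (\<open>apery_basis\<close>). All three claims follow from this description.

  The variables \<open>y\<^sub>a\<close> give a basis of \<open>\<aa> / \<aa>\<^sup>2\<close> (\<open>y_basis\<close>), so \<open>s = e - 1\<close> iff \<open>\<aa>\<^sup>2 = 0\<close>.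

  The ideal \<open>\<aa>\<^sup>2\<close> lives in degrees at least \<open>2 v\<^sub>1\<close>, whereas the elements of the Apery set are at most
  \<open>e + F\<close>, so that \<open>A\<close> vanishes in degrees greater than \<open>q + \<lceil>F / d\<rceil>\<close>.

  If \<open>P\<close> is ordinary, then \<open>g + 1 \<le> e \<le> g + d\<close>, and the divisibility condition says that \<open>e\<close> is one
  of the two bounds. In these cases \<open>\<aa>\<close> lives in degrees from \<open>k\<close> to \<open>2 k - 1\<close> for some \<open>k\<close>. In all
  others the product of functions of pole orders \<open>g + 1\<close> and \<open>e - 1\<close>, in degree \<open>2 q\<close>, is nonzero
  in \<open>A\<close> (\<open>square_zero_ordinary_iff\<close>).
\<close>


section \<open>Finite families modulo a subspace\<close>

text \<open>A homogeneous linear system with more unknowns than equations has a nonzero solution.\<close>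

lemma underdetermined_system:
  fixes a :: "'i \<Rightarrow> 'j \<Rightarrow> 'k::field"
  assumes "finite I" "finite J" "card I < card J"
  shows "\<exists>c. (\<exists>j\<in>J. c j \<noteq> 0) \<and> (\<forall>i\<in>I. (\<Sum>j\<in>J. a i j * c j) = 0)"
  using assms
proof (induction I arbitrary: J a rule: finite_induct)
  case empty
  then have "J \<noteq> {}" by auto
  then show ?case by (intro exI[of _ "\<lambda>_. 1"]) auto
next
  case (insert i0 I)
  show ?case
  proof (cases "\<forall>j\<in>J. a i0 j = 0")
    case True
    have "card I < card J" using insert by simp
    from insert.IH[OF insert.prems(1) this, of a] obtain c where
      c: "\<exists>j\<in>J. c j \<noteq> 0" "\<forall>i\<in>I. (\<Sum>j\<in>J. a i j * c j) = 0" by blast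
    then show ?thesis using True by (intro exI[of _ c]) auto
  next
    case False
    then obtain j0 where j0: "j0 \<in> J" "a i0 j0 \<noteq> 0" by blast
    define J' where "J' = J - {j0}"
    define a' where "a' i j = a i j - a i j0 * a i0 j / a i0 j0" for i j
    have J': "finite J'" "card I < card J'" "j0 \<notin> J'" "J = insert j0 J'"
      using insert j0 by (auto simp: J'_def card_Diff_singleton)
    from insert.IH[OF J'(1,2), of a'] obtain c where
      c: "\<exists>j\<in>J'. c j \<noteq> 0" "\<forall>i\<in>I. (\<Sum>j\<in>J'. a' i j * c j) = 0" by blast
    define s where "s = (\<Sum>j\<in>J'. a i0 j * c j)"
    define c' where "c' = c(j0 := - s / a i0 j0)"
    have sum_c': "(\<Sum>j\<in>J. a i j * c' j) = (\<Sum>j\<in>J'. a i j * c j) - a i j0 * s / a i0 j0" for i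
    proof -
      have "(\<Sum>j\<in>J'. a i j * c' j) = (\<Sum>j\<in>J'. a i j * c j)"
        using J'(3) by (intro sum.cong) (auto simp: c'_def)
      then show ?thesis using J' by (simp add: c'_def)
    qed
    have "(\<Sum>j\<in>J. a i j * c' j) = 0" if "i \<in> I" for i
    proof -
      have "0 = (\<Sum>j\<in>J'. a' i j * c j)" using c(2) that by simp
      also have "\<dots> = (\<Sum>j\<in>J'. a i j * c j - a i j0 / a i0 j0 * (a i0 j * c j))"
        by (intro sum.cong) (auto simp: a'_def algebra_simps)
      also have "\<dots> = (\<Sum>j\<in>J'. a i j * c j) - a i j0 / a i0 j0 * s"
        unfolding s_def by (simp add: sum_subtractf sum_distrib_left)
      finally show ?thesis using sum_c' by simp
    qed
    moreover have "(\<Sum>j\<in>J. a i0 j * c' j) = 0" using sum_c'[of i0] j0 by (simp add: s_def)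
    moreover have "\<exists>j\<in>J. c' j \<noteq> 0" using c(1) J' by (auto simp: c'_def)
    ultimately show ?thesis by blast
  qed
qed

lemma basis_modD:
  assumes "basis_mod sm V W I b"
  shows "finite I" "\<And>i. i \<in> I \<Longrightarrow> b i \<in> V"
    "\<And>v. v \<in> V \<Longrightarrow> \<exists>c. v - (\<Sum>i\<in>I. sm (c i) (b i)) \<in> W"
    "\<And>c. (\<Sum>i\<in>I. sm (c i) (b i)) \<in> W \<Longrightarrow> \<forall>i\<in>I. c i = 0"
  using assms unfolding basis_mod_def by simp_all

context vector_space
begin

text \<open>Steinitz' inequality modulo a subspace, for families (which may have repetitions) instead of
  sets.\<close>

lemma card_le_if_spanned_mod:
  assumes W: "subspace W" and fin: "finite I" "finite J"
    and span: "\<And>j. j \<in> J \<Longrightarrow> \<exists>c. y j - (\<Sum>i\<in>I. c i *s b i) \<in> W"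
    and indep: "\<And>c. (\<Sum>j\<in>J. c j *s y j) \<in> W \<Longrightarrow> \<forall>j\<in>J. c j = 0"
  shows "card J \<le> card I"
proof (rule ccontr)
  assume "\<not> card J \<le> card I"
  then have less: "card I < card J" by simp
  obtain A where A: "\<And>j. j \<in> J \<Longrightarrow> y j - (\<Sum>i\<in>I. A j i *s b i) \<in> W"
    using span by metis
  obtain c where c: "\<exists>j\<in>J. c j \<noteq> 0" "\<forall>i\<in>I. (\<Sum>j\<in>J. A j i * c j) = 0"
    using underdetermined_system[OF fin less, of "\<lambda>i j. A j i"] by blast
  have "(\<Sum>j\<in>J. c j *s (y j - (\<Sum>i\<in>I. A j i *s b i))) \<in> W"
    by (intro subspace_sum subspace_scale W A)
  also have "(\<Sum>j\<in>J. c j *s (y j - (\<Sum>i\<in>I. A j i *s b i))) =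
      (\<Sum>j\<in>J. c j *s y j) - (\<Sum>j\<in>J. \<Sum>i\<in>I. (A j i * c j) *s b i)"
    by (simp add: scale_right_diff_distrib sum_subtractf scale_sum_right mult.commute)
  also have "(\<Sum>j\<in>J. \<Sum>i\<in>I. (A j i * c j) *s b i) = (\<Sum>i\<in>I. (\<Sum>j\<in>J. A j i * c j) *s b i)"
    by (subst sum.swap) (simp add: scale_sum_left)
  also have "\<dots> = 0" using c(2) by simp
  finally have "(\<Sum>j\<in>J. c j *s y j) \<in> W" by simp
  with indep c(1) show False by blast
qed

lemma basis_mod_card_eq:
  assumes W: "subspace W" and b: "basis_mod scale V W I b" and y: "basis_mod scale V W J y"
  shows "card I = card J"
proof (rule antisym)
  show "card I \<le> card J"
    using b y by (intro card_le_if_spanned_mod[OF W, of J I b y]) (auto simp: basis_mod_def)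
  show "card J \<le> card I"
    using b y by (intro card_le_if_spanned_mod[OF W, of I J y b]) (auto simp: basis_mod_def)
qed

text \<open>A family that is independent modulo \<open>W\<close> and as long as a basis of \<open>V / W\<close> spans \<open>V\<close>
  modulo \<open>W\<close>: adding any vector to it gives a dependent family.\<close>

lemma spans_mod_if_card_eq:
  assumes W: "subspace W" and b: "basis_mod scale V W I b" and J: "finite J"
    and yV: "\<And>j. j \<in> J \<Longrightarrow> y j \<in> V" and card: "card J = card I"
    and indep: "\<And>c. (\<Sum>j\<in>J. c j *s y j) \<in> W \<Longrightarrow> \<forall>j\<in>J. c j = 0"
    and v: "v \<in> V"
  shows "\<exists>c. v - (\<Sum>j\<in>J. c j *s y j) \<in> W"
proof (rule ccontr)
  assume neg: "\<nexists>c. v - (\<Sum>j\<in>J. c j *s y j) \<in> W"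
  define y' where "y' = case_option v y"
  define J' where "J' = insert None (Some ` J)"
  have sum_J': "(\<Sum>j\<in>J'. c j *s y' j) = c None *s v + (\<Sum>j\<in>J. c (Some j) *s y j)" for c
    using J by (simp add: J'_def y'_def sum.reindex)
  have "card J' \<le> card I"
  proof (rule card_le_if_spanned_mod[OF W])
    show "finite I" using b by (simp add: basis_mod_def)
    show "finite J'" using J by (simp add: J'_def)
    show "\<exists>c. y' j - (\<Sum>i\<in>I. c i *s b i) \<in> W" if "j \<in> J'" for j
      using that b v yV by (auto simp: basis_mod_def J'_def y'_def)
    show "\<forall>j\<in>J'. c j = 0" if "(\<Sum>j\<in>J'. c j *s y' j) \<in> W" for c
    proof -
      have mem: "c None *s v + (\<Sum>j\<in>J. c (Some j) *s y j) \<in> W" using that sum_J' by simp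
      have c0: "c None = 0"
      proof (rule ccontr)
        assume n: "c None \<noteq> 0"
        have "inverse (c None) *s (c None *s v + (\<Sum>j\<in>J. c (Some j) *s y j)) \<in> W"
          by (rule subspace_scale[OF W mem])
        then have "v - (\<Sum>j\<in>J. (- inverse (c None) * c (Some j)) *s y j) \<in> W"
          using n by (simp add: scale_right_distrib scale_sum_right sum_negf)
        then show False
          using neg[unfolded not_ex, rule_format, of "\<lambda>j. - inverse (c None) * c (Some j)"]
          by contradiction
      qed
      then have "(\<Sum>j\<in>J. c (Some j) *s y j) \<in> W" using mem by simp
      then have "\<forall>j\<in>J. c (Some j) = 0" by (rule indep)
      then show ?thesis using c0 by (simp add: J'_def)
    qed
  qed
  moreover have "card J' = Suc (card J)" using J by (simp add: J'_def card_image)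
  ultimately show False using card by simp
qed

end


section \<open>Evaluation of multivariate polynomials\<close>

text \<open>The value of a monomial at \<open>x\<close>, its degree, and the variable \<open>i\<close> as a polynomial.\<close>

abbreviation power_product :: "('v \<Rightarrow> 'r::comm_ring_1) \<Rightarrow> ('v \<Rightarrow>\<^sub>0 nat) \<Rightarrow> 'r" where
  "power_product x m \<equiv> (\<Prod>i\<in>Poly_Mapping.keys m. x i ^ Poly_Mapping.lookup m i)"

abbreviation total_degree :: "('v \<Rightarrow>\<^sub>0 nat) \<Rightarrow> nat" where
  "total_degree m \<equiv> (\<Sum>i\<in>Poly_Mapping.keys m. Poly_Mapping.lookup m i)"

abbreviation var_mpol :: "'v \<Rightarrow> ('v, 'k::comm_ring_1) mpol" where
  "var_mpol i \<equiv> Poly_Mapping.single (Poly_Mapping.single i (Suc 0)) 1"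

lemma power_product_add: "power_product x (m + n) = power_product x m * power_product x n"
proof -
  let ?S = "Poly_Mapping.keys m \<union> Poly_Mapping.keys n"
  have ext: "power_product x k = (\<Prod>i\<in>?S. x i ^ Poly_Mapping.lookup k i)"
    if "Poly_Mapping.keys k \<subseteq> ?S" for k
    using that by (intro prod.mono_neutral_left) (auto simp: in_keys_iff)
  show ?thesis
    unfolding ext[OF Poly_Mapping.keys_add] ext[OF Un_upper1] ext[OF Un_upper2]
    by (simp add: lookup_add power_add prod.distrib)
qed

lemma total_degree_add: "total_degree (m + n) = total_degree m + total_degree n"
proof -
  let ?S = "Poly_Mapping.keys m \<union> Poly_Mapping.keys n"
  have ext: "total_degree k = (\<Sum>i\<in>?S. Poly_Mapping.lookup k i)"
    if "Poly_Mapping.keys k \<subseteq> ?S" for k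
    using that by (intro sum.mono_neutral_left) (auto simp: in_keys_iff)
  show ?thesis
    unfolding ext[OF Poly_Mapping.keys_add] ext[OF Un_upper1] ext[OF Un_upper2]
    by (simp add: lookup_add sum.distrib)
qed

lemma homogeneous_0: "homogeneous e 0"
  by (simp add: homogeneous_def)

lemma homogeneous_1: "homogeneous 0 (1 :: ('v, 'k::comm_ring_1) mpol)"
  by (simp add: homogeneous_def)

lemma homogeneous_const: "homogeneous 0 (Poly_Mapping.single 0 c)"
  by (simp add: homogeneous_def)

lemma homogeneous_var: "homogeneous 1 (var_mpol i :: ('v, 'k::comm_ring_1) mpol)"
  by (simp add: homogeneous_def)

lemma homogeneous_add:
  fixes F G :: "('v, 'k::comm_ring_1) mpol"
  shows "homogeneous e F \<Longrightarrow> homogeneous e G \<Longrightarrow> homogeneous e (F + G)"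
  using Poly_Mapping.keys_add[of F G] unfolding homogeneous_def by blast

lemma homogeneous_uminus:
  fixes F :: "('v, 'k::comm_ring_1) mpol"
  shows "homogeneous e F \<Longrightarrow> homogeneous e (- F)"
  unfolding homogeneous_def by (simp add: in_keys_iff)

lemma homogeneous_mult:
  fixes F G :: "('v, 'k::comm_ring_1) mpol"
  assumes "homogeneous e F" "homogeneous e' G"
  shows "homogeneous (e + e') (F * G)"
  unfolding homogeneous_def
proof
  fix m assume "m \<in> Poly_Mapping.keys (F * G)"
  with keys_mult[of F G] obtain a b where "m = a + b"
    "a \<in> Poly_Mapping.keys F" "b \<in> Poly_Mapping.keys G" by blast
  then show "total_degree m = e + e'"
    using assms unfolding homogeneous_def by (metis total_degree_add)
qed

lemma homogeneous_power:
  fixes F :: "('v, 'k::comm_ring_1) mpol"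
  shows "homogeneous e F \<Longrightarrow> homogeneous (n * e) (F ^ n)"
  by (induction n) (auto simp: homogeneous_1 intro: homogeneous_mult)

text \<open>Evaluation is a ring homomorphism if \<open>h\<close> is one.\<close>

locale coefficient_hom =
  fixes h :: "'k::comm_ring_1 \<Rightarrow> 'r::comm_ring_1"
  assumes h_one: "h 1 = 1"
    and h_add: "h (a + b) = h a + h b"
    and h_mult: "h (a * b) = h a * h b"
begin

lemma h_zero: "h 0 = 0"
  using h_add[of 0 0] by simp

lemma h_uminus: "h (- a) = - h a"
proof -
  have "h (- a) + h a = 0" by (simp add: h_zero flip: h_add)
  then show ?thesis by (simp add: eq_neg_iff_add_eq_0)
qed

lemma h_power: "h (a ^ n) = h a ^ n"
  by (induction n) (simp_all add: h_one h_mult)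

lemma mpol_eval_superset:
  assumes "finite S" "Poly_Mapping.keys F \<subseteq> S"
  shows "mpol_eval h x F = (\<Sum>m\<in>S. h (Poly_Mapping.lookup F m) * power_product x m)"
  unfolding mpol_eval_def using assms
  by (intro sum.mono_neutral_left) (auto simp: in_keys_iff h_zero)

lemma mpol_eval_0: "mpol_eval h x 0 = 0"
  by (simp add: mpol_eval_def)

lemma mpol_eval_add: "mpol_eval h x (F + G) = mpol_eval h x F + mpol_eval h x G"
proof -
  let ?S = "Poly_Mapping.keys F \<union> Poly_Mapping.keys G"
  show ?thesis using Poly_Mapping.keys_add[of F G]
    by (simp add: mpol_eval_superset[of ?S] lookup_add h_add distrib_right sum.distrib)
qed

lemma mpol_eval_diff: "mpol_eval h x (F - G) = mpol_eval h x F - mpol_eval h x G"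
  using mpol_eval_add[of x "F - G" G] by simp

lemma mpol_eval_sum: "mpol_eval h x (\<Sum>i\<in>S. F i) = (\<Sum>i\<in>S. mpol_eval h x (F i))"
  by (induction S rule: infinite_finite_induct) (auto simp: mpol_eval_0 mpol_eval_add)

lemma mpol_eval_single: "mpol_eval h x (Poly_Mapping.single m a) = h a * power_product x m"
  by (subst mpol_eval_superset[of "{m}"]) auto

lemma mpol_eval_const: "mpol_eval h x (Poly_Mapping.single 0 a) = h a"
  by (simp add: mpol_eval_single)

lemma mpol_eval_1: "mpol_eval h x 1 = 1"
  using mpol_eval_const[of x 1] by (simp add: h_one)

lemma mpol_eval_var:
  "mpol_eval h x (var_mpol i) = x i"
  by (simp add: mpol_eval_single h_one)

lemma mpol_as_sum:
  "F = (\<Sum>m\<in>Poly_Mapping.keys F. Poly_Mapping.single m (Poly_Mapping.lookup F m))"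
  by (rule poly_mapping_eqI)
     (auto simp: lookup_sum lookup_single when_def sum.delta in_keys_iff)

lemma mpol_eval_mult: "mpol_eval h x (F * G) = mpol_eval h x F * mpol_eval h x G"
proof -
  let ?f = "\<lambda>F m. Poly_Mapping.single m (Poly_Mapping.lookup F m)"
  have "F * G = (\<Sum>m\<in>Poly_Mapping.keys F. ?f F m) * (\<Sum>n\<in>Poly_Mapping.keys G. ?f G n)"
    using mpol_as_sum[of F] mpol_as_sum[of G] by simp
  also have "\<dots> = (\<Sum>m\<in>Poly_Mapping.keys F. \<Sum>n\<in>Poly_Mapping.keys G. ?f F m * ?f G n)"
    by (rule sum_product)
  finally have "mpol_eval h x (F * G) =
     (\<Sum>m\<in>Poly_Mapping.keys F. \<Sum>n\<in>Poly_Mapping.keys G.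
        (h (Poly_Mapping.lookup F m) * power_product x m) *
        (h (Poly_Mapping.lookup G n) * power_product x n))"
    by (simp only: mpol_eval_sum mult_single mpol_eval_single h_mult power_product_add
        mult.assoc mult.left_commute)
  also have "\<dots> = mpol_eval h x F * mpol_eval h x G"
    unfolding mpol_eval_def by (rule sum_product[symmetric])
  finally show ?thesis .
qed

lemma mpol_eval_power: "mpol_eval h x (F ^ n) = mpol_eval h x F ^ n"
  by (induction n) (simp_all add: mpol_eval_1 mpol_eval_mult)

lemma mpol_eval_scaled:
  assumes "homogeneous e F"
  shows "mpol_eval h (\<lambda>i. c * x i) F = c ^ e * mpol_eval h x F"
proof -
  have "power_product (\<lambda>i. c * x i) m = c ^ e * power_product x m"
    if "m \<in> Poly_Mapping.keys F" for m
    using assms that unfolding homogeneous_def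
    by (auto simp: power_mult_distrib prod.distrib power_sum)
  then show ?thesis
    unfolding mpol_eval_def sum_distrib_left by (intro sum.cong) auto
qed

end


section \<open>Subrings, ideals and Nakayama's lemma\<close>

text \<open>Subrings and ideals as sets of elements of a commutative ring.\<close>

locale subring_set =
  fixes A :: "'a::comm_ring_1 set"
  assumes one_closed: "1 \<in> A"
    and add_closed: "a \<in> A \<Longrightarrow> b \<in> A \<Longrightarrow> a + b \<in> A"
    and mult_closed: "a \<in> A \<Longrightarrow> b \<in> A \<Longrightarrow> a * b \<in> A"
    and uminus_closed: "a \<in> A \<Longrightarrow> - a \<in> A"
begin

lemma zero_closed: "0 \<in> A"
  using add_closed[OF one_closed uminus_closed[OF one_closed]] by simp

lemma diff_closed: "a \<in> A \<Longrightarrow> b \<in> A \<Longrightarrow> a - b \<in> A"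
  using add_closed[of a "- b"] uminus_closed by simp

lemma sum_closed: "(\<And>i. i \<in> S \<Longrightarrow> f i \<in> A) \<Longrightarrow> sum f S \<in> A"
  by (induction S rule: infinite_finite_induct) (auto intro: zero_closed add_closed)

lemma prod_closed: "(\<And>i. i \<in> S \<Longrightarrow> f i \<in> A) \<Longrightarrow> prod f S \<in> A"
  by (induction S rule: infinite_finite_induct) (auto intro: one_closed mult_closed)

lemma power_closed: "a \<in> A \<Longrightarrow> a ^ n \<in> A"
  by (induction n) (auto intro: one_closed mult_closed)

end

locale ideal_set = subring_set +
  fixes I
  assumes ideal_subset: "I \<subseteq> A"
    and ideal_zero: "0 \<in> I"
    and ideal_add: "a \<in> I \<Longrightarrow> b \<in> I \<Longrightarrow> a + b \<in> I"
    and ideal_mult: "a \<in> A \<Longrightarrow> b \<in> I \<Longrightarrow> a * b \<in> I"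
begin

lemma ideal_mult': "b \<in> I \<Longrightarrow> a \<in> A \<Longrightarrow> b * a \<in> I"
  using ideal_mult[of a b] by (simp add: mult.commute)

lemma ideal_uminus: "a \<in> I \<Longrightarrow> - a \<in> I"
  using ideal_mult[of "-1" a] by (simp add: one_closed uminus_closed)

lemma ideal_sum: "(\<And>i. i \<in> S \<Longrightarrow> f i \<in> I) \<Longrightarrow> sum f S \<in> I"
  by (induction S rule: infinite_finite_induct) (auto intro: ideal_zero ideal_add)

lemma mult_cong_ideal:
  assumes "a \<in> A" "b' \<in> A" "a - a' \<in> I" "b - b' \<in> I"
  shows "a * b - a' * b' \<in> I"
proof -
  have "a * b - a' * b' = a * (b - b') + b' * (a - a')" by (simp add: algebra_simps)
  then show ?thesis using assms by (auto intro: ideal_add ideal_mult)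
qed

lemma power_cong_ideal:
  assumes "a \<in> A" "b \<in> A" "a - b \<in> I"
  shows "a ^ n - b ^ n \<in> I"
  by (induction n) (auto intro!: mult_cong_ideal power_closed assms ideal_zero)

lemma prod_cong_ideal:
  assumes "\<And>i. i \<in> S \<Longrightarrow> f i \<in> A" "\<And>i. i \<in> S \<Longrightarrow> g i \<in> A"
    and "\<And>i. i \<in> S \<Longrightarrow> f i - g i \<in> I"
  shows "prod f S - prod g S \<in> I"
  using assms
  by (induction S rule: infinite_finite_induct)
     (auto intro!: mult_cong_ideal prod_closed ideal_zero)

text \<open>Polynomials with coefficients in the subring respect congruence modulo the ideal.\<close>

lemma mpol_eval_cong_ideal:
  assumes "\<And>c. h c \<in> A" "\<And>i. u i \<in> A" "\<And>i. w i \<in> A" "\<And>i. u i - w i \<in> I"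
  shows "mpol_eval h u F - mpol_eval h w F \<in> I"
  unfolding mpol_eval_def sum_subtractf[symmetric] right_diff_distrib[symmetric]
  by (intro ideal_sum ideal_mult prod_cong_ideal power_cong_ideal power_closed assms)

text \<open>Nakayama's lemma, for \<open>A\<close> local with maximal ideal \<open>I\<close>: finitely many elements that are
  modulo \<open>N\<close> linear combinations of each other with coefficients in \<open>I\<close> lie in \<open>N\<close>. The proof
  eliminates them one after the other.\<close>

lemma nakayama:
  assumes loc: "\<And>a. a \<in> A \<Longrightarrow> a \<notin> I \<Longrightarrow> \<exists>b\<in>A. a * b = 1" and "1 \<notin> I"
    and N: "ideal_set A N"
    and "finite S"
    and "\<And>s. s \<in> S \<Longrightarrow> \<exists>m. range m \<subseteq> I \<and> l s - (\<Sum>r\<in>S. m r * l r) \<in> N"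
  shows "\<forall>s\<in>S. l s \<in> N"
  using assms(4,5)
proof (induction S rule: finite_induct)
  case empty
  then show ?case by simp
next
  case (insert a S)
  interpret N: ideal_set A N by (rule N)
  obtain m where m: "\<And>s. s \<in> insert a S \<Longrightarrow> range (m s) \<subseteq> I"
    "\<And>s. s \<in> insert a S \<Longrightarrow> l s - (\<Sum>r\<in>insert a S. m s r * l r) \<in> N"
    using insert.prems by metis
  have mI: "m s r \<in> I" if "s \<in> insert a S" for s r using m(1)[OF that] by blast
  have "1 - m a a \<in> A" using mI[of a a] ideal_subset one_closed diff_closed by blast
  moreover have "1 - m a a \<notin> I" using ideal_add[of "1 - m a a" "m a a"] mI[of a a] \<open>1 \<notin> I\<close> by auto
  ultimately obtain b where b: "b \<in> A" "(1 - m a a) * b = 1" using loc by blast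
  define m' where "m' s r = m s r + m s a * b * m a r" for s r
  \<comment> \<open>Substituting the expression for \<open>l a\<close> eliminates \<open>a\<close> from the other relations.\<close>
  have red: "l s - (\<Sum>r\<in>S. m' s r * l r) =
      (l s - (\<Sum>r\<in>insert a S. m s r * l r)) + m s a * b * (l a - (\<Sum>r\<in>insert a S. m a r * l r))"
    for s
  proof -
    have "m s a * b * (l a - (m a a * l a + (\<Sum>r\<in>S. m a r * l r))) =
        m s a * l a * ((1 - m a a) * b) - (\<Sum>r\<in>S. m s a * b * m a r * l r)"
      by (simp add: algebra_simps sum_distrib_left)
    moreover have "b * (l a * m s a) - b * (l a * (m a a * m s a)) = l a * m s a"
      using arg_cong[OF b(2), of "\<lambda>c. c * (l a * m s a)"] by (simp add: algebra_simps)
    ultimately show ?thesis using insert.hyps b(2)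
      by (simp add: m'_def algebra_simps sum.distrib)
  qed
  have S: "\<forall>s\<in>S. l s \<in> N"
  proof (rule insert.IH)
    fix s assume s: "s \<in> S"
    have "range (m' s) \<subseteq> I"
      using s mI ideal_subset b(1) unfolding m'_def
      by (auto intro!: ideal_add ideal_mult mult_closed)
    moreover have "l s - (\<Sum>r\<in>S. m' s r * l r) \<in> N"
      unfolding red using s mI ideal_subset b(1) m(2)
      by (intro N.ideal_add N.ideal_mult mult_closed) auto
    ultimately show "\<exists>m. range m \<subseteq> I \<and> l s - (\<Sum>r\<in>S. m r * l r) \<in> N" by blast
  qed
  have "l a = b * ((l a - (\<Sum>r\<in>insert a S. m a r * l r)) + (\<Sum>r\<in>S. m a r * l r))"
  proof -
    have "l a = l a * ((1 - m a a) * b)" using b by simp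
    also have "\<dots> = b * (l a - m a a * l a)" by (simp add: algebra_simps)
    finally show ?thesis using insert.hyps by simp
  qed
  also have "\<dots> \<in> N"
    using m(2)[of a] S mI[of a] ideal_subset b(1)
    by (intro N.ideal_mult N.ideal_add N.ideal_sum) auto
  finally show ?case using S by simp
qed

end

lemma (in coefficient_hom) mpol_eval_hom_args:
  "mpol_eval h (\<lambda>i. h (w i)) F = h (mpol_eval (\<lambda>c. c) w F)"
proof -
  have h_sum: "h (sum f S) = (\<Sum>i\<in>S. h (f i))" for f S
    by (induction S rule: infinite_finite_induct) (auto simp: h_zero h_add)
  have h_prod: "h (prod f S) = (\<Prod>i\<in>S. h (f i))" for f S
    by (induction S rule: infinite_finite_induct) (auto simp: h_one h_mult)
  show ?thesis unfolding mpol_eval_def by (simp add: h_sum h_prod h_mult h_power)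
qed

interpretation value_at: coefficient_hom "\<lambda>c::'k::comm_ring_1. c"
  by unfold_locales auto


section \<open>Local rings of a smooth curve\<close>

text \<open>A point of the curve, given by homogeneous coordinates \<open>p\<close>, the \<open>j\<close>-th of which does not
  vanish. Within the locale, \<open>A\<close> and \<open>M\<close> are the local ring and its maximal ideal, \<open>val\<close> is the
  evaluation of forms at \<open>p\<close>, and \<open>gv\<close> the evaluation at the generic point.\<close>

locale curve_at =
  fixes X :: "('k::field, 'K::field, 'n::finite) variety" and p :: "'n \<Rightarrow> 'k" and j :: 'n
  assumes curve: "smooth_projective_curve X"
    and point: "proj_point p \<in> points X"
    and coord: "p j \<noteq> 0"

lemma smooth_projective_curve_coefficient_hom:
  assumes "smooth_projective_curve X" shows "coefficient_hom (scalar X)"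
  using assms unfolding smooth_projective_curve_def projective_variety_def
  by unfold_locales auto

sublocale curve_at \<subseteq> sc: coefficient_hom "scalar X"
  by (rule smooth_projective_curve_coefficient_hom[OF curve])

context curve_at
begin

abbreviation "A \<equiv> local_ring X (proj_point p)"
abbreviation "M \<equiv> local_max_ideal X (proj_point p)"
abbreviation "val \<equiv> mpol_eval (\<lambda>c. c) p"
abbreviation "gv \<equiv> generic_value X"

lemma vanishes_iff:
  assumes "homogeneous e F"
  shows "vanishes_at F (proj_point p) \<longleftrightarrow> val F = 0"
proof -
  have "mpol_eval (\<lambda>c. c) (\<lambda>i. c * p i) F = c ^ e * val F" for c
    by (rule value_at.mpol_eval_scaled[OF assms])
  then show ?thesis
    unfolding vanishes_at_def proj_point_def by (auto intro: exI[of _ 1])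
qed

lemma gv_eq_0_imp:
  assumes "homogeneous e F" "gv F = 0" shows "val F = 0"
proof -
  have "\<forall>Q\<in>points X. vanishes_at F Q"
    using assms curve unfolding smooth_projective_curve_def projective_variety_def by blast
  then show ?thesis using point vanishes_iff[OF assms(1)] by blast
qed

lemma mem_A: "f \<in> A \<longleftrightarrow>
   (\<exists>e F G. homogeneous e F \<and> homogeneous e G \<and> val G \<noteq> 0 \<and> f = gv F / gv G)"
  unfolding local_ring_def using vanishes_iff by blast

lemma mem_M: "f \<in> M \<longleftrightarrow>
   (\<exists>e F G. homogeneous e F \<and> homogeneous e G \<and> val G \<noteq> 0 \<and> val F = 0 \<and> f = gv F / gv G)"
  unfolding local_max_ideal_def using vanishes_iff by blast

lemma fraction_mem_A: "homogeneous e F \<Longrightarrow> homogeneous e G \<Longrightarrow> val G \<noteq> 0 \<Longrightarrow> gv F / gv G \<in> A"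
  unfolding mem_A by blast

lemma fraction_mem_M:
  "homogeneous e F \<Longrightarrow> homogeneous e G \<Longrightarrow> val G \<noteq> 0 \<Longrightarrow> val F = 0 \<Longrightarrow> gv F / gv G \<in> M"
  unfolding mem_M by blast

lemmas eval_simps =
  sc.mpol_eval_add sc.mpol_eval_mult sc.mpol_eval_diff sc.mpol_eval_1 sc.mpol_eval_0
  sc.mpol_eval_const sc.mpol_eval_var sc.mpol_eval_power
  value_at.mpol_eval_add value_at.mpol_eval_mult value_at.mpol_eval_diff value_at.mpol_eval_1
  value_at.mpol_eval_0 value_at.mpol_eval_const value_at.mpol_eval_var value_at.mpol_eval_power

text \<open>Two elements of the local ring have a common denominator.\<close>

lemma common_denominator:
  assumes "f \<in> A" "g \<in> A"
  obtains e F G H where "homogeneous e F" "homogeneous e G" "homogeneous e H" "val H \<noteq> 0"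
    "f = gv F / gv H" "g = gv G / gv H" "gv H \<noteq> 0"
proof -
  obtain e F G where f: "homogeneous e F" "homogeneous e G" "val G \<noteq> 0" "f = gv F / gv G"
    using assms(1) unfolding mem_A by blast
  obtain e' F' G' where g: "homogeneous e' F'" "homogeneous e' G'" "val G' \<noteq> 0" "g = gv F' / gv G'"
    using assms(2) unfolding mem_A by blast
  have nz: "gv G \<noteq> 0" "gv G' \<noteq> 0" using f g gv_eq_0_imp by blast+
  show ?thesis
    by (rule that[of "e + e'" "F * G'" "G * F'" "G * G'"])
       (use f g nz in \<open>auto simp: eval_simps intro: homogeneous_mult\<close>)
qed

lemma scalar_mem_A: "scalar X c \<in> A"
  using fraction_mem_A[OF homogeneous_const homogeneous_const, of 1 c]
  by (simp add: eval_simps sc.h_one)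

lemma subring_A: "subring_set A"
proof
  show "1 \<in> A" using scalar_mem_A[of 1] by (simp add: sc.h_one)
  show "f + g \<in> A" if "f \<in> A" "g \<in> A" for f g
  proof -
    from common_denominator[OF that] obtain e F G H where *: "homogeneous e F" "homogeneous e G"
      "homogeneous e H" "val H \<noteq> 0" "f = gv F / gv H" "g = gv G / gv H" "gv H \<noteq> 0" by blast
    then show ?thesis using fraction_mem_A[OF homogeneous_add[OF *(1,2)] *(3,4)]
      by (simp add: eval_simps add_divide_distrib)
  qed
  show mult: "f * g \<in> A" if "f \<in> A" "g \<in> A" for f g
  proof -
    from common_denominator[OF that] obtain e F G H where *: "homogeneous e F" "homogeneous e G"
      "homogeneous e H" "val H \<noteq> 0" "f = gv F / gv H" "g = gv G / gv H" "gv H \<noteq> 0" by blast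
    then show ?thesis using fraction_mem_A[OF homogeneous_mult[OF *(1,2)] homogeneous_mult[OF *(3,3)]]
      by (simp add: eval_simps)
  qed
  show "- f \<in> A" if "f \<in> A" for f
    using mult[OF scalar_mem_A[of "-1"] that] by (simp add: sc.h_uminus sc.h_one)
qed

end

sublocale curve_at \<subseteq> loc: subring_set "local_ring X (proj_point p)"
  by (rule subring_A)

context curve_at
begin

lemma M_subset_A: "M \<subseteq> A"
proof
  fix f assume "f \<in> M"
  then show "f \<in> A" unfolding mem_A mem_M by blast
qed

lemma ideal_M: "ideal_set A M"
proof
  show "M \<subseteq> A" by (rule M_subset_A)
  show "0 \<in> M" using fraction_mem_M[OF homogeneous_0 homogeneous_1] by (simp add: eval_simps)
  show "f + g \<in> M" if "f \<in> M" "g \<in> M" for f g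
  proof -
    obtain e F G where f: "homogeneous e F" "homogeneous e G" "val G \<noteq> 0" "val F = 0"
      "f = gv F / gv G" using \<open>f \<in> M\<close> unfolding mem_M by blast
    obtain e' F' G' where g: "homogeneous e' F'" "homogeneous e' G'" "val G' \<noteq> 0" "val F' = 0"
      "g = gv F' / gv G'" using \<open>g \<in> M\<close> unfolding mem_M by blast
    have nz: "gv G \<noteq> 0" "gv G' \<noteq> 0" using f g gv_eq_0_imp by blast+
    have "gv (F * G' + G * F') / gv (G * G') \<in> M"
      by (rule fraction_mem_M[of "e + e'"])
         (use f g in \<open>auto simp: eval_simps intro!: homogeneous_add homogeneous_mult\<close>)
    then show ?thesis using f g nz by (simp add: eval_simps add_divide_distrib)
  qed
  show "f * g \<in> M" if "f \<in> A" "g \<in> M" for f g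
  proof -
    obtain e F G where f: "homogeneous e F" "homogeneous e G" "val G \<noteq> 0" "f = gv F / gv G"
      using \<open>f \<in> A\<close> unfolding mem_A by blast
    obtain e' F' G' where g: "homogeneous e' F'" "homogeneous e' G'" "val G' \<noteq> 0" "val F' = 0"
      "g = gv F' / gv G'" using \<open>g \<in> M\<close> unfolding mem_M by blast
    have "gv (F * F') / gv (G * G') \<in> M"
      by (rule fraction_mem_M[of "e + e'"])
         (use f g in \<open>auto simp: eval_simps intro!: homogeneous_mult\<close>)
    then show ?thesis using f g by (simp add: eval_simps)
  qed
qed

end

sublocale curve_at \<subseteq> max: ideal_set "local_ring X (proj_point p)" "local_max_ideal X (proj_point p)"
  by (rule ideal_M)

context curve_at
begin

lemma one_notin_M: "1 \<notin> M"
proof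
  assume "1 \<in> M"
  then obtain e F G where f: "homogeneous e F" "homogeneous e G" "val G \<noteq> 0" "val F = 0"
      "1 = gv F / gv G" unfolding mem_M by blast
  have "gv G \<noteq> 0" using f gv_eq_0_imp by blast
  then have "gv (F + - G) = 0" using f by (simp add: eval_simps)
  then have "val (F + - G) = 0" using gv_eq_0_imp homogeneous_add homogeneous_uminus f by blast
  then show False using f by (simp add: eval_simps)
qed

lemma inverse_mem_A:
  assumes "f \<in> A" "f \<notin> M" shows "inverse f \<in> A" "f \<noteq> 0"
proof -
  obtain e F G where f: "homogeneous e F" "homogeneous e G" "val G \<noteq> 0" "f = gv F / gv G"
    using assms(1) unfolding mem_A by blast
  then have "val F \<noteq> 0" using assms(2) unfolding mem_M by blast
  then show "inverse f \<in> A" using fraction_mem_A[OF f(2,1)] f by simp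
  show "f \<noteq> 0" using assms max.ideal_zero by blast
qed

text \<open>The residue field is the ground field, because the point has coordinates in it.\<close>

lemma residue_scalar:
  assumes "f \<in> A" shows "\<exists>c. f - scalar X c \<in> M"
proof -
  obtain e F G where f: "homogeneous e F" "homogeneous e G" "val G \<noteq> 0" "f = gv F / gv G"
    using assms(1) unfolding mem_A by blast
  have nz: "gv G \<noteq> 0" using f gv_eq_0_imp by blast
  define c where "c = val F / val G"
  have c: "val F = c * val G" using f by (simp add: c_def)
  have "homogeneous (0 + e) (Poly_Mapping.single 0 (- c) * G)"
    by (rule homogeneous_mult[OF homogeneous_const f(2)])
  then have "gv (F + Poly_Mapping.single 0 (- c) * G) / gv G \<in> M"
    using f by (intro fraction_mem_M[of e] homogeneous_add) (auto simp: eval_simps c)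
  then have "f - scalar X c \<in> M"
    using f nz by (simp add: eval_simps diff_divide_distrib sc.h_uminus)
  then show ?thesis by blast
qed

lemma scalar_notin_M: "c \<noteq> 0 \<Longrightarrow> scalar X c \<notin> M"
proof
  assume "c \<noteq> 0" "scalar X c \<in> M"
  then have "scalar X (1 / c * c) \<in> M"
    unfolding sc.h_mult by (intro max.ideal_mult scalar_mem_A)
  then show False using \<open>c \<noteq> 0\<close> one_notin_M by (simp add: sc.h_one)
qed

lemma gcoord_nonzero: "gcoord X j \<noteq> 0"
  using gv_eq_0_imp[OF homogeneous_var[of j]] coord by (auto simp: eval_simps)

text \<open>The affine coordinates centred at the point.\<close>

definition local_coord :: "'n \<Rightarrow> 'K" where
  "local_coord i = gcoord X i / gcoord X j - scalar X (p i / p j)"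

lemma gcoord_ratio_mem_A: "gcoord X i / gcoord X j \<in> A"
  using fraction_mem_A[OF homogeneous_var[of i] homogeneous_var[of j]] coord
  by (simp add: eval_simps)

lemma local_coord_mem_M: "local_coord i \<in> M"
proof -
  let ?c = "\<lambda>c. Poly_Mapping.single 0 c * var_mpol j"
  have h: "homogeneous (0 + 1) (?c c)" for c
    by (rule homogeneous_mult[OF homogeneous_const homogeneous_var])
  have "gv (var_mpol i + ?c (- (p i / p j))) / gv (var_mpol j) \<in> M"
    using coord h by (intro fraction_mem_M[of 1] homogeneous_add homogeneous_var)
      (auto simp: eval_simps)
  then show ?thesis using gcoord_nonzero
    by (simp add: eval_simps local_coord_def diff_divide_distrib sc.h_uminus)
qed

text \<open>The maximal ideal is finitely generated: a form vanishing at the point is, after division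
  by a power of the \<open>j\<close>-th coordinate, congruent to its value at the point modulo the
  \<open>local_coord i\<close>.\<close>

lemma M_generated:
  assumes "f \<in> M" obtains a where "range a \<subseteq> A" "f = (\<Sum>i\<in>UNIV. a i * local_coord i)"
proof -
  let ?J = "{\<Sum>i\<in>UNIV. a i * local_coord i | a. range a \<subseteq> A}"
  interpret J: ideal_set A ?J
  proof
    show "?J \<subseteq> A"
      using local_coord_mem_M M_subset_A by (auto intro!: loc.sum_closed loc.mult_closed)
    show "0 \<in> ?J" using loc.zero_closed by (auto intro!: exI[of _ "\<lambda>_. 0"])
    show "f + g \<in> ?J" if fg: "f \<in> ?J" "g \<in> ?J" for f g
    proof -
      from fg obtain a b where ab: "range a \<subseteq> A" "f = (\<Sum>i\<in>UNIV. a i * local_coord i)"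
        "range b \<subseteq> A" "g = (\<Sum>i\<in>UNIV. b i * local_coord i)" by blast
      then show ?thesis
        by (auto intro!: exI[of _ "\<lambda>i. a i + b i"] loc.add_closed
            simp: sum.distrib distrib_right)
    qed
    show "f * g \<in> ?J" if fg: "f \<in> A" "g \<in> ?J" for f g
    proof -
      from fg obtain b where ab: "range b \<subseteq> A" "g = (\<Sum>i\<in>UNIV. b i * local_coord i)" by blast
      then show ?thesis using fg(1)
        by (auto intro!: exI[of _ "\<lambda>i. f * b i"] loc.mult_closed
            simp: sum_distrib_left mult.assoc)
    qed
  qed
  have lc: "local_coord i \<in> ?J" for i
  proof -
    have "local_coord i = (\<Sum>k\<in>UNIV. (if k = i then 1 else 0) * local_coord k)"
      by (simp add: if_distrib[of "\<lambda>c. c * _"] cong: if_cong)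
    moreover have "range (\<lambda>k. if k = i then 1 else 0) \<subseteq> A"
      by (auto intro: loc.one_closed loc.zero_closed)
    ultimately show ?thesis by (intro CollectI exI conjI)
  qed
  obtain e F G where f: "homogeneous e F" "homogeneous e G" "val G \<noteq> 0" "val F = 0"
      "f = gv F / gv G" using \<open>f \<in> M\<close> unfolding mem_M by blast
  let ?u = "\<lambda>i. gcoord X i / gcoord X j" and ?w = "\<lambda>i. scalar X (p i / p j)"
  have gv: "gv F = gcoord X j ^ e * mpol_eval (scalar X) ?u F"
    using sc.mpol_eval_scaled[OF f(1), of "gcoord X j" ?u] gcoord_nonzero by simp
  have "mpol_eval (\<lambda>c. c) (\<lambda>i. p i / p j) F = 0"
    using value_at.mpol_eval_scaled[OF f(1), of "1 / p j" p] f(4) by simp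
  then have w: "mpol_eval (scalar X) ?w F = 0"
    by (simp add: sc.mpol_eval_hom_args sc.h_zero)
  have "mpol_eval (scalar X) ?u F - mpol_eval (scalar X) ?w F \<in> ?J"
  proof (rule J.mpol_eval_cong_ideal)
    show "?u i - ?w i \<in> ?J" for i using lc[of i] by (simp only: local_coord_def)
  qed (rule scalar_mem_A gcoord_ratio_mem_A)+
  then have u: "mpol_eval (scalar X) ?u F \<in> ?J" using w by simp
  let ?L = "(var_mpol j :: ('n, 'k) mpol) ^ e"
  have "homogeneous (e * 1) ?L" by (rule homogeneous_power[OF homogeneous_var])
  then have "gv ?L / gv G \<in> A" using f by (intro fraction_mem_A[of e]) auto
  then have "gcoord X j ^ e / gv G \<in> A" by (simp add: eval_simps)
  from J.ideal_mult[OF this u] have "f \<in> ?J" using gv f(5) by simp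
  then show ?thesis using that by blast
qed

lemma M_square_combination:
  assumes "w \<in> ideal_prod (subring_on A) M M"
  shows "\<exists>m. range m \<subseteq> M \<and> w = (\<Sum>i\<in>UNIV. m i * local_coord i)"
  using assms
proof (induction w rule: ideal_prod.induct)
  case (prod f g)
  obtain a where a: "range a \<subseteq> A" "g = (\<Sum>i\<in>UNIV. a i * local_coord i)"
    using M_generated prod by blast
  then show ?case using prod
    by (intro exI[of _ "\<lambda>i. f * a i"])
       (auto simp: subring_on_def sum_distrib_left mult.assoc intro: max.ideal_mult')
next
  case (sum f g)
  then obtain a b where "range a \<subseteq> M" "f = (\<Sum>i\<in>UNIV. a i * local_coord i)"
    "range b \<subseteq> M" "g = (\<Sum>i\<in>UNIV. b i * local_coord i)" by blast
  then show ?case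
    by (intro exI[of _ "\<lambda>i. a i + b i"])
       (auto simp: subring_on_def sum.distrib distrib_right intro: max.ideal_add)
qed

text \<open>Smoothness provides \<open>t\<close> generating \<open>M\<close> modulo its square; by Nakayama's lemma, \<open>t\<close> generates
  \<open>M\<close>.\<close>

lemma ex_uniformizer: "\<exists>t. uniformizer X (proj_point p) t \<and> t \<in> M \<and> t \<noteq> 0"
proof -
  let ?M2 = "ideal_prod (subring_on A) M M"
  have "quotient_has_dim (scl X) M ?M2 1"
    using curve point unfolding smooth_projective_curve_def by blast
  then obtain b where b: "basis_mod (scl X) M ?M2 {..<1::nat} b"
    unfolding quotient_has_dim_def by blast
  define t where "t = b 0"
  have tM: "t \<in> M" using b by (simp add: basis_mod_def t_def)
  have span: "\<exists>c. f - scalar X c * t \<in> ?M2" if "f \<in> M" for f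
    using b that unfolding basis_mod_def by (auto simp: t_def)
  have "t \<notin> ?M2"
  proof
    assume "t \<in> ?M2"
    then have "(\<Sum>i<1. scl X 1 (b i)) \<in> ?M2" by (simp add: t_def sc.h_one)
    then have "\<forall>i\<in>{..<1::nat}. (1::'k) = 0"
      using b[unfolded basis_mod_def, THEN conjunct2, THEN conjunct2, THEN conjunct2,
          rule_format, of "\<lambda>_. 1"] by blast
    then show False by simp
  qed
  moreover have "0 \<in> ?M2"
    using ideal_prod.prod[of 0 M 0 M "subring_on A"] max.ideal_zero by (simp add: subring_on_def)
  ultimately have t0: "t \<noteq> 0" by auto
  let ?N = "{t * a | a. a \<in> A}"
  interpret N: ideal_set A ?N
  proof
    show "?N \<subseteq> A" using tM M_subset_A by (auto intro: loc.mult_closed)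
    show "0 \<in> ?N" using loc.zero_closed by force
    show "f + g \<in> ?N" if "f \<in> ?N" "g \<in> ?N" for f g
      using that by (auto simp flip: distrib_left intro: loc.add_closed)
    show "f * g \<in> ?N" if fg: "f \<in> A" "g \<in> ?N" for f g
    proof -
      obtain a where "a \<in> A" "g = t * a" using fg by blast
      then have "f * a \<in> A" "f * g = t * (f * a)" using fg by (auto intro: loc.mult_closed)
      then show ?thesis by blast
    qed
  qed
  have "\<forall>i\<in>UNIV. local_coord i \<in> ?N"
  proof (rule max.nakayama)
    show "\<exists>b\<in>A. a * b = 1" if "a \<in> A" "a \<notin> M" for a
      using inverse_mem_A[OF that] by (intro bexI[of _ "inverse a"]) auto
    show "1 \<notin> M" by (rule one_notin_M)
    show "ideal_set A ?N" by unfold_locales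
    show "finite (UNIV :: 'n set)" by simp
    fix i :: 'n
    obtain c where "local_coord i - scalar X c * t \<in> ?M2" using span local_coord_mem_M by blast
    then obtain m where m: "range m \<subseteq> M"
      "local_coord i - scalar X c * t = (\<Sum>r\<in>UNIV. m r * local_coord r)"
      using M_square_combination by blast
    then have "local_coord i - (\<Sum>r\<in>UNIV. m r * local_coord r) = t * scalar X c"
      by (simp add: algebra_simps)
    then show "\<exists>m. range m \<subseteq> M \<and> local_coord i - (\<Sum>r\<in>UNIV. m r * local_coord r) \<in> ?N"
      using m(1) scalar_mem_A by blast
  qed
  then have lN: "local_coord i \<in> ?N" for i by blast
  have "M \<subseteq> ?N"
  proof
    fix f assume "f \<in> M"
    then obtain a where a: "range a \<subseteq> A" "f = (\<Sum>i\<in>UNIV. a i * local_coord i)"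
      by (rule M_generated)
    have "(\<Sum>i\<in>UNIV. a i * local_coord i) \<in> ?N"
      using a(1) lN by (intro N.ideal_sum N.ideal_mult) auto
    then show "f \<in> ?N" using a(2) by simp
  qed
  moreover have "?N \<subseteq> M" using tM by (auto intro: max.ideal_mult')
  ultimately show ?thesis using tM t0 unfolding uniformizer_def by blast
qed

end


context curve_at
begin

text \<open>The intersection of the powers of the maximal ideal is zero. A function \<open>f\<close> in it satisfies
  a polynomial relation with \<open>t\<close>, as the function field has transcendence degree one. In the term
  \<open>c t\<^sup>a f\<^sup>b\<close> with \<open>b\<close>, then \<open>a\<close>, as small as possible, \<open>t\<^sup>a f\<^sup>b\<close> properly divides the monomials of
  all the other terms, so the constant \<open>c\<close> would be divisible by \<open>t\<close>.\<close>

lemma not_infinitely_divisible: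
  assumes t: "uniformizer X (proj_point p) t" and "t \<noteq> 0" and f: "f \<noteq> 0"
  shows "\<exists>n. \<forall>a\<in>A. f \<noteq> t ^ n * a"
proof (rule ccontr)
  assume "\<nexists>n. \<forall>a\<in>A. f \<noteq> t ^ n * a"
  then have div: "\<exists>a\<in>A. f = t ^ n * a" for n by blast
  have tA: "t \<in> A"
    using t M_subset_A loc.one_closed unfolding uniformizer_def by force
  have fA: "f \<in> A" using div[of 0] by auto
  let ?x = "\<lambda>i::nat. if i = 0 then t else f"
  have "\<not> alg_independent X {..<2} ?x"
    using curve unfolding smooth_projective_curve_def has_dimension_def
    by (metis One_nat_def Suc_1)
  then obtain F where F: "F \<in> mpols_in {..<2::nat}" "mpol_eval (scalar X) ?x F = 0" "F \<noteq> 0"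
    unfolding alg_independent_def by blast
  let ?K = "Poly_Mapping.keys F"
  have keys: "Poly_Mapping.keys m \<subseteq> {0, 1}" if "m \<in> ?K" for m
    using F(1) that unfolding mpols_in_def by (auto simp: lessThan_Suc numeral_2_eq_2)
  let ?e = Poly_Mapping.lookup
  have pp: "power_product ?x m = t ^ ?e m 0 * f ^ ?e m 1" if "m \<in> ?K" for m
  proof -
    have "power_product ?x m = (\<Prod>i\<in>{0, 1}. ?x i ^ ?e m i)"
      using keys[OF that] by (intro prod.mono_neutral_left) (auto simp: in_keys_iff)
    then show ?thesis by simp
  qed
  have "?K \<noteq> {}" using F(3) by simp
  then obtain m1 where m1: "m1 \<in> ?K" "\<And>m. m \<in> ?K \<Longrightarrow> ?e m1 1 \<le> ?e m 1"
    using ex_min_if_finite[of "(\<lambda>m. ?e m 1) ` ?K"] by (auto simp: not_less)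
  define b where "b = ?e m1 1"
  let ?K' = "{m \<in> ?K. ?e m 1 = b}"
  have "?K' \<noteq> {}" "finite ?K'" using m1 by (auto simp: b_def)
  then obtain m0 where m0: "m0 \<in> ?K'" "\<And>m. m \<in> ?K' \<Longrightarrow> ?e m0 0 \<le> ?e m 0"
    using ex_min_if_finite[of "(\<lambda>m. ?e m 0) ` ?K'"] by (auto simp: not_less)
  define a where "a = ?e m0 0"
  \<comment> \<open>In all other terms either \<open>f\<close> has a higher exponent, and \<open>t ^ Suc a\<close> divides \<open>f\<close>, or \<open>t\<close>
    has one.\<close>
  have other: "\<exists>r\<in>A. power_product ?x m = t ^ a * f ^ b * (t * r)" if m: "m \<in> ?K - {m0}" for m
  proof (cases "?e m 1 = b")
    case True
    have "?e m 0 \<noteq> a"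
    proof
      assume "?e m 0 = a"
      have "?e m i = ?e m0 i" for i
      proof (cases "i \<in> {0, 1}")
        case False
        then have "i \<notin> Poly_Mapping.keys m" "i \<notin> Poly_Mapping.keys m0"
          using m0(1) m keys[of m] keys[of m0] by blast+
        then show ?thesis by (simp add: in_keys_iff)
      qed (use True m0(1) \<open>?e m 0 = a\<close> in \<open>auto simp: a_def\<close>)
      then show False using m by (auto intro: poly_mapping_eqI)
    qed
    moreover have "a \<le> ?e m 0" using m0(2)[of m] m True by (simp add: a_def)
    ultimately obtain n where "?e m 0 = a + Suc n" by (metis less_natE le_neq_implies_less add_Suc_right)
    then have "power_product ?x m = t ^ a * f ^ b * (t * t ^ n)"
      using pp[of m] m True by (simp add: power_add)
    then show ?thesis using loc.power_closed[OF tA] by blast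
  next
    case False
    then have "b < ?e m 1" using m1(2)[of m] m by (simp add: b_def)
    then obtain n where n: "?e m 1 = b + Suc n" by (metis less_natE add_Suc_right)
    obtain r where r: "r \<in> A" "f = t ^ Suc a * r" using div by blast
    have "power_product ?x m = t ^ ?e m 0 * (f ^ b * f * f ^ n)"
      using pp[of m] m n by (simp add: power_add)
    also have "\<dots> = t ^ ?e m 0 * (f ^ b * (t ^ Suc a * r) * f ^ n)" using r(2) by simp
    also have "\<dots> = t ^ a * f ^ b * (t * (t ^ ?e m 0 * r * f ^ n))"
      by (simp add: algebra_simps)
    finally show ?thesis
      by (rule bexI) (intro loc.mult_closed loc.power_closed r(1) tA fA)
  qed
  then obtain r where r: "\<And>m. m \<in> ?K - {m0} \<Longrightarrow> r m \<in> A"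
    "\<And>m. m \<in> ?K - {m0} \<Longrightarrow> power_product ?x m = t ^ a * f ^ b * (t * r m)"
    using bchoice[of "?K - {m0}" "\<lambda>m r. r \<in> A \<and> power_product ?x m = t ^ a * f ^ b * (t * r)"]
    by blast
  define c where "c = ?e F m0"
  define R where "R = (\<Sum>m\<in>?K - {m0}. scalar X (?e F m) * r m)"
  have m0K: "m0 \<in> ?K" "?e m0 1 = b" using m0 by auto
  have "0 = (\<Sum>m\<in>?K. scalar X (?e F m) * power_product ?x m)"
    using F(2) unfolding mpol_eval_def by simp
  also have "\<dots> = scalar X c * (t ^ a * f ^ b) +
      (\<Sum>m\<in>?K - {m0}. scalar X (?e F m) * power_product ?x m)"
    using m0K pp[of m0] by (simp add: sum.remove[OF finite_keys m0K(1)] c_def a_def)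
  also have "(\<Sum>m\<in>?K - {m0}. scalar X (?e F m) * power_product ?x m) = t ^ a * f ^ b * (t * R)"
    unfolding R_def sum_distrib_left by (intro sum.cong) (auto simp: r(2) mult_ac)
  finally have "t ^ a * f ^ b * (scalar X c + t * R) = 0" by (simp add: algebra_simps)
  then have "scalar X c = t * (- R)" using f \<open>t \<noteq> 0\<close> by (simp add: eq_neg_iff_add_eq_0)
  moreover have "- R \<in> A"
    unfolding R_def
    by (intro loc.uminus_closed loc.sum_closed loc.mult_closed scalar_mem_A r(1))
  ultimately have "scalar X c \<in> M" using t unfolding uniformizer_def by blast
  moreover have "c \<noteq> 0" using m0K(1) by (simp add: c_def in_keys_iff)
  ultimately show False using scalar_notin_M by blast
qed

section \<open>The order of a function at a point\<close>

text \<open>The units of the local ring. Every nonzero function is a unit times an integral power of a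
  uniformizer, so the order is a discrete valuation; its residue field is the ground field.\<close>

definition units :: "'K set" where
  "units = {u. u \<noteq> 0 \<and> u \<in> A \<and> inverse u \<in> A}"

lemma units_mult: "u \<in> units \<Longrightarrow> w \<in> units \<Longrightarrow> u * w \<in> units"
  by (auto simp: units_def loc.mult_closed)

lemma units_inverse: "u \<in> units \<Longrightarrow> inverse u \<in> units"
  by (auto simp: units_def)

lemma units_powi: "u \<in> units \<Longrightarrow> u powi n \<in> units"
  by (auto simp: units_def power_int_def loc.power_closed simp flip: power_inverse)

lemma scalar_units: "c \<noteq> 0 \<Longrightarrow> scalar X c \<in> units"
  using inverse_mem_A[OF scalar_mem_A scalar_notin_M] scalar_mem_A by (simp add: units_def)

lemma units_iff: "u \<in> units \<longleftrightarrow> u \<in> A \<and> u \<notin> M"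
proof
  assume u: "u \<in> units"
  then have "u * inverse u = 1" by (simp add: units_def)
  then show "u \<in> A \<and> u \<notin> M"
    using max.ideal_mult'[of u "inverse u"] u one_notin_M by (auto simp: units_def)
next
  assume "u \<in> A \<and> u \<notin> M"
  then show "u \<in> units" using inverse_mem_A by (auto simp: units_def)
qed

lemma regular_factorization:
  assumes t: "uniformizer X (proj_point p) t" "t \<noteq> 0" and f: "f \<in> A" "f \<noteq> 0"
  shows "\<exists>n::nat. \<exists>u\<in>units. f = u * t ^ n"
proof -
  let ?P = "\<lambda>n. \<forall>a\<in>A. f \<noteq> t ^ n * a"
  obtain n where n: "?P n" "\<And>m. m < n \<Longrightarrow> \<not> ?P m"
    using not_infinitely_divisible[OF t f(2)] exists_least_iff[of ?P] by blast
  have "\<not> ?P 0" using f(1) by simp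
  then obtain m where m: "n = Suc m" using n(1) by (cases n) auto
  then obtain a where a: "a \<in> A" "f = t ^ m * a" using n(2)[of m] by auto
  have "a \<notin> M"
  proof
    assume "a \<in> M"
    then obtain b where "b \<in> A" "a = t * b" using t unfolding uniformizer_def by blast
    then have "f = t ^ n * b" using a m by simp
    then show False using n(1) \<open>b \<in> A\<close> by blast
  qed
  then have "a \<in> units" using a(1) units_iff by blast
  then show ?thesis using a(2) by (auto simp: mult.commute)
qed

lemma fraction_of_regular:
  obtains g h where "g \<in> A" "h \<in> A" "h \<noteq> 0" "f = g / h"
proof -
  obtain e F G where f: "homogeneous e F" "homogeneous e G" "gv G \<noteq> 0" "f = gv F / gv G"
    using curve unfolding smooth_projective_curve_def projective_variety_def by blast
  let ?L = "(var_mpol j :: ('n, 'k) mpol) ^ e"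
  have L: "homogeneous (e * 1) ?L" using homogeneous_power[OF homogeneous_var] by simp
  have "val ?L \<noteq> 0" using coord by (simp add: eval_simps)
  moreover have "gv ?L \<noteq> 0" using gcoord_nonzero by (simp add: eval_simps)
  ultimately show ?thesis using f L
    by (intro that[of "gv F / gv ?L" "gv G / gv ?L"] fraction_mem_A[of e]) auto
qed

lemma factorization:
  assumes t: "uniformizer X (proj_point p) t" "t \<noteq> 0" and f: "f \<noteq> 0"
  obtains n u where "u \<in> units" "f = u * t powi n"
proof -
  obtain g h where gh: "g \<in> A" "h \<in> A" "h \<noteq> 0" "f = g / h" by (rule fraction_of_regular)
  then have "g \<noteq> 0" using f by auto
  obtain m u where g: "u \<in> units" "g = u * t ^ m"
    using regular_factorization[OF t gh(1) \<open>g \<noteq> 0\<close>] by blast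
  obtain n w where h: "w \<in> units" "h = w * t ^ n"
    using regular_factorization[OF t gh(2,3)] by blast
  have "f = (u * inverse w) * t powi (int m - int n)"
    using gh(4) g h t(2) by (simp add: power_int_diff divide_simps)
  then show ?thesis using that units_mult[OF g(1) units_inverse[OF h(1)]] by blast
qed

lemma powi_unit_imp:
  assumes t: "uniformizer X (proj_point p) t" "t \<noteq> 0" and "t powi n \<in> units" shows "n = 0"
proof -
  have tM: "t \<in> M" using t loc.one_closed unfolding uniformizer_def by force
  have pos: "n \<le> 0" if "t powi n \<in> units" for n :: int
  proof (rule ccontr)
    assume n: "\<not> n \<le> 0"
    then obtain m where "n = int (Suc m)" by (metis not_le zero_less_imp_eq_int gr0_implies_Suc)
    then have "t powi n = t * t ^ m" by (simp only: power_int_of_nat power_Suc)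
    moreover have "t * t ^ m \<in> M"
      using tM M_subset_A by (intro max.ideal_mult' loc.power_closed) auto
    ultimately show False using that units_iff by simp
  qed
  have "t powi (- n) \<in> units" using units_inverse[OF assms(3)] by (simp add: power_int_minus)
  then show ?thesis using pos[of n] pos[of "- n"] assms(3) by simp
qed

text \<open>The order depends on neither the uniformizer nor the unit, so \<open>ord_at\<close> is well defined.\<close>

lemma ord_at_eq:
  assumes t: "uniformizer X (proj_point p) t" "t \<noteq> 0" and u: "u \<in> units"
  shows "ord_at X (proj_point p) (u * t powi n) = n"
  unfolding ord_at_def
proof (rule the_equality)
  show "\<exists>t' u'. uniformizer X (proj_point p) t' \<and> u' \<noteq> 0 \<and> u' \<in> A \<and> inverse u' \<in> A \<and>
      u * t powi n = u' * t' powi n"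
    using t u unfolding units_def by blast
next
  fix m
  assume "\<exists>t' u'. uniformizer X (proj_point p) t' \<and> u' \<noteq> 0 \<and> u' \<in> A \<and> inverse u' \<in> A \<and>
      u * t powi n = u' * t' powi m"
  then obtain t' u' where t': "uniformizer X (proj_point p) t'" and u': "u' \<in> units"
    and eq: "u * t powi n = u' * t' powi m" unfolding units_def by blast
  have "{t * a | a. a \<in> A} = {t' * a | a. a \<in> A}" using t(1) t' by (simp add: uniformizer_def)
  moreover have "t * 1 \<in> {t * a | a. a \<in> A}" "t' * 1 \<in> {t' * a | a. a \<in> A}"
    using loc.one_closed by blast+
  ultimately have "t * 1 \<in> {t' * a | a. a \<in> A}" "t' * 1 \<in> {t * a | a. a \<in> A}"
    by (simp_all only:)
  then obtain a b where "t * 1 = t' * b" "b \<in> A" "t' * 1 = t * a" "a \<in> A" by blast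
  then have ab: "a \<in> A" "t' = t * a" "b \<in> A" "t = t' * b" by simp_all
  have "t * (a * b) = t * 1" using ab(2,4) by (simp only: mult.assoc[symmetric] mult_1_right)
  then have "a * b = 1" using mult_left_cancel[OF t(2)] by blast
  then have "inverse a = b" "a \<noteq> 0" by (auto intro: inverse_unique)
  then have a: "a \<in> units" using ab \<open>a \<noteq> 0\<close> by (simp add: units_def)
  have unz: "u \<noteq> 0" using u by (simp add: units_def)
  have "u * t powi n = (u' * a powi m) * t powi m"
    using eq ab(2) by (simp add: power_int_mult_distrib mult_ac)
  then have "t powi (n - m) = u' * a powi m * inverse u"
    using t(2) unz by (simp add: power_int_diff field_simps)
  also have "\<dots> \<in> units" using u u' a by (intro units_mult units_powi units_inverse)
  finally show "m = n" using powi_unit_imp[OF t] by fastforce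
qed

abbreviation "ord \<equiv> ord_at X (proj_point p)"

lemma obtain_factorization:
  assumes "f \<noteq> 0"
  obtains t u where "uniformizer X (proj_point p) t" "t \<noteq> 0" "u \<in> units" "f = u * t powi ord f"
  using ex_uniformizer factorization[OF _ _ assms] ord_at_eq by metis

lemma common_factorization:
  assumes "f \<noteq> 0" "g \<noteq> 0"
  obtains t u w where "uniformizer X (proj_point p) t" "t \<noteq> 0" "t \<in> M" "u \<in> units" "w \<in> units"
    "f = u * t powi ord f" "g = w * t powi ord g"
  using ex_uniformizer factorization[OF _ _ assms(1)] factorization[OF _ _ assms(2)] ord_at_eq
  by metis

lemma ord_unit: "u \<in> units \<Longrightarrow> ord u = 0"
  using ex_uniformizer ord_at_eq[of _ u 0] by auto

lemma ord_scalar: "c \<noteq> 0 \<Longrightarrow> ord (scalar X c) = 0"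
  using ord_unit scalar_units by blast

lemma ord_mult:
  assumes "f \<noteq> 0" "g \<noteq> 0" shows "ord (f * g) = ord f + ord g"
proof -
  obtain t u w where t: "uniformizer X (proj_point p) t" "t \<noteq> 0" "u \<in> units" "w \<in> units"
    "f = u * t powi ord f" "g = w * t powi ord g" using common_factorization[OF assms] by metis
  have "f * g = (u * w) * t powi (ord f + ord g)"
    by (subst t(5), subst t(6)) (simp add: power_int_add t(2))
  then show ?thesis using ord_at_eq[OF t(1,2) units_mult[OF t(3,4)]] by simp
qed

lemma ord_nonneg_iff:
  assumes "f \<noteq> 0" shows "0 \<le> ord f \<longleftrightarrow> f \<in> A"
proof -
  obtain t u where t: "uniformizer X (proj_point p) t" "t \<noteq> 0" "t \<in> M" "u \<in> units"
    "f = u * t powi ord f" using common_factorization[OF assms assms] by metis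
  have "t \<in> A" using t(3) M_subset_A by blast
  show ?thesis
  proof
    assume "0 \<le> ord f"
    then have "t powi ord f \<in> A"
      using loc.power_closed[OF \<open>t \<in> A\<close>] by (simp add: power_int_def)
    then show "f \<in> A" using t(4) by (subst t(5)) (auto simp: units_def intro: loc.mult_closed)
  next
    assume "f \<in> A"
    then obtain n w where "w \<in> units" "f = w * t ^ n"
      using regular_factorization[OF t(1,2) _ assms] by blast
    then have "ord f = int n" using ord_at_eq[OF t(1,2), of w "int n"] by simp
    then show "0 \<le> ord f" by simp
  qed
qed

lemma ord_divide:
  assumes "f \<noteq> 0" "g \<noteq> 0" shows "ord (f / g) = ord f - ord g"
  using ord_mult[of "f / g" g] assms by simp

lemma ord_le_iff:
  assumes "f \<noteq> 0" "g \<noteq> 0" shows "ord f \<le> ord g \<longleftrightarrow> g / f \<in> A"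
  using ord_divide[OF assms(2,1)] ord_nonneg_iff[of "g / f"] assms by simp

lemma ord_add:
  assumes "f \<noteq> 0" "g \<noteq> 0" "f + g \<noteq> 0" shows "min (ord f) (ord g) \<le> ord (f + g)"
proof -
  have *: "ord f \<le> ord (f + g)" if "f \<noteq> 0" "g \<noteq> 0" "f + g \<noteq> 0" "ord f \<le> ord g" for f g
  proof -
    have "(f + g) / f = 1 + g / f" using that by (simp add: field_simps)
    also have "\<dots> \<in> A" using that ord_le_iff[of f g] loc.one_closed loc.add_closed by blast
    finally show ?thesis using ord_le_iff that by blast
  qed
  show ?thesis using *[of f g] *[of g f] assms by (auto simp: add.commute min_def)
qed

lemma ord_pos_iff:
  assumes "f \<noteq> 0" shows "0 < ord f \<longleftrightarrow> f \<in> M"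
proof -
  have "ord f = 0" if "f \<in> A" "f \<notin> M" using ord_unit units_iff that by blast
  moreover have "ord f \<noteq> 0" if "f \<in> M"
  proof
    assume "ord f = 0"
    obtain t u where "u \<in> units" "f = u * t powi ord f" using obtain_factorization[OF assms] by metis
    then have "f \<in> units" using \<open>ord f = 0\<close> by simp
    then show False using that units_iff by blast
  qed
  ultimately show ?thesis using ord_nonneg_iff[OF assms] M_subset_A by force
qed

lemma ord_residue:
  assumes "f \<noteq> 0" "g \<noteq> 0" "ord f = ord g"
  shows "\<exists>c. f - scalar X c * g = 0 \<or> ord f < ord (f - scalar X c * g)"
proof -
  have "f / g \<in> A" using ord_le_iff[of g f] assms by simp
  then obtain c where c: "f / g - scalar X c \<in> M" using residue_scalar by blast
  let ?r = "f - scalar X c * g"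
  have r: "?r = (f / g - scalar X c) * g" using assms(2) by (simp add: field_simps)
  have "ord f < ord ?r" if "?r \<noteq> 0"
  proof -
    have "f / g - scalar X c \<noteq> 0" using r that by auto
    then show ?thesis
      unfolding r using ord_mult[OF _ assms(2)] ord_pos_iff c assms(3) by simp
  qed
  then show ?thesis by blast
qed

lemma ex_ord_eq: "\<exists>f. f \<noteq> 0 \<and> ord f = n"
proof -
  obtain t where t: "uniformizer X (proj_point p) t" "t \<noteq> 0" using ex_uniformizer by blast
  have "(1::'K) \<in> units" using scalar_units[of 1] by (simp add: sc.h_one)
  then show ?thesis using ord_at_eq[OF t, of 1 n] t(2) by (intro exI[of _ "1 * t powi n"]) simp
qed

end


section \<open>Functions filtered by pole order\<close>

text \<open>\<open>B\<close> is the ring of the functions that are regular away from a fixed point, \<open>ord\<close> the order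
  at this point, and \<open>H\<close> the set of pole orders of the elements of \<open>B\<close>. The space \<open>L n\<close> consists of
  the elements of pole order at most \<open>n\<close>.\<close>

locale pole_filtration = coefficient_hom sc
  for sc :: "'k::field \<Rightarrow> 'K::field" +
  fixes ord :: "'K \<Rightarrow> int" and B :: "'K set"
  assumes sc_mem: "sc c \<in> B"
    and B_add: "f \<in> B \<Longrightarrow> g \<in> B \<Longrightarrow> f + g \<in> B"
    and B_mult: "f \<in> B \<Longrightarrow> g \<in> B \<Longrightarrow> f * g \<in> B"
    and ord_sc: "c \<noteq> 0 \<Longrightarrow> ord (sc c) = 0"
    and ord_mult: "f \<noteq> 0 \<Longrightarrow> g \<noteq> 0 \<Longrightarrow> ord (f * g) = ord f + ord g"
    and ord_add: "f \<noteq> 0 \<Longrightarrow> g \<noteq> 0 \<Longrightarrow> f + g \<noteq> 0 \<Longrightarrow> min (ord f) (ord g) \<le> ord (f + g)"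
    and ord_residue: "f \<noteq> 0 \<Longrightarrow> g \<noteq> 0 \<Longrightarrow> ord f = ord g \<Longrightarrow>
      \<exists>c. f - sc c * g = 0 \<or> ord f < ord (f - sc c * g)"
    and regular_constant: "f \<in> B \<Longrightarrow> f \<noteq> 0 \<Longrightarrow> 0 \<le> ord f \<Longrightarrow> \<exists>c. f = sc c"
begin

definition L :: "nat \<Rightarrow> 'K set" where
  "L n = {f \<in> B. f = 0 \<or> - int n \<le> ord f}"

definition H :: "nat set" where
  "H = {n. \<exists>f\<in>B. f \<noteq> 0 \<and> ord f = - int n}"

lemma B_zero: "0 \<in> B"
  using sc_mem[of 0] by (simp add: h_zero)

lemma B_uminus: "f \<in> B \<Longrightarrow> - f \<in> B"
  using B_mult[OF sc_mem[of "-1"], of f] by (simp add: h_uminus h_one)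

lemma ord_nonpos: "f \<in> B \<Longrightarrow> f \<noteq> 0 \<Longrightarrow> ord f \<le> 0"
  using regular_constant ord_sc h_zero by (metis linorder_le_cases)

lemma ord_uminus: "ord (- f) = ord f"
proof (cases "f = 0")
  case False
  have "ord (sc (-1)) = 0" by (rule ord_sc) simp
  then show ?thesis using ord_mult[of "sc (-1)" f] False by (simp add: h_uminus h_one)
qed simp

lemma L_zero: "0 \<in> L n"
  by (simp add: L_def B_zero)

lemma L_add: "f \<in> L n \<Longrightarrow> g \<in> L n \<Longrightarrow> f + g \<in> L n"
  using ord_add[of f g] by (cases "f = 0 \<or> g = 0 \<or> f + g = 0") (auto simp: L_def B_add B_zero)

lemma L_uminus: "f \<in> L n \<Longrightarrow> - f \<in> L n"
  by (auto simp: L_def B_uminus ord_uminus)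

lemma L_diff: "f \<in> L n \<Longrightarrow> g \<in> L n \<Longrightarrow> f - g \<in> L n"
  using L_add[of f n "- g"] L_uminus by simp

lemma L_mult: "f \<in> L m \<Longrightarrow> g \<in> L n \<Longrightarrow> f * g \<in> L (m + n)"
  using ord_mult[of f g] by (cases "f = 0 \<or> g = 0") (auto simp: L_def B_mult B_zero)

lemma L_mono: "m \<le> n \<Longrightarrow> L m \<subseteq> L n"
  by (auto simp: L_def)

lemma sc_mem_L: "sc c \<in> L n"
  using sc_mem[of c] by (cases "c = 0") (auto simp: L_def ord_sc h_zero)

lemma sc_mult_L: "f \<in> L n \<Longrightarrow> sc c * f \<in> L n"
  using L_mult[OF sc_mem_L[of c 0]] by simp

lemma L_sum: "(\<And>i. i \<in> S \<Longrightarrow> f i \<in> L n) \<Longrightarrow> sum f S \<in> L n"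
  by (induction S rule: infinite_finite_induct) (auto intro: L_zero L_add)

lemma L_0_scalar: "f \<in> L 0 \<Longrightarrow> \<exists>c. f = sc c"
  using regular_constant[of f] h_zero by (cases "f = 0") (auto simp: L_def)

lemma sc_nonzero: "c \<noteq> 0 \<Longrightarrow> sc c \<noteq> 0"
proof
  assume "c \<noteq> 0" "sc c = 0"
  then have "sc (inverse c * c) = 0" by (simp only: h_mult mult_zero_right)
  then show False using \<open>c \<noteq> 0\<close> by (simp add: h_one)
qed

lemma ord_sc_mult: "c \<noteq> 0 \<Longrightarrow> f \<noteq> 0 \<Longrightarrow> ord (sc c * f) = ord f"
  using ord_mult[OF sc_nonzero] ord_sc by simp

lemma H_zero: "0 \<in> H"
  unfolding H_def using sc_mem[of 1] ord_sc[of 1] sc_nonzero[of 1] by (auto intro!: bexI[of _ "sc 1"])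

lemma H_add: "m \<in> H \<Longrightarrow> n \<in> H \<Longrightarrow> m + n \<in> H"
proof -
  assume "m \<in> H" "n \<in> H"
  then obtain f g where "f \<in> B" "f \<noteq> 0" "ord f = - int m" "g \<in> B" "g \<noteq> 0" "ord g = - int n"
    unfolding H_def by blast
  then show ?thesis unfolding H_def using ord_mult[of f g]
    by (auto intro!: bexI[of _ "f * g"] B_mult)
qed

lemma H_mult: "m \<in> H \<Longrightarrow> k * m \<in> H"
  by (induction k) (auto intro: H_zero H_add)

lemma mem_L_iff: "f \<in> B \<Longrightarrow> f \<noteq> 0 \<Longrightarrow> ord f = - int h \<Longrightarrow> f \<in> L n \<longleftrightarrow> h \<le> n"
  by (simp add: L_def)

lemma ord_greater_if_mem_L: "f \<in> L n \<Longrightarrow> n < h \<Longrightarrow> f = 0 \<or> - int h < ord f"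
  by (auto simp: L_def)

text \<open>The pole order of a sum of two functions of different pole orders.\<close>

lemma ord_add_eq:
  assumes "f \<noteq> 0" "g = 0 \<or> ord f < ord g"
  shows "f + g \<noteq> 0" "ord (f + g) = ord f"
proof -
  show 1: "f + g \<noteq> 0"
  proof
    assume "f + g = 0"
    then have "f = - g" by (simp add: eq_neg_iff_add_eq_0)
    then show False using assms ord_uminus[of g] by auto
  qed
  show "ord (f + g) = ord f"
  proof (cases "g = 0")
    case False
    then have "ord f < ord g" "ord f \<le> ord (f + g)" using assms ord_add[of f g] 1 by auto
    moreover have "ord (f + g) \<le> ord f"
      using ord_add[of "f + g" "- g"] 1 False assms ord_uminus[of g] by auto
    ultimately show ?thesis by simp
  qed simp
qed

lemma obtain_pole_order:
  assumes "f \<in> B" "f \<noteq> 0" obtains h where "h \<in> H" "ord f = - int h"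
  using ord_nonpos[OF assms] assms that[of "nat (- ord f)"] unfolding H_def by auto

lemma reduce_pole_order:
  assumes "f \<in> L n" "f \<noteq> 0" "g \<noteq> 0" "ord f = ord g" "g \<in> B"
  obtains c where "f - sc c * g \<in> L n" "f - sc c * g = 0 \<or> ord f < ord (f - sc c * g)"
proof -
  obtain c where c: "f - sc c * g = 0 \<or> ord f < ord (f - sc c * g)"
    using ord_residue[OF assms(2-4)] by blast
  have "g \<in> L n" using assms by (auto simp: L_def)
  then show ?thesis using that c L_diff[OF assms(1) sc_mult_L] by blast
qed

text \<open>Functions of pairwise different pole orders: the order of a linear combination.\<close>

lemma ord_linear_combination:
  assumes "finite S" "\<exists>i\<in>S. c i \<noteq> 0"
    and b: "\<And>i. i \<in> S \<Longrightarrow> b i \<noteq> 0" and inj: "inj_on (\<lambda>i. ord (b i)) S"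
  shows "\<exists>i\<in>S. c i \<noteq> 0 \<and> (\<Sum>i\<in>S. sc (c i) * b i) \<noteq> 0 \<and> ord (\<Sum>i\<in>S. sc (c i) * b i) = ord (b i)"
  using assms
proof (induction S rule: finite_induct)
  case empty
  then show ?case by simp
next
  case (insert a S)
  let ?s = "\<Sum>i\<in>S. sc (c i) * b i"
  have sum: "(\<Sum>i\<in>insert a S. sc (c i) * b i) = sc (c a) * b a + ?s"
    using insert.hyps by simp
  have inj: "inj_on (\<lambda>i. ord (b i)) S" using insert.prems(3) by (auto simp: inj_on_def)
  show ?case
  proof (cases "\<exists>i\<in>S. c i \<noteq> 0")
    case False
    then have "?s = 0" by (intro sum.neutral) (auto simp: h_zero)
    moreover have "c a \<noteq> 0" using insert.prems(1) False by blast
    ultimately show ?thesis unfolding sum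
      using ord_sc_mult[of "c a" "b a"] sc_nonzero[of "c a"] insert.prems(2) by auto
  next
    case True
    then obtain i where i: "i \<in> S" "c i \<noteq> 0" "?s \<noteq> 0" "ord ?s = ord (b i)"
      using insert.IH insert.prems inj by blast
    show ?thesis
    proof (cases "c a = 0")
      case True
      then show ?thesis unfolding sum using i by (auto simp: h_zero)
    next
      case False
      have ba: "b a \<noteq> 0" using insert.prems(2) by simp
      have a: "sc (c a) * b a \<noteq> 0" "ord (sc (c a) * b a) = ord (b a)"
        using False ord_sc_mult[OF False ba] sc_nonzero[OF False] ba by simp_all
      have "ord (b a) \<noteq> ord (b i)"
        using insert.prems(3) insert.hyps(2) i(1) by (auto simp: inj_on_def)
      then consider "ord (b a) < ord (b i)" | "ord (b i) < ord (b a)" by linarith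
      then show ?thesis
      proof cases
        case 1
        then show ?thesis unfolding sum
          using ord_add_eq[of "sc (c a) * b a" ?s] a i False by auto
      next
        case 2
        then show ?thesis unfolding sum
          using ord_add_eq[of ?s "sc (c a) * b a"] a i by (auto simp: add.commute)
      qed
    qed
  qed
qed

end

section \<open>The graded pieces of the ideal generated by the two sections\<close>

text \<open>In the section ring, whose piece of degree \<open>m\<close> is \<open>L (m * d)\<close>, let \<open>x\<close> be the function \<open>1\<close> in
  degree \<open>1\<close>, and \<open>z\<close> the function \<open>\<phi>\<close> in degree \<open>q\<close>. Then \<open>D m\<close> is the piece of degree \<open>m\<close> of the
  ideal \<open>(x, z)\<close>.\<close>

locale section_pair = pole_filtration sc ord B
  for sc :: "'k::field \<Rightarrow> 'K::field" and ord B +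
  fixes d q :: nat and \<phi> :: 'K
  assumes d_pos: "1 \<le> d" and q_pos: "1 \<le> q"
    and \<phi>_mem: "\<phi> \<in> B" and \<phi>_nonzero: "\<phi> \<noteq> 0" and ord_\<phi>: "ord \<phi> = - int (q * d)"
begin

abbreviation "e \<equiv> q * d"

text \<open>The piece of degree \<open>m - k\<close>, which is zero for \<open>m < k\<close>.\<close>

definition piece_below :: "nat \<Rightarrow> nat \<Rightarrow> 'K set" where
  "piece_below m k = (if m < k then {0} else L ((m - k) * d))"

definition D :: "nat \<Rightarrow> 'K set" where
  "D m = {a + \<phi> * b | a b. a \<in> piece_below m 1 \<and> b \<in> piece_below m q}"

text \<open>The square of the ideal of positive degree of the quotient by \<open>(x, z)\<close> vanishes; it suffices
  to consider products of two homogeneous elements.\<close>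

definition square_zero :: bool where
  "square_zero \<longleftrightarrow> (\<forall>m\<ge>1. \<forall>n\<ge>1. \<forall>f\<in>L (m * d). \<forall>g\<in>L (n * d). f * g \<in> D (m + n))"

lemma piece_below_zero: "0 \<in> piece_below m k"
  by (simp add: piece_below_def L_zero)

lemma piece_below_add: "f \<in> piece_below m k \<Longrightarrow> g \<in> piece_below m k \<Longrightarrow> f + g \<in> piece_below m k"
  by (auto simp: piece_below_def L_add split: if_splits)

lemma piece_below_mult:
  assumes "f \<in> L (n * d)" "g \<in> piece_below m k" shows "f * g \<in> piece_below (n + m) k"
proof (cases "m < k")
  case True
  then show ?thesis using assms piece_below_zero by (simp add: piece_below_def[of m])
next
  case False
  then have "f * g \<in> L (n * d + (m - k) * d)"
    using assms by (intro L_mult) (auto simp: piece_below_def)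
  moreover have "n * d + (m - k) * d = (n + m - k) * d"
    using False by (simp add: add_mult_distrib[symmetric])
  ultimately show ?thesis using False by (simp add: piece_below_def)
qed

lemma D_zero: "0 \<in> D m"
  unfolding D_def using piece_below_zero[of m 1] piece_below_zero[of m q] by force

lemma D_0: "D 0 = {0}"
  using q_pos by (auto simp: D_def piece_below_def)

lemma D_add:
  assumes "f \<in> D m" "g \<in> D m" shows "f + g \<in> D m"
proof -
  obtain a b a' b' where "f = a + \<phi> * b" "a \<in> piece_below m 1" "b \<in> piece_below m q"
    "g = a' + \<phi> * b'" "a' \<in> piece_below m 1" "b' \<in> piece_below m q"
    using assms unfolding D_def by blast
  then show ?thesis unfolding D_def
    by (intro CollectI exI[of _ "a + a'"] exI[of _ "b + b'"])
       (auto simp: algebra_simps intro: piece_below_add)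
qed

lemma D_sum: "(\<And>i. i \<in> S \<Longrightarrow> f i \<in> D m) \<Longrightarrow> sum f S \<in> D m"
  by (induction S rule: infinite_finite_induct) (auto intro: D_zero D_add)

lemma D_mult:
  assumes "f \<in> L (n * d)" "g \<in> D m" shows "f * g \<in> D (n + m)"
proof -
  obtain a b where "g = a + \<phi> * b" "a \<in> piece_below m 1" "b \<in> piece_below m q"
    using assms(2) unfolding D_def by blast
  then have "f * g = f * a + \<phi> * (f * b)" "f * a \<in> piece_below (n + m) 1"
    "f * b \<in> piece_below (n + m) q"
    using piece_below_mult[OF assms(1)] by (simp_all add: algebra_simps)
  then show ?thesis unfolding D_def by blast
qed

lemma D_mult': "g \<in> D m \<Longrightarrow> f \<in> L (n * d) \<Longrightarrow> g * f \<in> D (m + n)"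
  using D_mult[of f n g m] by (simp add: mult.commute add.commute)

lemma D_sc_mult: "g \<in> D m \<Longrightarrow> sc c * g \<in> D m"
  using D_mult[of "sc c" 0 g m] sc_mem_L by simp

lemma \<phi>_mem_L: "\<phi> \<in> L e"
  by (simp add: L_def \<phi>_mem ord_\<phi>)

lemma D_subset: "D m \<subseteq> L (m * d)"
proof
  fix f assume "f \<in> D m"
  then obtain a b where ab: "f = a + \<phi> * b" "a \<in> piece_below m 1" "b \<in> piece_below m q"
    unfolding D_def by blast
  have "piece_below m 1 \<subseteq> L (m * d)"
    using L_mono[of "(m - 1) * d" "m * d"] L_zero by (auto simp: piece_below_def)
  moreover have "\<phi> * b \<in> L (m * d)"
  proof (cases "m < q")
    case True
    then show ?thesis using ab L_zero by (simp add: piece_below_def)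
  next
    case False
    then have "\<phi> * b \<in> L (e + (m - q) * d)"
      using ab by (intro L_mult \<phi>_mem_L) (simp add: piece_below_def)
    then show ?thesis using False by (simp add: add_mult_distrib[symmetric])
  qed
  ultimately show "f \<in> L (m * d)" using ab L_add by blast
qed

lemma L_pred_subset_D:
  assumes "1 \<le> m" shows "L ((m - 1) * d) \<subseteq> D m"
proof
  fix f assume "f \<in> L ((m - 1) * d)"
  then have "f \<in> piece_below m 1" "f = f + \<phi> * 0"
    using assms by (simp_all add: piece_below_def)
  then show "f \<in> D m" unfolding D_def using piece_below_zero by blast
qed

lemma e_mem_H: "e \<in> H"
  unfolding H_def using \<phi>_mem \<phi>_nonzero ord_\<phi> by blast

lemma e_pos: "0 < e"
  using d_pos q_pos by simp

text \<open>The quotient of \<open>L (m * d)\<close> by \<open>D m\<close> has a basis of functions whose pole orders are the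
  \<open>h\<close> with \<open>(m - 1) * d < h \<le> m * d\<close> in the Apery set of \<open>H\<close> with respect to \<open>e\<close>, i.e. \<open>h \<in> H\<close> but
  \<open>h - e \<notin> H\<close>. The next lemmas are the two halves of this statement.\<close>

definition apery :: "nat set" where
  "apery = {h \<in> H. \<not> (e \<le> h \<and> h - e \<in> H)}"

lemma mem_D_if_not_apery:
  assumes h: "h \<in> H" "h \<notin> apery" "h \<le> m * d"
  shows "\<exists>g\<in>D m. g \<noteq> 0 \<and> ord g = - int h"
proof -
  have eh: "e \<le> h" "h - e \<in> H" using h by (auto simp: apery_def)
  obtain b where b: "b \<in> B" "b \<noteq> 0" "ord b = - int (h - e)" using eh(2) unfolding H_def by blast
  have "q * d \<le> m * d" using eh(1) h(3) by linarith
  then have qm: "q \<le> m" using d_pos by simp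
  have "h - e \<le> (m - q) * d" using h(3) by (simp add: diff_mult_distrib)
  then have "int (h - e) \<le> int ((m - q) * d)" by (simp only: of_nat_le_iff)
  then have "b \<in> L ((m - q) * d)" using b(1,3) unfolding L_def by simp
  then have "b \<in> piece_below m q" using qm by (simp add: piece_below_def)
  then have "0 + \<phi> * b \<in> D m" unfolding D_def using piece_below_zero by blast
  moreover have "\<phi> * b \<noteq> 0" using b \<phi>_nonzero by simp
  moreover have "ord (\<phi> * b) = - int h" using ord_mult[OF \<phi>_nonzero b(2)] ord_\<phi> b(3) eh(1) by simp
  ultimately show ?thesis by (metis add_0)
qed

lemma not_mem_D_if_apery:
  assumes "f \<noteq> 0" "ord f = - int h" "h \<in> apery" "(m - 1) * d < h"
  shows "f \<notin> D m"
proof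
  assume "f \<in> D m"
  then obtain a b where ab: "f = a + \<phi> * b" "a \<in> piece_below m 1" "b \<in> piece_below m q"
    unfolding D_def by blast
  have a: "a = 0 \<or> ord f < ord a"
    using ab(2) assms(2) ord_greater_if_mem_L[OF _ assms(4)]
    by (auto simp: piece_below_def split: if_splits)
  have b: "\<phi> * b = f - a" using ab(1) by simp
  have *: "f + - a \<noteq> 0" "ord (f + - a) = ord f"
    using ord_add_eq[of f "- a"] assms(1) a ord_uminus[of a] by auto
  then have b0: "b \<noteq> 0" using b by auto
  have "ord \<phi> + ord b = - int h" using * b ord_mult[OF \<phi>_nonzero b0] assms(2) by simp
  have "b \<in> B" using ab(3) B_zero by (auto simp: piece_below_def L_def split: if_splits)
  then obtain k where "k \<in> H" "ord b = - int k" using obtain_pole_order b0 by blast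
  then have "h = e + k" using \<open>ord \<phi> + ord b = - int h\<close> ord_\<phi> by linarith
  then show False using assms(3) \<open>k \<in> H\<close> by (simp add: apery_def)
qed

text \<open>Reduction modulo \<open>D m\<close> to functions with pole orders in the Apery set, by induction on the
  pole order; the least value of the measure is reserved for the zero function.\<close>

lemma reduce_mod_D:
  assumes f: "f \<in> L (m * d)" and m: "1 \<le> m"
    and W: "0 \<in> W" "\<And>u v. u \<in> W \<Longrightarrow> v \<in> W \<Longrightarrow> u + v \<in> W" "D m \<subseteq> W"
    and gen: "\<And>h. h \<in> apery \<Longrightarrow> (m - 1) * d < h \<Longrightarrow> h \<le> m * d \<Longrightarrow>
      \<exists>g\<in>B. g \<noteq> 0 \<and> ord g = - int h \<and> (\<forall>c. sc c * g \<in> W)"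
  shows "f \<in> W"
  using f
proof (induction "if f = 0 then 0 else Suc (nat (- ord f))" arbitrary: f rule: less_induct)
  case less
  show ?case
  proof (cases "f \<in> L ((m - 1) * d)")
    case True
    then show ?thesis using L_pred_subset_D[OF m] W(3) by blast
  next
    case False
    have fB: "f \<in> B" using less.prems by (simp add: L_def)
    have f0: "f \<noteq> 0" using False L_zero by auto
    then obtain h where h: "h \<in> H" "ord f = - int h" using obtain_pole_order fB by blast
    have hm: "h \<le> m * d" "(m - 1) * d < h"
      using less.prems False mem_L_iff[OF fB f0 h(2)] by simp_all
    have "\<exists>g\<in>B. g \<noteq> 0 \<and> ord g = - int h \<and> (\<forall>c. sc c * g \<in> W)"
    proof (cases "h \<in> apery")
      case True
      then show ?thesis using gen hm by blast
    next
      case False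
      then obtain g where "g \<in> D m" "g \<noteq> 0" "ord g = - int h"
        using mem_D_if_not_apery h(1) hm(1) by blast
      moreover then have "g \<in> B" using D_subset by (auto simp: L_def)
      ultimately show ?thesis using D_sc_mult W(3) by blast
    qed
    then obtain g where g: "g \<in> B" "g \<noteq> 0" "ord g = - int h" "\<And>c. sc c * g \<in> W" by blast
    then obtain c where c: "f - sc c * g \<in> L (m * d)"
      "f - sc c * g = 0 \<or> ord f < ord (f - sc c * g)"
      using reduce_pole_order[OF less.prems f0 g(2)] h(2) by metis
    have "f - sc c * g \<in> W"
    proof (rule less.hyps[OF _ c(1)])
      have "nat (- ord (f - sc c * g)) < nat (- ord f)" if "f - sc c * g \<noteq> 0"
        using c that ord_nonpos[of "f - sc c * g"] by (simp add: L_def)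
      then show "(if f - sc c * g = 0 then 0 else Suc (nat (- ord (f - sc c * g))))
          < (if f = 0 then 0 else Suc (nat (- ord f)))" using f0 by auto
    qed
    then show ?thesis using W(2)[OF _ g(4)[of c]] by fastforce
  qed
qed

text \<open>The quotient by \<open>(x, z)\<close> vanishes in degree \<open>m\<close> if no element of the Apery set belongs to
  this degree.\<close>

lemma L_subset_D:
  assumes "1 \<le> m" "\<And>h. h \<in> apery \<Longrightarrow> (m - 1) * d < h \<Longrightarrow> m * d < h"
  shows "L (m * d) \<subseteq> D m"
proof
  fix f assume f: "f \<in> L (m * d)"
  show "f \<in> D m"
  proof (rule reduce_mod_D[OF f assms(1) D_zero D_add order_refl])
    fix h assume "h \<in> apery" "(m - 1) * d < h" "h \<le> m * d"
    then show "\<exists>g\<in>B. g \<noteq> 0 \<and> ord g = - int h \<and> (\<forall>c. sc c * g \<in> D m)"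
      using assms(2)[of h] by simp
  qed
qed

lemma apery_le:
  assumes "\<And>h. F < h \<Longrightarrow> h \<in> H" "h \<in> apery" shows "h \<le> e + F"
proof (rule ccontr)
  assume "\<not> h \<le> e + F"
  then have "e \<le> h" "F < h - e" by simp_all
  then show False using assms by (simp add: apery_def)
qed

text \<open>The criterion for ordinary points, i.e. \<open>H = {0} \<union> {g + 1, \<dots>}\<close>, where \<open>g + 1 \<le> e \<le> g + d\<close> as \<open>q\<close> is the
  least multiplier with \<open>q * d > g\<close>. The condition says that \<open>e\<close> is one of the two extreme values.
  For these, degree considerations suffice. Otherwise functions of pole orders \<open>g + 1\<close> and \<open>e - 1\<close>
  both lie in degree \<open>q\<close>, and their product has pole order \<open>e + g\<close>, which is in the Apery set and
  belongs to degree \<open>2 * q\<close>.\<close>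

lemma square_zero_ordinary_iff:
  assumes H: "\<And>n. n \<in> H \<longleftrightarrow> n = 0 \<or> g < n" and g: "1 \<le> g"
    and least: "\<And>r. 1 \<le> r \<Longrightarrow> r * d \<in> H \<Longrightarrow> q \<le> r"
  shows "square_zero \<longleftrightarrow> d dvd g \<or> d dvd (g + 1)"
proof -
  have ge: "g < e" using e_mem_H e_pos H[of e] by simp
  have eg: "e \<le> g + d"
  proof (cases "q = 1")
    case False
    then have "(q - 1) * d \<notin> H" using least[of "q - 1"] q_pos by fastforce
    then have "(q - 1) * d \<le> g" using H by (simp add: not_less)
    then show ?thesis by (simp add: diff_mult_distrib)
  qed (use g in simp)
  have ap_le: "h \<le> e + g" if "h \<in> apery" for h using apery_le[OF _ that, of g] H by simp
  have large: "L (m * d) \<subseteq> D m" if "e + g \<le> (m - 1) * d" "1 \<le> m" for m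
    using L_subset_D[OF that(2)] ap_le that(1) by (meson le_trans not_le)
  \<comment> \<open>By the assumptions, the positive part of the quotient lives in degrees from \<open>k\<close> to
    \<open>2 * k - 1\<close>.\<close>
  have sz: square_zero
    if k: "\<And>m. 1 \<le> m \<Longrightarrow> m < k \<Longrightarrow> L (m * d) \<subseteq> D m" "e + g \<le> (2 * k - 1) * d" for k
    unfolding square_zero_def
  proof (intro allI impI ballI)
    fix m n :: nat and u w
    assume mn: "1 \<le> m" "1 \<le> n" "u \<in> L (m * d)" "w \<in> L (n * d)"
    consider "m < k" | "n < k" | "2 * k \<le> m + n" by linarith
    then show "u * w \<in> D (m + n)"
    proof cases
      case 1
      then show ?thesis using k(1) mn D_mult' by blast
    next
      case 2
      then show ?thesis using k(1) mn D_mult by blast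
    next
      case 3
      then have "(2 * k - 1) * d \<le> (m + n - 1) * d" by (intro mult_le_mono1) linarith
      then have "L ((m + n) * d) \<subseteq> D (m + n)" using k(2) mn by (intro large) linarith+
      then show ?thesis using L_mult[OF mn(3,4)] by (auto simp: add_mult_distrib)
    qed
  qed
  show ?thesis
  proof
    assume "d dvd g \<or> d dvd (g + 1)"
    then show square_zero
    proof
      assume "d dvd (g + 1)"
      then obtain r where r: "g + 1 = r * d" by (auto simp: dvd_def mult.commute)
      then have "q \<le> r" using least[of r] H by (cases "r = 0") (auto simp flip: r)
      then have "e \<le> g + 1" using r by simp
      then have e: "e = g + 1" using ge by simp
      show ?thesis
      proof (rule sz[of "q + 1"])
        fix m assume m: "1 \<le> m" "m < q + 1"
        then have "m * d \<le> e" by simp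
        show "L (m * d) \<subseteq> D m"
        proof (rule L_subset_D[OF m(1)])
          fix h assume h: "h \<in> apery" "(m - 1) * d < h"
          then have "g < h" "h \<noteq> e" using H by (auto simp: apery_def)
          then show "m * d < h" using e \<open>m * d \<le> e\<close> by simp
        qed
      next
        have "(2 * (q + 1) - 1) * d = e + e + d" by (simp add: algebra_simps)
        then show "e + g \<le> (2 * (q + 1) - 1) * d" using ge by linarith
      qed
    next
      assume "d dvd g"
      then obtain r where r: "g = r * d" by (auto simp: dvd_def mult.commute)
      then have "r * d < q * d" using ge by simp
      then have "r < q" by simp
      then have "(r + 1) * d \<le> e" by (intro mult_le_mono1) simp
      then have e: "e = g + d" using eg r by simp
      show ?thesis
      proof (rule sz[of q])
        fix m assume m: "1 \<le> m" "m < q"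
        have "m * d \<le> (q - 1) * d" using m by (intro mult_le_mono1) simp
        then have "m * d \<le> g" using e by (simp add: diff_mult_distrib)
        show "L (m * d) \<subseteq> D m"
        proof (rule L_subset_D[OF m(1)])
          fix h assume h: "h \<in> apery" "(m - 1) * d < h"
          then show "m * d < h" using H \<open>m * d \<le> g\<close> by (auto simp: apery_def)
        qed
      next
        have "(2 * q - 1) * d = e + e - d" by (simp add: algebra_simps diff_mult_distrib)
        then show "e + g \<le> (2 * q - 1) * d" using e by linarith
      qed
    qed
  next
    assume sq: square_zero
    show "d dvd g \<or> d dvd (g + 1)"
    proof (rule ccontr)
      assume neg: "\<not> (d dvd g \<or> d dvd (g + 1))"
      have "d dvd e" by simp
      then have "e \<noteq> g + 1" "e \<noteq> g + d" using neg by fastforce+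
      then have e: "g + 1 < e" "e < g + d" using ge eg by simp_all
      obtain u where u: "u \<in> B" "u \<noteq> 0" "ord u = - int (g + 1)"
        using H[of "g + 1"] unfolding H_def by auto
      obtain w where w: "w \<in> B" "w \<noteq> 0" "ord w = - int (e - 1)"
        using H[of "e - 1"] e(1) unfolding H_def by auto
      have "u \<in> L e" "w \<in> L e" using mem_L_iff[OF u] mem_L_iff[OF w] e(1) by simp_all
      then have "u * w \<in> D (q + q)" using sq q_pos unfolding square_zero_def by blast
      moreover have "u * w \<notin> D (q + q)"
      proof (rule not_mem_D_if_apery)
        show "u * w \<noteq> 0" using u w by simp
        have "(g + 1) + (e - 1) = e + g" using e by linarith
        then have "- int (g + 1) + - int (e - 1) = - int (e + g)"
          by (metis of_nat_add minus_add_distrib)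
        then show "ord (u * w) = - int (e + g)" by (simp only: ord_mult[OF u(2) w(2)] u(3) w(3))
        have "e + g \<in> H" "g \<notin> H" using H[of "e + g"] H[of g] g e_pos by simp_all
        then show "e + g \<in> apery" by (simp add: apery_def)
        have "(q + q - 1) * d = e + e - d" by (simp add: algebra_simps diff_mult_distrib)
        then show "(q + q - 1) * d < e + g" using e by simp
      qed
      ultimately show False by blast
    qed
  qed
qed

end


section \<open>Subrings and ideals as structures\<close>

lemma subring_on_simps:
  "carrier (subring_on A) = A" "mult (subring_on A) a b = a * b" "one (subring_on A) = 1"
  "ring.zero (subring_on A) = 0" "add (subring_on A) a b = a + b"
  by (simp_all add: subring_on_def)

lemma (in subring_set) cring_subring_on: "cring (subring_on A)"
proof (rule cringI)
  show "abelian_group (subring_on A)"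
    by (rule abelian_groupI)
       (auto simp: subring_on_simps add_ac add_closed zero_closed
          intro!: bexI[of _ "- _"] uminus_closed)
  show "comm_monoid (subring_on A)"
    by (rule comm_monoidI) (auto simp: subring_on_simps mult_ac mult_closed one_closed)
qed (auto simp: subring_on_simps algebra_simps)

lemma (in subring_set) a_inv_subring_on: "a \<in> A \<Longrightarrow> a_inv (subring_on A) a = - a"
proof -
  assume "a \<in> A"
  interpret R: cring "subring_on A" by (rule cring_subring_on)
  show ?thesis
    using R.minus_equality[of "- a" a] \<open>a \<in> A\<close> by (simp add: subring_on_simps uminus_closed)
qed

lemma (in subring_set) ideal_subring_on_iff: "ideal I (subring_on A) \<longleftrightarrow> ideal_set A I"
proof
  assume "ideal I (subring_on A)"
  then interpret I: ideal I "subring_on A" .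
  show "ideal_set A I"
  proof
    show "I \<subseteq> A" using I.a_subset by (simp add: subring_on_simps)
    show "0 \<in> I" using additive_subgroup.zero_closed[OF I.additive_subgroup_axioms] by (simp add: subring_on_simps)
    show "a + b \<in> I" if "a \<in> I" "b \<in> I" for a b
      using additive_subgroup.a_closed[OF I.additive_subgroup_axioms that] by (simp add: subring_on_simps)
    show "a * b \<in> I" if "a \<in> A" "b \<in> I" for a b
      using I.I_l_closed[OF that(2)] that(1) by (simp add: subring_on_simps)
  qed
next
  assume "ideal_set A I"
  then interpret I: ideal_set A I .
  interpret R: cring "subring_on A" by (rule cring_subring_on)
  show "ideal I (subring_on A)"
  proof (rule idealI)
    show "ring (subring_on A)" by (rule R.ring_axioms)
    show "subgroup I (add_monoid (subring_on A))"
    proof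
      show "inv\<^bsub>add_monoid (subring_on A)\<^esub> a \<in> I" if "a \<in> I" for a
        using a_inv_subring_on[of a] I.ideal_uminus[OF that] I.ideal_subset that
        by (auto simp: a_inv_def)
    qed (use I.ideal_subset in \<open>auto simp: subring_on_simps I.ideal_zero I.ideal_add\<close>)
  qed (auto simp: subring_on_simps I.ideal_mult I.ideal_mult')
qed

text \<open>A product of two subsets of the quotient ring is zero iff all products of representatives lie
  in the ideal.\<close>

lemma (in ideal_set) ideal_prod_quotient_zero_iff:
  assumes "V \<subseteq> A" "0 \<in> V"
  shows "ideal_prod (subring_on A Quot I) ((\<lambda>p. I +>\<^bsub>subring_on A\<^esub> p) ` V)
      ((\<lambda>p. I +>\<^bsub>subring_on A\<^esub> p) ` V) = {\<zero>\<^bsub>subring_on A Quot I\<^esub>}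
    \<longleftrightarrow> (\<forall>p\<in>V. \<forall>p'\<in>V. p * p' \<in> I)"
proof -
  let ?R = "subring_on A"
  let ?c = "\<lambda>p. I +>\<^bsub>?R\<^esub> p"
  interpret I: ideal I ?R using ideal_subring_on_iff ideal_set_axioms by blast
  interpret Q: ring "?R Quot I" by (rule I.quotient_is_ring)
  have zero: "\<zero>\<^bsub>?R Quot I\<^esub> = I" by (simp add: FactRing_def)
  have mult: "?c p \<otimes>\<^bsub>?R Quot I\<^esub> ?c p' = ?c (p * p')" if "p \<in> A" "p' \<in> A" for p p'
    using ring_hom_mult[OF I.rcos_ring_hom, of p p'] that by (simp add: subring_on_simps)
  have eq_I: "?c p = I \<longleftrightarrow> p \<in> I" if "p \<in> A" for p
    using I.rcos_const_imp_mem[of p] I.a_rcos_zero[OF I.is_ideal, of p] that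
    by (auto simp: subring_on_simps)
  let ?P = "ideal_prod (?R Quot I) (?c ` V) (?c ` V)"
  show ?thesis
  proof
    assume *: "?P = {\<zero>\<^bsub>?R Quot I\<^esub>}"
    show "\<forall>p\<in>V. \<forall>p'\<in>V. p * p' \<in> I"
    proof (intro ballI)
      fix p p' assume p: "p \<in> V" "p' \<in> V"
      then have "?c p \<otimes>\<^bsub>?R Quot I\<^esub> ?c p' \<in> ?P" by (intro ideal_prod.prod) auto
      moreover have "?c p \<otimes>\<^bsub>?R Quot I\<^esub> ?c p' = ?c (p * p')" using p assms(1) by (intro mult) auto
      ultimately have "?c (p * p') = I" using * zero by (simp only: singleton_iff)
      moreover have "p * p' \<in> A" using p assms(1) by (intro mult_closed) auto
      ultimately show "p * p' \<in> I" using eq_I by blast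
    qed
  next
    assume *: "\<forall>p\<in>V. \<forall>p'\<in>V. p * p' \<in> I"
    have c: "?c p \<otimes>\<^bsub>?R Quot I\<^esub> ?c p' = \<zero>\<^bsub>?R Quot I\<^esub>" if "p \<in> V" "p' \<in> V" for p p'
    proof -
      have A: "p \<in> A" "p' \<in> A" using that assms(1) by auto
      have "?c (p * p') = I" using eq_I[OF mult_closed[OF A]] * that by blast
      then show ?thesis using mult[OF A] zero by (simp only:)
    qed
    show "?P = {\<zero>\<^bsub>?R Quot I\<^esub>}"
    proof
      show "?P \<subseteq> {\<zero>\<^bsub>?R Quot I\<^esub>}"
      proof
        fix w assume "w \<in> ?P"
        then have "w = \<zero>\<^bsub>?R Quot I\<^esub>"
          by (induction w rule: ideal_prod.induct) (auto simp: c)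
        then show "w \<in> {\<zero>\<^bsub>?R Quot I\<^esub>}" by simp
      qed
      have "?c 0 \<otimes>\<^bsub>?R Quot I\<^esub> ?c 0 \<in> ?P" using assms(2) by (intro ideal_prod.prod) auto
      then show "{\<zero>\<^bsub>?R Quot I\<^esub>} \<subseteq> ?P" using c[OF assms(2,2)] by simp
    qed
  qed
qed


section \<open>The section ring and the ideal generated by the two sections\<close>

context section_pair
begin

text \<open>The section ring \<open>R\<close> as a graded subring of the polynomial ring over the function field, its
  ideal \<open>R_plus\<close> of positive degree, and the ideal \<open>I\<close> with the graded pieces \<open>D m\<close>.\<close>

definition R :: "'K poly set" where
  "R = {p. \<forall>m. Polynomial.coeff p m \<in> L (m * d)}"

definition R_plus :: "'K poly set" where
  "R_plus = {p \<in> R. Polynomial.coeff p 0 = 0}"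

definition I :: "'K poly set" where
  "I = {p. \<forall>m. Polynomial.coeff p m \<in> D m}"

abbreviation z :: "'K poly" where
  "z \<equiv> Polynomial.monom \<phi> q"

abbreviation scale :: "'k \<Rightarrow> 'K poly \<Rightarrow> 'K poly" where
  "scale c \<equiv> Polynomial.smult (sc c)"

lemma vector_space_scale: "vector_space scale"
  by unfold_locales (simp_all add: smult_add_right smult_add_left h_add h_mult h_one)

lemma monom_mem_R: "f \<in> L (m * d) \<Longrightarrow> Polynomial.monom f m \<in> R"
  by (auto simp: R_def L_zero)

lemma monom_mem_I: "f \<in> D m \<Longrightarrow> Polynomial.monom f m \<in> I"
  by (auto simp: I_def D_zero)

lemma subring_R: "subring_set R"
proof
  show "1 \<in> R" using sc_mem_L[of 1] by (auto simp: R_def coeff_1 L_zero h_one)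
  show "p * p' \<in> R" if "p \<in> R" "p' \<in> R" for p p'
    unfolding R_def mem_Collect_eq coeff_mult
  proof (intro allI L_sum)
    fix m i :: nat assume "i \<in> {..m}"
    then have "i * d + (m - i) * d = m * d" by (simp flip: add_mult_distrib)
    then show "Polynomial.coeff p i * Polynomial.coeff p' (m - i) \<in> L (m * d)"
      using that L_mult[of "Polynomial.coeff p i" "i * d" "Polynomial.coeff p' (m - i)" "(m - i) * d"]
      by (simp add: R_def)
  qed
qed (auto simp: R_def L_add L_uminus)

end

sublocale section_pair \<subseteq> R: subring_set R
  by (rule subring_R)

context section_pair
begin

lemma ideal_set_I: "ideal_set R I"
proof
  show "I \<subseteq> R" unfolding I_def R_def using D_subset by blast
  show "0 \<in> I" "\<And>p p'. p \<in> I \<Longrightarrow> p' \<in> I \<Longrightarrow> p + p' \<in> I" by (auto simp: I_def D_zero D_add)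
  show "p * p' \<in> I" if "p \<in> R" "p' \<in> I" for p p'
    unfolding I_def mem_Collect_eq coeff_mult
  proof (intro allI D_sum)
    fix m i :: nat assume "i \<in> {..m}"
    then show "Polynomial.coeff p i * Polynomial.coeff p' (m - i) \<in> D m"
      using D_mult[of "Polynomial.coeff p i" i "Polynomial.coeff p' (m - i)" "m - i"]
        that by (simp add: R_def I_def)
  qed
qed

end

sublocale section_pair \<subseteq> I: ideal_set R I
  by (rule ideal_set_I)

context section_pair
begin

lemma x_mem_I: "x_section \<in> I"
proof -
  have "1 \<in> L 0" using sc_mem_L[of 1] by (simp add: h_one)
  then have "1 \<in> D 1" using L_pred_subset_D[of 1] by auto
  then show ?thesis by (simp add: x_section_def monom_mem_I)
qed

lemma z_mem_I: "z \<in> I"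
proof -
  have "1 \<in> piece_below q q" using sc_mem_L[of 1] by (simp add: piece_below_def h_one)
  then have "0 + \<phi> * 1 \<in> D q" unfolding D_def using piece_below_zero by blast
  then show ?thesis by (simp add: monom_mem_I)
qed

lemma poly_mem_sum_closed:
  assumes "0 \<in> W" "\<And>u w. u \<in> W \<Longrightarrow> w \<in> W \<Longrightarrow> u + w \<in> W"
    and "\<And>m. Polynomial.monom (Polynomial.coeff p m) m \<in> W"
  shows "p \<in> W"
proof -
  have "(\<Sum>m\<le>n. Polynomial.monom (Polynomial.coeff p m) m) \<in> W" for n
    using assms by (induction n) auto
  then show ?thesis using poly_as_sum_of_monoms[of p] by metis
qed

text \<open>The ideal generated by \<open>x\<close> and \<open>z\<close> is described by its graded pieces.\<close>

lemma genideal_eq_I: "genideal (subring_on R) {x_section, z} = I"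
proof -
  interpret ring "subring_on R" using R.cring_subring_on by (rule cring.axioms)
  let ?J = "genideal (subring_on R) {x_section, z}"
  have sub: "{x_section, z} \<subseteq> carrier (subring_on R)"
    using x_mem_I z_mem_I I.ideal_subset by (auto simp: subring_on_simps)
  interpret J: ideal_set R ?J using R.ideal_subring_on_iff genideal_ideal[OF sub] by blast
  have J: "x_section \<in> ?J" "z \<in> ?J" using genideal_self[OF sub] by auto
  show ?thesis
  proof
    show "?J \<subseteq> I"
      using x_mem_I z_mem_I R.ideal_subring_on_iff ideal_set_I by (intro genideal_minimal) auto
    show "I \<subseteq> ?J"
    proof
      fix p assume p: "p \<in> I"
      show "p \<in> ?J"
      proof (rule poly_mem_sum_closed[OF J.ideal_zero J.ideal_add])
        fix m
        obtain a b where ab: "Polynomial.coeff p m = a + \<phi> * b" "a \<in> piece_below m 1"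
          "b \<in> piece_below m q" using p unfolding I_def D_def by blast
        have a: "Polynomial.monom a m \<in> ?J"
        proof (cases m)
          case 0
          then show ?thesis using ab(2) J.ideal_zero by (simp add: piece_below_def)
        next
          case (Suc n)
          then have "Polynomial.monom a n \<in> R"
            using ab(2) by (intro monom_mem_R) (simp add: piece_below_def)
          then have "Polynomial.monom a n * x_section \<in> ?J" by (rule J.ideal_mult) (rule J)
          then show ?thesis by (simp add: x_section_def mult_monom Suc)
        qed
        have b: "Polynomial.monom (\<phi> * b) m \<in> ?J"
        proof (cases "m < q")
          case True
          then show ?thesis using ab(3) J.ideal_zero by (simp add: piece_below_def)
        next
          case False
          then have "Polynomial.monom b (m - q) \<in> R"
            using ab(3) by (intro monom_mem_R) (simp add: piece_below_def)
          then have "Polynomial.monom b (m - q) * z \<in> ?J" by (rule J.ideal_mult) (rule J)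
          then show ?thesis using False by (simp add: mult_monom mult.commute)
        qed
        show "Polynomial.monom (Polynomial.coeff p m) m \<in> ?J"
          unfolding ab(1) using J.ideal_add[OF a b] by (simp add: add_monom)
      qed
    qed
  qed
qed

lemma square_zero_iff: "square_zero \<longleftrightarrow> (\<forall>p\<in>R_plus. \<forall>p'\<in>R_plus. p * p' \<in> I)"
proof
  assume sq: square_zero
  show "\<forall>p\<in>R_plus. \<forall>p'\<in>R_plus. p * p' \<in> I"
  proof (intro ballI)
    fix p p' assume p: "p \<in> R_plus" "p' \<in> R_plus"
    show "p * p' \<in> I"
      unfolding I_def mem_Collect_eq coeff_mult
    proof (intro allI D_sum)
      fix m i :: nat assume "i \<in> {..m}"
      then have i: "i + (m - i) = m" by simp
      show "Polynomial.coeff p i * Polynomial.coeff p' (m - i) \<in> D m"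
      proof (cases "i = 0 \<or> m - i = 0")
        case True
        then show ?thesis using p D_zero by (auto simp: R_plus_def)
      next
        case False
        then have "1 \<le> i" "1 \<le> m - i" by auto
        then have "Polynomial.coeff p i * Polynomial.coeff p' (m - i) \<in> D (i + (m - i))"
          using sq p unfolding square_zero_def R_plus_def R_def by blast
        then show ?thesis using i by simp
      qed
    qed
  qed
next
  assume *: "\<forall>p\<in>R_plus. \<forall>p'\<in>R_plus. p * p' \<in> I"
  show square_zero
    unfolding square_zero_def
  proof (intro allI impI ballI)
    fix m n :: nat and f g
    assume mn: "1 \<le> m" "1 \<le> n" "f \<in> L (m * d)" "g \<in> L (n * d)"
    then have "Polynomial.monom f m \<in> R_plus" "Polynomial.monom g n \<in> R_plus"
      by (auto simp: R_plus_def monom_mem_R)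
    then have "Polynomial.monom (f * g) (m + n) \<in> I" using * by (simp flip: mult_monom)
    then show "f * g \<in> D (m + n)" unfolding I_def by (metis (no_types, lifting) coeff_monom mem_Collect_eq)
  qed
qed

end


section \<open>The Apery basis\<close>

text \<open>Now let \<open>H\<close> contain all numbers greater than \<open>F\<close>. Then each residue class modulo \<open>e\<close> contains
  exactly one element of the Apery set, namely the least element of \<open>H\<close> in this class.\<close>

locale cofinite_section_pair = section_pair sc ord B d q \<phi>
  for sc :: "'k::field \<Rightarrow> 'K::field" and ord B d q \<phi> +
  fixes F :: nat
  assumes cofinite: "F < n \<Longrightarrow> n \<in> H"
begin

text \<open>The least element of \<open>H\<close> in the class of \<open>r\<close> modulo \<open>e\<close>.\<close>

definition least_in_class :: "nat \<Rightarrow> nat" where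
  "least_in_class r = (LEAST h. h \<in> H \<and> h mod e = r)"

lemma least_in_class:
  assumes "r < e" shows "least_in_class r \<in> H" "least_in_class r mod e = r"
proof -
  let ?h = "(F + 1) * e + r"
  have "F + 1 \<le> (F + 1) * e" using e_pos by (metis mult.right_neutral mult_le_mono2 Suc_leI One_nat_def)
  then have "F < ?h" by linarith
  moreover have "?h mod e = r" using assms by (simp only: mod_mult_self3 mod_less)
  ultimately have "?h \<in> H \<and> ?h mod e = r" using cofinite by blast
  then have "least_in_class r \<in> H \<and> least_in_class r mod e = r"
    unfolding least_in_class_def by (rule LeastI)
  then show "least_in_class r \<in> H" "least_in_class r mod e = r" by auto
qed

lemma least_in_class_le: "h \<in> H \<Longrightarrow> least_in_class (h mod e) \<le> h"
  unfolding least_in_class_def by (rule Least_le) simp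

lemma least_in_class_mem_apery:
  assumes "r < e" shows "least_in_class r \<in> apery"
proof -
  let ?h = "least_in_class r"
  have "?h - e \<notin> H" if "e \<le> ?h"
  proof
    assume "?h - e \<in> H"
    then have "least_in_class ((?h - e) mod e) \<le> ?h - e" by (rule least_in_class_le)
    moreover have "(?h - e) mod e = r"
      using that least_in_class(2)[OF assms] by (simp add: le_mod_geq)
    ultimately show False using e_pos that by simp
  qed
  then show ?thesis using least_in_class(1)[OF assms] by (simp add: apery_def)
qed

lemma apery_eq_least_in_class:
  assumes "h \<in> apery" shows "h = least_in_class (h mod e)"
proof (rule ccontr)
  let ?l = "least_in_class (h mod e)"
  assume ne: "h \<noteq> ?l"
  have h: "h \<in> H" using assms by (simp add: apery_def)
  have r: "h mod e < e" using e_pos by simp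
  have "?l < h" using ne least_in_class_le[OF h] by simp
  moreover have "h mod e = ?l mod e" by (rule least_in_class(2)[OF r, symmetric])
  ultimately obtain k where k: "h = ?l + e * k" using mod_eq_nat1E[of h e ?l] by auto
  have "k \<noteq> 0"
  proof
    assume "k = 0"
    with k have "h = ?l" by (simp only: mult_0_right add_0_right)
    then show False using ne by contradiction
  qed
  then obtain k' where "k = Suc k'" by (cases k) auto
  then have "h - e = ?l + k' * e" "e \<le> h" using k by (auto simp: algebra_simps)
  then have "h - e \<in> H" using H_add[OF least_in_class(1)[OF r] H_mult[OF e_mem_H]] by simp
  then show False using assms \<open>e \<le> h\<close> by (simp add: apery_def)
qed

lemma least_in_class_0: "least_in_class 0 = 0"
  using least_in_class_le[OF H_zero] by simp

lemma least_in_class_pos: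
  assumes "r \<in> {1..<e}" shows "0 < least_in_class r"
proof (rule ccontr)
  assume "\<not> 0 < least_in_class r"
  then have "r = 0" using least_in_class(2)[of r] assms by simp
  then show False using assms by simp
qed

text \<open>The degree in which a function of pole order \<open>h\<close> appears first, i.e. \<open>h / d\<close> rounded up.\<close>

definition first_degree :: "nat \<Rightarrow> nat" where
  "first_degree h = (h + (d - 1)) div d"

lemma first_degree_eq_iff:
  assumes "1 \<le> m" shows "first_degree h = m \<longleftrightarrow> (m - 1) * d < h \<and> h \<le> m * d"
proof -
  obtain n where n: "m = Suc n" using assms by (cases m) auto
  have "(h + (d - 1)) div d = m \<longleftrightarrow> d * m \<le> h + (d - 1) \<and> h + (d - 1) < d * (m + 1)"
    using d_pos div_nat_eqI[of d m "h + (d - 1)"]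
    by (metis dividend_less_times_div le_refl less_le_trans mult.commute mult_Suc_right
        Suc_eq_plus1 times_div_less_eq_dividend less_one neq0_conv not_le)
  then show ?thesis unfolding first_degree_def n using d_pos by (auto simp: algebra_simps)
qed

lemma first_degree_pos: "0 < h \<Longrightarrow> 1 \<le> first_degree h"
  using d_pos by (simp add: first_degree_def Suc_le_eq div_greater_zero_iff)

text \<open>A function of pole order \<open>h\<close>, for \<open>h\<close> in \<open>H\<close>, and the sections given by such functions for
  the elements of the Apery set.\<close>

definition function_of_order :: "nat \<Rightarrow> 'K" where
  "function_of_order h = (SOME f. f \<in> B \<and> f \<noteq> 0 \<and> ord f = - int h)"

lemma function_of_order:
  assumes "h \<in> H"
  shows "function_of_order h \<in> B" "function_of_order h \<noteq> 0" "ord (function_of_order h) = - int h"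
proof -
  have "\<exists>f. f \<in> B \<and> f \<noteq> 0 \<and> ord f = - int h" using assms by (auto simp: H_def)
  then have "function_of_order h \<in> B \<and> function_of_order h \<noteq> 0 \<and> ord (function_of_order h) = - int h"
    unfolding function_of_order_def by (rule someI_ex)
  then show "function_of_order h \<in> B" "function_of_order h \<noteq> 0"
    "ord (function_of_order h) = - int h" by auto
qed

definition apery_section :: "nat \<Rightarrow> 'K poly" where
  "apery_section r =
     Polynomial.monom (function_of_order (least_in_class r)) (first_degree (least_in_class r))"

lemma apery_section_mem:
  assumes "r \<in> {1..<e}" shows "apery_section r \<in> R_plus"
proof -
  let ?h = "least_in_class r"
  have h: "?h \<in> H" using assms by (intro least_in_class) simp
  have m: "1 \<le> first_degree ?h" using least_in_class_pos[OF assms] by (rule first_degree_pos)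
  then have "?h \<le> first_degree ?h * d" using first_degree_eq_iff[OF m] by blast
  then have "function_of_order ?h \<in> L (first_degree ?h * d)"
    using mem_L_iff[OF function_of_order[OF h]] by blast
  then show ?thesis using m by (simp add: apery_section_def R_plus_def monom_mem_R)
qed

text \<open>The residue class \<open>0\<close> is left out: its element of the Apery set is \<open>0\<close>, which belongs to
  degree \<open>0\<close>. Hence \<open>R_plus / I\<close> has dimension \<open>e - 1\<close>.\<close>

lemma apery_basis: "basis_mod scale R_plus I {1..<e} apery_section"
  unfolding basis_mod_def
proof (intro conjI ballI allI impI)
  interpret V: vector_space scale by (rule vector_space_scale)
  show "finite {1..<e}" by simp
  show "apery_section r \<in> R_plus" if "r \<in> {1..<e}" for r using that by (rule apery_section_mem)
  let ?comb = "\<lambda>c. \<Sum>r\<in>{1..<e}. scale (c r) (apery_section r)"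
  have coeff_comb: "Polynomial.coeff (?comb c) m =
      (\<Sum>r\<in>{r \<in> {1..<e}. first_degree (least_in_class r) = m}.
         sc (c r) * function_of_order (least_in_class r))" for c m
  proof -
    have "Polynomial.coeff (?comb c) m = (\<Sum>r\<in>{1..<e}. if first_degree (least_in_class r) = m
        then sc (c r) * function_of_order (least_in_class r) else 0)"
      unfolding coeff_sum by (intro sum.cong) (auto simp: apery_section_def)
    then show ?thesis by (subst sum.inter_filter) auto
  qed
  let ?W = "{w. \<exists>c. w - ?comb c \<in> I}"
  have W_add: "u + w \<in> ?W" if uw: "u \<in> ?W" "w \<in> ?W" for u w
  proof -
    obtain a b where "u - ?comb a \<in> I" "w - ?comb b \<in> I" using uw by blast
    then have "(u - ?comb a) + (w - ?comb b) \<in> I" by (rule I.ideal_add)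
    then have "u + w - ?comb (\<lambda>r. a r + b r) \<in> I"
      by (simp add: V.scale_left_distrib sum.distrib algebra_simps)
    then show ?thesis by (intro CollectI exI[of _ "\<lambda>r. a r + b r"])
  qed
  have W_0: "0 \<in> ?W" by (auto intro!: exI[of _ "\<lambda>_. 0"] simp: h_zero I.ideal_zero)
  have W_I: "I \<subseteq> ?W" by (auto intro!: exI[of _ "\<lambda>_. 0"] simp: h_zero)
  show "\<exists>c. p - ?comb c \<in> I" if p: "p \<in> R_plus" for p
  proof -
    have "p \<in> ?W"
    proof (rule poly_mem_sum_closed[OF _ W_add])
      show "0 \<in> ?W" by (rule W_0)
      fix m
      show "Polynomial.monom (Polynomial.coeff p m) m \<in> ?W"
      proof (cases "m = 0")
        case True
        then have "Polynomial.monom (Polynomial.coeff p m) m = 0" using p by (simp add: R_plus_def)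
        then show ?thesis using W_0 by (simp only:)
      next
        case False
        then have m: "1 \<le> m" by simp
        let ?Wm = "{f. Polynomial.monom f m \<in> ?W}"
        have "Polynomial.coeff p m \<in> ?Wm"
        proof (rule reduce_mod_D[OF _ m])
          show "Polynomial.coeff p m \<in> L (m * d)" using p by (simp add: R_plus_def R_def)
          show "0 \<in> ?Wm" using W_0 by (simp only: mem_Collect_eq monom_eq_0)
          show "u + w \<in> ?Wm" if "u \<in> ?Wm" "w \<in> ?Wm" for u w
            using W_add that by (simp flip: add_monom)
          show "D m \<subseteq> ?Wm" using W_I monom_mem_I by blast
          fix h assume h: "h \<in> apery" "(m - 1) * d < h" "h \<le> m * d"
          let ?r = "h mod e"
          have hr: "h = least_in_class ?r" by (rule apery_eq_least_in_class[OF h(1)])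
          have "?r \<noteq> 0" using hr least_in_class_0 h(2) by (metis not_less_zero)
          then have r: "?r \<in> {1..<e}" using e_pos by simp
          have deg: "first_degree h = m" using first_degree_eq_iff[OF m] h by blast
          have hH: "h \<in> H" using h(1) by (simp add: apery_def)
          have "Polynomial.monom (sc c * function_of_order h) m \<in> ?W" for c
          proof -
            have "Polynomial.monom (sc c * function_of_order h) m = scale c (apery_section ?r)"
              unfolding apery_section_def using hr deg by (simp add: smult_monom)
            also have "\<dots> = ?comb (\<lambda>r. if r = ?r then c else 0)"
              using r by (simp add: if_distrib[of "\<lambda>c. Polynomial.smult (sc c) _"] h_zero cong: if_cong)
            finally have "Polynomial.monom (sc c * function_of_order h) m
              - ?comb (\<lambda>r. if r = ?r then c else 0) \<in> I" using I.ideal_zero by simp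
            then show ?thesis by (intro CollectI exI[of _ "\<lambda>r. if r = ?r then c else 0"])
          qed
          then show "\<exists>g\<in>B. g \<noteq> 0 \<and> ord g = - int h \<and> (\<forall>c. sc c * g \<in> ?Wm)"
            using function_of_order[OF hH] by (intro bexI[of _ "function_of_order h"]) auto
        qed
        then show ?thesis by simp
      qed
    qed
    then show ?thesis by blast
  qed
  fix c r0
  assume I: "?comb c \<in> I" and r0: "r0 \<in> {1..<e}"
  show "c r0 = 0"
  proof (rule ccontr)
    assume "c r0 \<noteq> 0"
    define m where "m = first_degree (least_in_class r0)"
    define S where "S = {r \<in> {1..<e}. first_degree (least_in_class r) = m}"
    define b where "b r = function_of_order (least_in_class r)" for r
    have m: "1 \<le> m" using least_in_class_pos[OF r0] first_degree_pos by (simp add: m_def)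
    have b: "b r \<noteq> 0" "ord (b r) = - int (least_in_class r)" if "r \<in> S" for r
      using that function_of_order[OF least_in_class(1)] by (simp_all add: b_def S_def)
    have inj: "inj_on (\<lambda>r. ord (b r)) S"
    proof (rule inj_onI)
      fix r r' assume "r \<in> S" "r' \<in> S" "ord (b r) = ord (b r')"
      then have "least_in_class r = least_in_class r'" "r < e" "r' < e" by (auto simp: b S_def)
      then show "r = r'" using least_in_class(2) by metis
    qed
    have "\<exists>r\<in>S. c r \<noteq> 0" using r0 \<open>c r0 \<noteq> 0\<close> by (auto simp: S_def m_def)
    moreover have "finite S" by (simp add: S_def)
    ultimately obtain r where r: "r \<in> S" "(\<Sum>i\<in>S. sc (c i) * b i) \<noteq> 0"
      "ord (\<Sum>i\<in>S. sc (c i) * b i) = ord (b r)"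
      using ord_linear_combination[of S c b] b(1) inj by blast
    have "(\<Sum>i\<in>S. sc (c i) * b i) \<notin> D m"
    proof (rule not_mem_D_if_apery[OF r(2)])
      show "ord (\<Sum>i\<in>S. sc (c i) * b i) = - int (least_in_class r)" using r b(2) by simp
      show "least_in_class r \<in> apery" using r(1) by (auto simp: S_def intro: least_in_class_mem_apery)
      show "(m - 1) * d < least_in_class r"
        using first_degree_eq_iff[OF m] r(1) by (auto simp: S_def)
    qed
    moreover have "Polynomial.coeff (?comb c) m = (\<Sum>i\<in>S. sc (c i) * b i)"
      unfolding coeff_comb S_def b_def ..
    ultimately show False using I by (metis (no_types, lifting) I_def mem_Collect_eq)
  qed
qed

end


section \<open>Minimal presentations\<close>

text \<open>Here the \<open>y a\<close>, of weights \<open>v a\<close>, complete \<open>x\<close> and \<open>z\<close> to a minimal system of homogeneous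
  generators of \<open>R\<close>.\<close>

locale presented_section_pair = cofinite_section_pair sc ord B d q \<phi> F
  for sc :: "'k::field \<Rightarrow> 'K::field" and ord B d q \<phi> F +
  fixes s :: nat and v :: "nat \<Rightarrow> nat" and y :: "nat \<Rightarrow> 'K poly"
  assumes y_homogeneous: "a \<in> {1..s} \<Longrightarrow> \<exists>f. y a = Polynomial.monom f (v a)"
    and v_mono: "mono_on {1..s} v"
    and generators: "mpol_eval (\<lambda>c. [:sc c:]) (pvar_image z y) ` mpols_in (pvars s) = R"
    and generator_basis: "basis_mod scale R_plus (ideal_prod (subring_on R) R_plus R_plus)
      (pvars s) (pvar_image z y)"
begin

abbreviation R_plus_square :: "'K poly set" where
  "R_plus_square \<equiv> ideal_prod (subring_on R) R_plus R_plus"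

lemma ideal_R_plus: "ideal_set R R_plus"
  by unfold_locales (auto simp: R_plus_def R.zero_closed R.add_closed R.mult_closed coeff_mult_0)

lemma ideal_R_plus_square: "ideal_set R R_plus_square" and R_plus_square_subset: "R_plus_square \<subseteq> R_plus"
proof -
  interpret ring "subring_on R" using R.cring_subring_on by (rule cring.axioms)
  have "ideal R_plus (subring_on R)" using ideal_R_plus R.ideal_subring_on_iff by blast
  then show "ideal_set R R_plus_square" "R_plus_square \<subseteq> R_plus"
    using ideal_prod_is_ideal ideal_prod_inter R.ideal_subring_on_iff by blast+
qed

lemma product_mem_square: "p \<in> R_plus \<Longrightarrow> p' \<in> R_plus \<Longrightarrow> p * p' \<in> R_plus_square"
  using ideal_prod.prod[of p R_plus p' R_plus "subring_on R"] by (simp add: subring_on_simps)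

lemma square_zero_iff_subset: "square_zero \<longleftrightarrow> R_plus_square \<subseteq> I"
proof
  assume sq: square_zero
  show "R_plus_square \<subseteq> I"
  proof
    fix w assume "w \<in> R_plus_square"
    then show "w \<in> I"
      by (induction w rule: ideal_prod.induct)
         (use sq square_zero_iff in \<open>auto simp: subring_on_simps intro: I.ideal_add\<close>)
  qed
next
  assume "R_plus_square \<subseteq> I"
  then show square_zero using square_zero_iff product_mem_square by blast
qed

lemma x_mem_R_plus: "x_section \<in> R_plus"
  using x_mem_I I.ideal_subset by (auto simp: R_plus_def x_section_def)

lemma z_mem_R_plus: "z \<in> R_plus"
  using z_mem_I I.ideal_subset q_pos by (auto simp: R_plus_def)

lemma scale_mem: "ideal_set R J \<Longrightarrow> p \<in> J \<Longrightarrow> scale c p \<in> J"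
proof -
  assume J: "ideal_set R J" "p \<in> J"
  have "Polynomial.monom (sc c) 0 \<in> R" by (rule monom_mem_R) (rule sc_mem_L)
  then have "Polynomial.monom (sc c) 0 * p \<in> J" by (rule ideal_set.ideal_mult[OF J(1) _ J(2)])
  then show ?thesis by (simp add: monom_0)
qed

lemma subspace_if_ideal: "ideal_set R J \<Longrightarrow> module.subspace scale J"
proof -
  assume J: "ideal_set R J"
  interpret vector_space scale by (rule vector_space_scale)
  show ?thesis
    by (rule subspaceI)
       (use J in \<open>auto intro: scale_mem ideal_set.ideal_zero ideal_set.ideal_add\<close>)
qed

text \<open>As \<open>R\<close> has only constants in degree \<open>0\<close>, modulo the square of the ideal of positive degree
  the ideal \<open>(x, z)\<close> is spanned by \<open>x\<close> and \<open>z\<close>.\<close>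

lemma I_mod_square:
  assumes "u \<in> I" shows "\<exists>a b. u - scale a x_section - scale b z \<in> R_plus_square"
proof -
  interpret S: ideal_set R R_plus_square by (rule ideal_R_plus_square)
  interpret ring "subring_on R" using R.cring_subring_on by (rule cring.axioms)
  let ?J = "{u. \<exists>a b. u - scale a x_section - scale b z \<in> R_plus_square}"
  have xzR: "x_section \<in> R" "z \<in> R" using x_mem_R_plus z_mem_R_plus by (auto simp: R_plus_def)
  have scR: "scale c p \<in> R" if "p \<in> R" for c p
    using that by (auto simp: R_def sc_mult_L)
  have scP: "scale c p \<in> R_plus" if "p \<in> R_plus" for c p
    using that by (auto simp: R_plus_def scR)
  have J: "ideal_set R ?J"
  proof
    show "?J \<subseteq> R"
    proof
      fix u assume "u \<in> ?J"
      then obtain a b where "u - scale a x_section - scale b z \<in> R" using S.ideal_subset by blast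
      then have "(u - scale a x_section - scale b z) + (scale a x_section + scale b z) \<in> R"
        by (intro R.add_closed scR xzR)
      then show "u \<in> R" by simp
    qed
    show "0 \<in> ?J" by (auto intro!: exI[of _ 0] simp: h_zero S.ideal_zero)
    show "u + u' \<in> ?J" if uu: "u \<in> ?J" "u' \<in> ?J" for u u'
    proof -
      obtain a b a' b' where "u - scale a x_section - scale b z \<in> R_plus_square"
        "u' - scale a' x_section - scale b' z \<in> R_plus_square" using uu by blast
      then have "(u - scale a x_section - scale b z) + (u' - scale a' x_section - scale b' z)
          \<in> R_plus_square" by (rule S.ideal_add)
      then have "(u + u') - scale (a + a') x_section - scale (b + b') z \<in> R_plus_square"
        by (simp add: h_add smult_add_left algebra_simps)
      then show ?thesis by blast
    qed
    show "p * u \<in> ?J" if pu: "p \<in> R" "u \<in> ?J" for p u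
    proof -
      obtain a b where ab: "u - scale a x_section - scale b z \<in> R_plus_square" using pu by blast
      have "Polynomial.coeff p 0 \<in> L (0 * d)" using pu(1) unfolding R_def by blast
      then obtain c where c: "Polynomial.coeff p 0 = sc c" using L_0_scalar by auto
      have "[:sc c:] \<in> R" using monom_mem_R[of "sc c" 0] sc_mem_L by (simp add: monom_0)
      then have "p - [:sc c:] \<in> R_plus" using pu(1) c by (simp add: R_plus_def R.diff_closed)
      moreover have "scale a x_section + scale b z \<in> R_plus"
        by (intro ideal_set.ideal_add[OF ideal_R_plus] scP x_mem_R_plus z_mem_R_plus)
      ultimately have "(p - [:sc c:]) * (scale a x_section + scale b z) \<in> R_plus_square"
        by (rule product_mem_square)
      moreover have "p * (u - scale a x_section - scale b z) \<in> R_plus_square"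
        by (rule S.ideal_mult[OF pu(1) ab])
      ultimately have "p * (u - scale a x_section - scale b z)
          + (p - [:sc c:]) * (scale a x_section + scale b z) \<in> R_plus_square"
        by (intro S.ideal_add)
      moreover have "p * (u - x' - z') + (p - k) * (x' + z') = p * u - k * x' - k * z'"
        for k x' z' :: "'K poly" by (simp add: algebra_simps)
      ultimately have "p * u - [:sc c:] * scale a x_section - [:sc c:] * scale b z \<in> R_plus_square"
        by simp
      then have "p * u - scale (c * a) x_section - scale (c * b) z \<in> R_plus_square"
        by (simp add: h_mult mult.commute)
      then show ?thesis by blast
    qed
  qed
  have "x_section - scale 1 x_section - scale 0 z \<in> R_plus_square"
    "z - scale 0 x_section - scale 1 z \<in> R_plus_square"
    by (simp_all add: h_one h_zero S.ideal_zero)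
  then have "{x_section, z} \<subseteq> ?J" by blast
  moreover have "ideal ?J (subring_on R)" using J R.ideal_subring_on_iff by blast
  ultimately have "I \<subseteq> ?J" unfolding genideal_eq_I[symmetric] by (intro genideal_minimal)
  then show ?thesis using assms by blast
qed

lemma sum_pvars: "(\<Sum>i\<in>pvars s. f i) = f XV + f ZV + (\<Sum>a\<in>{1..s}. f (YV a))"
proof -
  have "(\<Sum>i\<in>pvars s. f i) = (\<Sum>i\<in>{XV, ZV}. f i) + (\<Sum>i\<in>YV ` {1..s}. f i)"
    unfolding pvars_def by (rule sum.union_disjoint) auto
  moreover have "inj_on YV {1..s}" by (rule inj_onI) (rule pvar.inject[THEN iffD1])
  ultimately show ?thesis by (simp add: sum.reindex)
qed

text \<open>The remaining generators form a basis of the quotient of the ideal of positive degree of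
  \<open>R / (x, z)\<close> by its square.\<close>

lemma y_basis:
  "basis_mod scale R_plus {w + u | w u. w \<in> R_plus_square \<and> u \<in> I} {1..s} y"
  (is "basis_mod _ _ ?W _ _")
  unfolding basis_mod_def
proof (intro conjI ballI allI impI)
  interpret S: ideal_set R R_plus_square by (rule ideal_R_plus_square)
  note basis = basis_modD[OF generator_basis]
  have W: "w + u \<in> ?W" if "w \<in> R_plus_square" "u \<in> I" for w u
    using that by (intro CollectI exI[of _ w] exI[of _ u]) simp
  show "finite {1..s}" by simp
  show "y a \<in> R_plus" if "a \<in> {1..s}" for a
  proof -
    have "pvar_image z y (YV a) \<in> R_plus" using that by (intro basis) (simp add: pvars_def)
    then show ?thesis by simp
  qed
  show "\<exists>c. p - (\<Sum>a\<in>{1..s}. scale (c a) (y a)) \<in> ?W" if "p \<in> R_plus" for p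
  proof -
    obtain c where c: "p - (\<Sum>i\<in>pvars s. scale (c i) (pvar_image z y i)) \<in> R_plus_square"
      using basis(3)[OF \<open>p \<in> R_plus\<close>] by blast
    have "scale (c XV) x_section + scale (c ZV) z \<in> I"
      by (intro I.ideal_add scale_mem ideal_set_I x_mem_I z_mem_I)
    then have "(p - (\<Sum>i\<in>pvars s. scale (c i) (pvar_image z y i)))
      + (scale (c XV) x_section + scale (c ZV) z) \<in> ?W"
      by (rule W[OF c])
    then have "p - (\<Sum>a\<in>{1..s}. scale (c (YV a)) (y a)) \<in> ?W" by (simp add: sum_pvars)
    then show ?thesis by (rule exI[of _ "\<lambda>a. c (YV a)"])
  qed
  fix c a assume c: "(\<Sum>a\<in>{1..s}. scale (c a) (y a)) \<in> ?W" and a: "a \<in> {1..s}"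
  then obtain w u where wu: "(\<Sum>a\<in>{1..s}. scale (c a) (y a)) = w + u"
    "w \<in> R_plus_square" "u \<in> I" by blast
  obtain b b' where "u - scale b x_section - scale b' z \<in> R_plus_square"
    using I_mod_square[OF wu(3)] by blast
  then have "w + (u - scale b x_section - scale b' z) \<in> R_plus_square"
    by (rule S.ideal_add[OF wu(2)])
  moreover define c' where "c' = case_pvar (- b) (- b') c"
  moreover have "(\<Sum>i\<in>pvars s. scale (c' i) (pvar_image z y i)) =
      w + (u - scale b x_section - scale b' z)"
    using wu(1) by (simp add: sum_pvars c'_def h_uminus)
  ultimately have "(\<Sum>i\<in>pvars s. scale (c' i) (pvar_image z y i)) \<in> R_plus_square" by simp
  then have "\<forall>i\<in>pvars s. c' i = 0" by (rule basis(4))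
  moreover have "YV a \<in> pvars s" using a by (auto simp: pvars_def)
  ultimately have "c' (YV a) = 0" by blast
  then show "c a = 0" by (simp add: c'_def)
qed

text \<open>The quotient \<open>R_plus / I\<close> has dimension \<open>e - 1\<close>, and \<open>s\<close> is the dimension of
  its quotient \<open>R_plus / (R_plus_square + I)\<close>. These agree iff \<open>R_plus_square\<close> is contained in
  \<open>I\<close>.\<close>

lemma square_zero_iff_length: "square_zero \<longleftrightarrow> s = e - 1"
proof
  interpret vector_space scale by (rule vector_space_scale)
  interpret S: ideal_set R R_plus_square by (rule ideal_R_plus_square)
  assume square_zero
  then have "R_plus_square \<subseteq> I" by (simp add: square_zero_iff_subset)
  then have "w + u \<in> I" if "w \<in> R_plus_square" "u \<in> I" for w u
    using that I.ideal_add by blast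
  moreover have "u = 0 + u" for u :: "'K poly" by simp
  ultimately have "{w + u | w u. w \<in> R_plus_square \<and> u \<in> I} = I"
    using S.ideal_zero by blast
  then have "basis_mod scale R_plus I {1..s} y" using y_basis by simp
  then have "card {1..s} = card {1..<e}"
    by (rule basis_mod_card_eq[OF subspace_if_ideal[OF ideal_set_I] _ apery_basis])
  then show "s = e - 1" by simp
next
  interpret vector_space scale by (rule vector_space_scale)
  interpret S: ideal_set R R_plus_square by (rule ideal_R_plus_square)
  let ?W = "{w + u | w u. w \<in> R_plus_square \<and> u \<in> I}"
  note y = basis_modD[OF y_basis]
  assume s: "s = e - 1"
  have W: "w + u \<in> ?W" if "w \<in> R_plus_square" "u \<in> I" for w u
    using that by (intro CollectI exI[of _ w] exI[of _ u]) simp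
  have "w \<in> I" if w: "w \<in> R_plus_square" for w
  proof -
    have "\<exists>c. w - (\<Sum>a\<in>{1..s}. scale (c a) (y a)) \<in> I"
    proof (rule spans_mod_if_card_eq[OF subspace_if_ideal[OF ideal_set_I] apery_basis])
      show "w \<in> R_plus" using w R_plus_square_subset by blast
      show "y a \<in> R_plus" if "a \<in> {1..s}" for a using that by (rule y(2))
      show "\<forall>a\<in>{1..s}. c a = 0" if "(\<Sum>a\<in>{1..s}. scale (c a) (y a)) \<in> I" for c
        using W[OF S.ideal_zero that] by (intro y(4)) simp
    qed (simp_all add: s)
    then obtain c where c: "w - (\<Sum>a\<in>{1..s}. scale (c a) (y a)) \<in> I" by blast
    from W[OF w I.ideal_uminus[OF c]] have "(\<Sum>a\<in>{1..s}. scale (c a) (y a)) \<in> ?W" by simp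
    then have "\<forall>a\<in>{1..s}. c a = 0" by (rule y(4))
    then have "(\<Sum>a\<in>{1..s}. scale (c a) (y a)) = 0" by (simp add: h_zero)
    then show ?thesis using c by simp
  qed
  then show square_zero using square_zero_iff_subset by blast
qed

text \<open>The quotient by \<open>(x, z)\<close> is generated by the \<open>y a\<close>, so in positive degrees it lives in
  degrees at least \<open>v 1\<close>. For \<open>s = 0\<close> the quotient is the ground field, and \<open>v 1\<close> is
  meaningless.\<close>

lemma decompose_mod_I:
  assumes p: "p \<in> R_plus" and v1: "1 \<le> v 1 \<or> s = 0"
  obtains u r where "p = u + r" "u \<in> I" "r \<in> R"
    "\<And>j. j < v 1 \<or> s = 0 \<Longrightarrow> Polynomial.coeff r j = 0"
proof -
  let ?low = "{r \<in> R. \<forall>j. j < v 1 \<or> s = 0 \<longrightarrow> Polynomial.coeff r j = 0}"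
  let ?T = "{p. \<exists>c. \<exists>u\<in>I. \<exists>r\<in>?low. p = [:sc c:] + u + r}"
  have low0: "0 \<in> ?low" by (simp add: R.zero_closed)
  have T_intro: "[:sc c:] + u + r \<in> ?T" if "u \<in> I" "r \<in> ?low" for c u r
    by (rule CollectI, rule exI[of _ c], rule bexI[OF _ that(1)], rule bexI[OF _ that(2)], rule refl)
  have T_0: "0 \<in> ?T" using T_intro[OF I.ideal_zero low0, of 0] by (simp add: h_zero)
  have T_add: "a + b \<in> ?T" if ab: "a \<in> ?T" "b \<in> ?T" for a b
  proof -
    obtain c u r c' u' r' where "a = [:sc c:] + u + r" "b = [:sc c':] + u' + r'"
      and *: "u \<in> I" "u' \<in> I" "r \<in> ?low" "r' \<in> ?low" using ab by blast
    then have eq: "a + b = [:sc (c + c'):] + (u + u') + (r + r')"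
      by (simp add: h_add algebra_simps)
    have "r + r' \<in> ?low" using * by (simp add: R.add_closed)
    then show ?thesis unfolding eq by (intro T_intro I.ideal_add *)
  qed
  have image_mem: "pvar_image z y i \<in> R" if "i \<in> pvars s" for i
    using basis_modD(2)[OF generator_basis that] by (simp add: R_plus_def)
  have const_R: "[:sc c:] \<in> R" for c using monom_mem_R[of "sc c" 0] sc_mem_L by (simp add: monom_0)
  have term_mem: "[:sc c:] * power_product (pvar_image z y) m \<in> ?T"
    if m: "Poly_Mapping.keys m \<subseteq> pvars s" for c m
  proof (cases "Poly_Mapping.keys m = {}")
    case True
    then show ?thesis using T_intro[OF I.ideal_zero low0, of c] by simp
  next
    case False
    then obtain i where i: "i \<in> Poly_Mapping.keys m" by blast
    let ?e = "Poly_Mapping.lookup m"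
    let ?w = "[:sc c:] * pvar_image z y i ^ (?e i - 1) *
       (\<Prod>k\<in>Poly_Mapping.keys m - {i}. pvar_image z y k ^ ?e k)"
    have w: "?w \<in> R"
      using m i by (intro R.mult_closed R.prod_closed R.power_closed const_R image_mem) auto
    have "0 < ?e i" using i by (simp add: in_keys_iff)
    then have "pvar_image z y i ^ ?e i = pvar_image z y i * pvar_image z y i ^ (?e i - 1)"
      by (cases "?e i") auto
    then have eq: "[:sc c:] * power_product (pvar_image z y) m = pvar_image z y i * ?w"
      using prod.remove[OF finite_keys i, of "\<lambda>k. pvar_image z y k ^ ?e k"]
      by (simp add: mult_ac)
    show ?thesis
    proof (cases i)
      case (YV a)
      then have a: "a \<in> {1..s}" using m i by (auto simp: pvars_def)
      then have "v 1 \<le> v a" using v_mono by (auto simp: mono_on_def)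
      moreover obtain f where "y a = Polynomial.monom f (v a)" using y_homogeneous[OF a] by blast
      ultimately have "Polynomial.coeff (y a * ?w) j = 0" if "j < v 1" for j
        using that by (simp add: coeff_monom_mult)
      moreover have "s \<noteq> 0" using a by simp
      moreover have "y a \<in> R" using image_mem[of i] m i YV by auto
      then have "y a * ?w \<in> R" by (rule R.mult_closed[OF _ w])
      ultimately have "pvar_image z y i * ?w \<in> ?low" using YV by simp
      then show ?thesis using eq T_intro[OF I.ideal_zero, of "pvar_image z y i * ?w" 0] by (simp add: h_zero)
    next
      case XV
      have "x_section * ?w \<in> I" by (rule I.ideal_mult'[OF x_mem_I w])
      then show ?thesis using eq XV T_intro[OF _ low0, of "x_section * ?w" 0] by (simp add: h_zero)
    next
      case ZV
      have "z * ?w \<in> I" by (rule I.ideal_mult'[OF z_mem_I w])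
      then show ?thesis using eq ZV T_intro[OF _ low0, of "z * ?w" 0] by (simp add: h_zero)
    qed
  qed
  have "p \<in> R" using p by (simp add: R_plus_def)
  then obtain G where G: "G \<in> mpols_in (pvars s)" "p = mpol_eval (\<lambda>c. [:sc c:]) (pvar_image z y) G"
    using generators by blast
  have "(\<Sum>m\<in>S. [:sc (Poly_Mapping.lookup G m):] * power_product (pvar_image z y) m) \<in> ?T"
    if "S \<subseteq> Poly_Mapping.keys G" "finite S" for S
    using that(2,1)
  proof (induction S rule: finite_induct)
    case empty
    show ?case using T_0 by (simp only: sum.empty)
  next
    case (insert m S)
    then have "Poly_Mapping.keys m \<subseteq> pvars s" using G(1) by (auto simp: mpols_in_def)
    then show ?case
      unfolding sum.insert[OF insert.hyps] using insert by (intro T_add term_mem) auto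
  qed
  from this[OF subset_refl finite_keys] have "p \<in> ?T" unfolding G(2) mpol_eval_def .
  then obtain c u r where cur: "p = [:sc c:] + u + r" "u \<in> I" "r \<in> ?low" by blast
  have "Polynomial.coeff u 0 \<in> D 0" using cur(2) unfolding I_def by blast
  moreover have "Polynomial.coeff r 0 = 0" using cur(3) v1 by auto
  ultimately have "sc c = 0" using p cur(1) D_0 by (simp add: R_plus_def)
  then show ?thesis using cur by (intro that[of u r]) auto
qed

lemma square_zero_if_degrees_exceed:
  assumes v1: "1 \<le> v 1 \<or> s = 0" and large: "\<And>m. 2 * v 1 \<le> m \<Longrightarrow> L (m * d) \<subseteq> D m"
  shows square_zero
  unfolding square_zero_iff
proof (intro ballI)
  fix p p' assume "p \<in> R_plus" "p' \<in> R_plus"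
  then obtain u r u' r' where *: "p = u + r" "u \<in> I" "r \<in> R"
      "\<And>j. j < v 1 \<or> s = 0 \<Longrightarrow> Polynomial.coeff r j = 0"
    "p' = u' + r'" "u' \<in> I" "r' \<in> R"
      "\<And>j. j < v 1 \<or> s = 0 \<Longrightarrow> Polynomial.coeff r' j = 0"
    using decompose_mod_I[OF _ v1] by metis
  have "r * r' \<in> I"
    unfolding I_def mem_Collect_eq
  proof
    fix m
    show "Polynomial.coeff (r * r') m \<in> D m"
    proof (cases "2 * v 1 \<le> m")
      case True
      have "r * r' \<in> R" using * by (intro R.mult_closed)
      then show ?thesis using large[OF True] by (auto simp: R_def)
    next
      case False
      have "Polynomial.coeff r i * Polynomial.coeff r' (m - i) = 0" for i
      proof (cases "i < v 1")
        case False
        then have "m - i < v 1" using \<open>\<not> 2 * v 1 \<le> m\<close> by linarith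
        then show ?thesis using *(8) by simp
      qed (use *(4) in simp)
      then have "Polynomial.coeff (r * r') m = 0" unfolding coeff_mult by (intro sum.neutral ballI)
      then show ?thesis by (simp add: D_zero)
    qed
  qed
  moreover have "p' \<in> R" using \<open>p' \<in> R_plus\<close> by (simp add: R_plus_def)
  ultimately have "u * p' + (r * u' + r * r') \<in> I"
    by (intro I.ideal_add I.ideal_mult'[OF *(2)] I.ideal_mult[OF *(3) *(6)])
  then show "p * p' \<in> I" using * by (simp add: algebra_simps)
qed

text \<open>An element of the Apery set is at most \<open>e + F\<close>, so the quotient by \<open>(x, z)\<close> vanishes in the
  degrees greater than \<open>q + \<lceil>F / d\<rceil>\<close>.\<close>

lemma square_zero_if_weights_large:
  assumes "2 * int (v 1) > int q + \<lceil>real F / real d\<rceil>"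
  shows square_zero
proof (rule square_zero_if_degrees_exceed)
  have c: "0 \<le> \<lceil>real F / real d\<rceil>"
    using ceiling_mono[of 0 "real F / real d"] by simp
  show "1 \<le> v 1 \<or> s = 0" using assms c by linarith
  fix m assume m: "2 * v 1 \<le> m"
  have "int q + \<lceil>real F / real d\<rceil> \<le> int (m - 1)" using assms m c by linarith
  then have "real q + real F / real d \<le> real (m - 1)" by linarith
  then have "(real q + real F / real d) * real d \<le> real (m - 1) * real d"
    by (rule mult_right_mono) simp
  then have "real (e + F) \<le> real ((m - 1) * d)" using d_pos by (simp add: distrib_right)
  then have le: "e + F \<le> (m - 1) * d" by (simp only: of_nat_le_iff)
  have "1 \<le> m" using m assms c by linarith
  then show "L (m * d) \<subseteq> D m"
  proof (rule L_subset_D)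
    fix h assume "h \<in> apery" "(m - 1) * d < h"
    then show "m * d < h" using apery_le[OF cofinite] le by (meson le_trans not_le)
  qed
qed

end


section \<open>Pole orders on a smooth curve\<close>

lemma obtain_curve_at:
  assumes "smooth_projective_curve X" "Q \<in> points X"
  obtains p j where "curve_at X p j" "Q = proj_point p"
proof -
  have "Q \<in> proj_space"
    using assms unfolding smooth_projective_curve_def projective_variety_def algebraic_set_def
    by blast
  then obtain p where p: "Q = proj_point p" "p \<noteq> (\<lambda>_. 0)" unfolding proj_space_def by blast
  then obtain j where "p j \<noteq> 0" by blast
  with p assms have "curve_at X p j" by unfold_locales auto
  then show ?thesis using that p(1) by blast
qed

lemma subring_local_ring:
  assumes "smooth_projective_curve X" "Q \<in> points X" shows "subring_set (local_ring X Q)"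
  using obtain_curve_at[OF assms] curve_at.subring_A by metis

lemma scalar_mem_local_ring:
  assumes "smooth_projective_curve X" "Q \<in> points X" shows "scalar X c \<in> local_ring X Q"
  using obtain_curve_at[OF assms] curve_at.scalar_mem_A by metis

lemma ord_at_nonneg_iff:
  assumes "smooth_projective_curve X" "Q \<in> points X" "f \<noteq> 0"
  shows "0 \<le> ord_at X Q f \<longleftrightarrow> f \<in> local_ring X Q"
  using obtain_curve_at[OF assms(1,2)] curve_at.ord_nonneg_iff assms(3) by metis

text \<open>The ring of the rational functions that are regular away from \<open>P\<close>.\<close>

definition regular_away ::
  "('k::field, 'K::field, 'n::finite) variety \<Rightarrow> ('n \<Rightarrow> 'k) set \<Rightarrow> 'K set" where
  "regular_away X P = {f. \<forall>Q\<in>points X - {P}. f \<in> local_ring X Q}"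

lemma H0_eq:
  assumes "smooth_projective_curve X"
  shows "H0 X P n = {f \<in> regular_away X P. f = 0 \<or> - int n \<le> ord_at X P f}"
proof -
  have zero: "0 \<in> local_ring X Q" if "Q \<in> points X" for Q
    using subring_set.zero_closed[OF subring_local_ring[OF assms that]] .
  have "f \<in> H0 X P n \<longleftrightarrow> f \<in> regular_away X P \<and> (f = 0 \<or> - int n \<le> ord_at X P f)" for f
  proof (cases "f = 0")
    case True
    then show ?thesis using zero by (simp add: H0_def regular_away_def)
  next
    case False
    have "(\<forall>Q\<in>points X - {P}. 0 \<le> ord_at X Q f) \<longleftrightarrow> f \<in> regular_away X P"
      unfolding regular_away_def mem_Collect_eq
      by (intro ball_cong refl ord_at_nonneg_iff[OF assms]) (use False in auto)
    then show ?thesis using False by (simp only: H0_def mem_Collect_eq simp_thms conj_commute)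
  qed
  then show ?thesis by (simp only: set_eq_iff mem_Collect_eq simp_thms)
qed

text \<open>The functions that are regular away from \<open>P\<close> are filtered by their pole orders at \<open>P\<close>, as
  soon as those without a pole are known to be constant.\<close>

lemma pole_filtration_curve:
  assumes X: "smooth_projective_curve X" and P: "P \<in> points X"
    and const: "\<And>f. f \<in> regular_away X P \<Longrightarrow> f \<noteq> 0 \<Longrightarrow> 0 \<le> ord_at X P f \<Longrightarrow> \<exists>c. f = scalar X c"
  shows "pole_filtration (scalar X) (ord_at X P) (regular_away X P)"
proof -
  obtain p j where p: "curve_at X p j" "P = proj_point p" using obtain_curve_at[OF X P] by blast
  interpret curve_at X p j by (rule p(1))
  show ?thesis
    unfolding p(2)
  proof
    show "scalar X c \<in> regular_away X (proj_point p)" for c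
      using scalar_mem_local_ring[OF X] by (simp add: regular_away_def)
    show "f + g \<in> regular_away X (proj_point p)"
      if "f \<in> regular_away X (proj_point p)" "g \<in> regular_away X (proj_point p)" for f g
      using that subring_set.add_closed[OF subring_local_ring[OF X]] by (simp add: regular_away_def)
    show "f * g \<in> regular_away X (proj_point p)"
      if "f \<in> regular_away X (proj_point p)" "g \<in> regular_away X (proj_point p)" for f g
      using that subring_set.mult_closed[OF subring_local_ring[OF X]] by (simp add: regular_away_def)
  qed (use ord_scalar ord_mult ord_add ord_residue const p(2) in blast)+
qed

lemma vector_space_repartitions:
  assumes "smooth_projective_curve X"
  shows "vector_space (\<lambda>c r Q. scl X c (r Q))"
proof -
  interpret coefficient_hom "scalar X" by (rule smooth_projective_curve_coefficient_hom[OF assms])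
  show ?thesis
    by unfold_locales (auto simp: fun_eq_iff h_add h_mult h_one algebra_simps)
qed

lemma subspace_principal_repartitions:
  assumes X: "smooth_projective_curve X"
  shows "module.subspace (\<lambda>c r Q. scl X c (r Q)) (principal_repartitions X)"
proof -
  interpret vector_space "\<lambda>c r Q. scl X c (r Q)" by (rule vector_space_repartitions[OF X])
  note ring = subring_local_ring[OF X]
  show ?thesis
  proof (rule subspaceI)
    have zero: "0 \<in> local_ring X Q" if "Q \<in> points X" for Q
      by (rule subring_set.zero_closed[OF ring[OF that]])
    then have "{Q \<in> points X. 0 Q \<notin> local_ring X Q} = {}" by auto
    moreover have "\<forall>Q\<in>points X. 0 Q - 0 \<in> local_ring X Q" using zero by simp
    ultimately show "0 \<in> principal_repartitions X"
      unfolding principal_repartitions_def repartitions_def mem_Collect_eq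
      by (metis finite.emptyI)
  next
    fix r r' assume "r \<in> principal_repartitions X" "r' \<in> principal_repartitions X"
    then obtain f f' where f: "finite {Q \<in> points X. r Q \<notin> local_ring X Q}"
      "\<And>Q. Q \<in> points X \<Longrightarrow> r Q - f \<in> local_ring X Q"
      "finite {Q \<in> points X. r' Q \<notin> local_ring X Q}"
      "\<And>Q. Q \<in> points X \<Longrightarrow> r' Q - f' \<in> local_ring X Q"
      unfolding principal_repartitions_def repartitions_def by blast
    have "{Q \<in> points X. (r + r') Q \<notin> local_ring X Q} \<subseteq>
       {Q \<in> points X. r Q \<notin> local_ring X Q} \<union> {Q \<in> points X. r' Q \<notin> local_ring X Q}"
      using subring_set.add_closed[OF ring] by auto
    then have "finite {Q \<in> points X. (r + r') Q \<notin> local_ring X Q}"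
      using f(1,3) finite_subset by blast
    moreover have "(r + r') Q - (f + f') \<in> local_ring X Q" if "Q \<in> points X" for Q
      using subring_set.add_closed[OF ring[OF that] f(2)[OF that] f(4)[OF that]] by (simp add: algebra_simps)
    ultimately show "r + r' \<in> principal_repartitions X"
      unfolding principal_repartitions_def repartitions_def by blast
  next
    fix c r assume "r \<in> principal_repartitions X"
    then obtain f where f: "finite {Q \<in> points X. r Q \<notin> local_ring X Q}"
      "\<And>Q. Q \<in> points X \<Longrightarrow> r Q - f \<in> local_ring X Q"
      unfolding principal_repartitions_def repartitions_def by blast
    have mult: "scl X c h \<in> local_ring X Q" if "Q \<in> points X" "h \<in> local_ring X Q" for h Q
      by (rule subring_set.mult_closed[OF ring[OF that(1)] scalar_mem_local_ring[OF X that(1)] that(2)])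
    have "{Q \<in> points X. scl X c (r Q) \<notin> local_ring X Q} \<subseteq> {Q \<in> points X. r Q \<notin> local_ring X Q}"
      using mult by blast
    then have "finite {Q \<in> points X. scl X c (r Q) \<notin> local_ring X Q}"
      using f(1) finite_subset by blast
    moreover have "scl X c (r Q) - scl X c f \<in> local_ring X Q" if "Q \<in> points X" for Q
      using mult[OF that f(2)[OF that]] by (simp add: right_diff_distrib)
    ultimately show "(\<lambda>Q. scl X c (r Q)) \<in> principal_repartitions X"
      unfolding principal_repartitions_def repartitions_def by blast
  qed
qed

lemma genus_unique:
  assumes "smooth_projective_curve X" "has_genus X g" "has_genus X g'"
  shows "g = g'"
proof -
  obtain b b' where
    "basis_mod (\<lambda>c r Q. scl X c (r Q)) (repartitions X) (principal_repartitions X) {..<g} b"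
    "basis_mod (\<lambda>c r Q. scl X c (r Q)) (repartitions X) (principal_repartitions X) {..<g'} b'"
    using assms(2,3) unfolding has_genus_def quotient_has_dim_def by blast
  then have "card {..<g} = card {..<g'}"
    by (rule vector_space.basis_mod_card_eq[OF vector_space_repartitions[OF assms(1)]
          subspace_principal_repartitions[OF assms(1)]])
  then show ?thesis by simp
qed

lemma weierstrass_semigroup_eq:
  "pole_filtration (scalar X) (ord_at X P) (regular_away X P) \<Longrightarrow>
   weierstrass_semigroup X P = pole_filtration.H (ord_at X P) (regular_away X P)"
  unfolding weierstrass_semigroup_def regular_away_def
  by (subst pole_filtration.H_def[of "scalar X"]) auto

text \<open>There are at most \<open>g\<close> gaps: the repartitions supported at \<open>P\<close> with value of pole order \<open>n\<close>,
  for the gaps \<open>n\<close>, are linearly independent modulo the principal ones, since otherwise some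
  function would have a gap as pole order.\<close>

lemma card_gaps_le_genus:
  assumes X: "smooth_projective_curve X" and P: "P \<in> points X" and g: "has_genus X g"
    and filt: "pole_filtration (scalar X) (ord_at X P) (regular_away X P)"
    and G: "finite G" "G \<subseteq> gaps X P"
  shows "card G \<le> g"
proof -
  interpret pole_filtration "scalar X" "ord_at X P" "regular_away X P" by (rule filt)
  interpret vector_space "\<lambda>c r Q. scl X c (r Q)" by (rule vector_space_repartitions[OF X])
  obtain p j where p: "curve_at X p j" "P = proj_point p" using obtain_curve_at[OF X P] by blast
  have gap: "n \<notin> H" if "n \<in> G" for n
    using that G(2) weierstrass_semigroup_eq[OF filt] by (auto simp: gaps_def)
  obtain t where t: "\<And>n. t n \<noteq> 0" "\<And>n::nat. ord_at X P (t n) = - int n"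
    using choice[of "\<lambda>n f. f \<noteq> 0 \<and> ord_at X P f = - int n"] curve_at.ex_ord_eq[OF p(1)] p(2)
    by blast
  define y where "y n Q = (if Q = P then t n else 0)" for n Q
  obtain b where b:
    "basis_mod (\<lambda>c r Q. scl X c (r Q)) (repartitions X) (principal_repartitions X) {..<g} b"
    using g unfolding has_genus_def quotient_has_dim_def by blast
  have zero: "0 \<in> local_ring X Q" if "Q \<in> points X" for Q
    by (rule subring_set.zero_closed[OF subring_local_ring[OF X that]])
  have y_rep: "y n \<in> repartitions X" for n
  proof -
    have "{Q \<in> points X. y n Q \<notin> local_ring X Q} \<subseteq> {P}" using zero by (auto simp: y_def)
    then show ?thesis unfolding repartitions_def using finite_subset by blast
  qed
  have "card G \<le> card {..<g}"
  proof (rule card_le_if_spanned_mod[OF subspace_principal_repartitions[OF X]])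
    show "finite G" by (rule G(1))
    show "\<exists>c. y n - (\<Sum>i\<in>{..<g}. (\<lambda>Q. scl X (c i) (b i Q))) \<in> principal_repartitions X" for n
      by (rule basis_modD(3)[OF b y_rep])
    show "\<forall>n\<in>G. c n = 0" if c: "(\<Sum>n\<in>G. (\<lambda>Q. scl X (c n) (y n Q))) \<in> principal_repartitions X" for c
    proof (rule ccontr)
      assume "\<not> (\<forall>n\<in>G. c n = 0)"
      moreover have "inj_on (\<lambda>n. ord_at X P (t n)) G" by (rule inj_onI) (simp add: t(2))
      ultimately obtain n where n: "n \<in> G" "(\<Sum>n\<in>G. scl X (c n) (t n)) \<noteq> 0"
        "ord_at X P (\<Sum>n\<in>G. scl X (c n) (t n)) = - int n"
        using ord_linear_combination[OF G(1), of c t] t by metis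
      let ?u = "\<Sum>n\<in>G. scl X (c n) (t n)"
      have sum: "(\<Sum>n\<in>G. (\<lambda>Q. scl X (c n) (y n Q))) Q = (if Q = P then ?u else 0)" for Q
        using G(1) by (induction G rule: finite_induct) (auto simp: y_def)
      obtain f where f: "\<And>Q. Q \<in> points X \<Longrightarrow> (if Q = P then ?u else 0) - f \<in> local_ring X Q"
        using c unfolding principal_repartitions_def mem_Collect_eq sum by blast
      have "- f \<in> local_ring X Q" if "Q \<in> points X - {P}" for Q using f[of Q] that by simp
      then have "- f \<in> regular_away X P" by (simp add: regular_away_def)
      then have fB: "f \<in> regular_away X P" using B_uminus by force
      have fP: "?u - f \<in> local_ring X P" using f[OF P] by simp
      have "n \<noteq> 0" using gap[OF n(1)] H_zero by metis
      have "f - ?u = 0 \<or> ord_at X P ?u < ord_at X P (f - ?u)"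
        using fP ord_at_nonneg_iff[OF X P, of "?u - f"] ord_uminus[of "?u - f"] n(3) \<open>n \<noteq> 0\<close>
        by (cases "f = ?u") auto
      then have "f \<noteq> 0" "ord_at X P f = - int n"
        using ord_add_eq[OF n(2), of "f - ?u"] n(3) by simp_all
      then have "n \<in> H" unfolding H_def using fB by blast
      then show False using gap[OF n(1)] by contradiction
    qed
  qed simp
  then show ?thesis by simp
qed

lemma finite_gaps:
  assumes "smooth_projective_curve X" "P \<in> points X" "has_genus X g"
    and "pole_filtration (scalar X) (ord_at X P) (regular_away X P)"
  shows "finite (gaps X P)"
proof (rule ccontr)
  assume "infinite (gaps X P)"
  then obtain G where "G \<subseteq> gaps X P" "finite G" "card G = Suc g"
    using infinite_arbitrarily_large by blast
  then show False using card_gaps_le_genus[OF assms, of G] by simp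
qed

text \<open>All generators have positive degree, so only constants are left in degree \<open>0\<close>.\<close>

lemma regular_constant_if_presented:
  assumes X: "smooth_projective_curve X"
    and pres: "minimal_presentation X P d z s v y"
    and f: "f \<in> regular_away X P" "0 \<le> ord_at X P f" "f \<noteq> 0"
  shows "\<exists>c. f = scalar X c"
proof -
  interpret coefficient_hom "scalar X" by (rule smooth_projective_curve_coefficient_hom[OF X])
  have "0 \<in> H0 X P n" for n by (simp add: H0_def)
  moreover have "f \<in> H0 X P 0" using f by (simp add: H0_eq[OF X])
  ultimately have "Polynomial.monom f 0 \<in> section_carrier X P d"
    by (simp add: section_carrier_def)
  then obtain G where G: "G \<in> mpols_in (pvars s)"
    "Polynomial.monom f 0 = mpol_eval (\<lambda>c. [:scalar X c:]) (pvar_image z y) G"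
    using pres unfolding minimal_presentation_def by blast
  have image0: "Polynomial.coeff (pvar_image z y i) 0 = 0" if "i \<in> pvars s" for i
    using pres that unfolding minimal_presentation_def basis_mod_def irrelevant_ideal_def by blast
  let ?t = "\<lambda>m. [:scalar X (Poly_Mapping.lookup G m):] * power_product (pvar_image z y) m"
  have t: "Polynomial.coeff (?t m) 0 = (if m = 0 then scalar X (Poly_Mapping.lookup G 0) else 0)"
    if "m \<in> Poly_Mapping.keys G" for m
  proof (cases "m = 0")
    case False
    then obtain i where i: "i \<in> Poly_Mapping.keys m" by fastforce
    then have "i \<in> pvars s" using that G(1) by (auto simp: mpols_in_def)
    moreover have "0 < Poly_Mapping.lookup m i" using i by (simp add: in_keys_iff)
    ultimately have "poly (pvar_image z y i ^ Poly_Mapping.lookup m i) 0 = 0"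
      using image0[of i] by (simp add: poly_power poly_0_coeff_0[symmetric])
    then have "poly (?t m) 0 = 0"
      using i by (simp add: poly_prod prod_zero_iff) metis
    then show ?thesis using False by (simp add: poly_0_coeff_0)
  qed simp
  have "f = Polynomial.coeff (Polynomial.monom f 0) 0" by simp
  also have "\<dots> = (\<Sum>m\<in>Poly_Mapping.keys G. Polynomial.coeff (?t m) 0)"
    unfolding G(2) mpol_eval_def by (rule coeff_sum)
  also have "\<dots> = (\<Sum>m\<in>Poly_Mapping.keys G. if m = 0 then scalar X (Poly_Mapping.lookup G 0) else 0)"
    by (intro sum.cong refl t)
  also have "\<dots> = scalar X (Poly_Mapping.lookup G 0)"
    by (simp add: in_keys_iff h_zero)
  finally show ?thesis by blast
qed

theorem proposition4p2:
  fixes X :: "('k::alg_closed_field, 'K::field, 'n::finite) variety"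
    and P :: "('n \<Rightarrow> 'k) set"
    and g d s :: nat
    and z :: "'K poly"
    and v :: "nat \<Rightarrow> nat"
    and y :: "nat \<Rightarrow> 'K poly"
  assumes "smooth_projective_curve X"
    and "has_genus X g"
    and "g \<ge> 1"
    and "P \<in> points X"
    and "d \<ge> 1"
    and "z_section X P d z"
    and "minimal_presentation X P d z s v y"
  shows "(A_plus_square_zero X P d z \<longleftrightarrow> s = ed X P d - 1) \<and>
    (2 * int (v 1) > int (qd X P d) + \<lceil>real (frobenius_number X P) / real d\<rceil> \<longrightarrow>
       A_plus_square_zero X P d z) \<and>
    (ordinary_point X P \<longrightarrow> (A_plus_square_zero X P d z \<longleftrightarrow> d dvd g \<or> d dvd (g + 1)))"
proof -
  note X = assms(1) and P = assms(4) and pres = assms(7)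
  have filt: "pole_filtration (scalar X) (ord_at X P) (regular_away X P)"
    using regular_constant_if_presented[OF X pres] by (intro pole_filtration_curve[OF X P])
  interpret pole_filtration "scalar X" "ord_at X P" "regular_away X P" by (rule filt)
  let ?q = "qd X P d" and ?F = "frobenius_number X P"
  have H0: "H0 X P n = L n" for n by (simp add: H0_eq[OF X] L_def)
  have wH: "weierstrass_semigroup X P = H" by (rule weierstrass_semigroup_eq[OF filt])
  have fin: "finite (gaps X P)" by (rule finite_gaps[OF X P assms(2) filt])
  \<comment> \<open>This also holds if there are no gaps, whatever \<open>?F\<close> is then.\<close>
  have cofinite: "n \<in> H" if "?F < n" for n
    using Max_ge[OF fin, of n] that wH by (auto simp: gaps_def frobenius_number_def)
  have q: "1 \<le> ?q \<and> ?q * d \<in> H"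
    unfolding qd_def wH
  proof (rule LeastI)
    have "(?F + 1) * 1 \<le> (?F + 1) * d" using assms(5) by (intro mult_le_mono2)
    then have "?F < (?F + 1) * d" by (simp only: mult_1_right Suc_eq_plus1[symmetric] Suc_le_eq)
    then show "1 \<le> ?F + 1 \<and> (?F + 1) * d \<in> H" using cofinite by simp
  qed
  have q_least: "?q \<le> r" if "1 \<le> r" "r * d \<in> H" for r
    unfolding qd_def wH by (rule Least_le) (use that in simp)
  obtain \<phi> where \<phi>: "\<phi> \<in> L (?q * d)" "\<phi> \<noteq> 0" "ord_at X P \<phi> = - int (?q * d)"
    "z = Polynomial.monom \<phi> ?q"
    using assms(6) unfolding z_section_def H0 ed_def by blast
  interpret S: section_pair "scalar X" "ord_at X P" "regular_away X P" d ?q \<phi>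
    using \<phi> q assms(5) by unfold_locales (auto simp: L_def)
  have R: "section_carrier X P d = S.R" by (simp add: section_carrier_def S.R_def H0)
  have R_plus: "irrelevant_ideal X P d = S.R_plus"
    by (simp add: irrelevant_ideal_def S.R_plus_def R)
  interpret presented_section_pair "scalar X" "ord_at X P" "regular_away X P" d ?q \<phi> ?F s v y
  proof
    show "n \<in> H" if "?F < n" for n using that by (rule cofinite)
    show "\<exists>f. y a = Polynomial.monom f (v a)" if "a \<in> {1..s}" for a
      using pres that unfolding minimal_presentation_def section_piece_def by blast
  qed (use pres \<phi>(4) in \<open>simp_all add: minimal_presentation_def R R_plus section_ring_def\<close>)
  have I: "A_ideal X P d z = S.I"
    using S.genideal_eq_I by (simp add: A_ideal_def section_ring_def R \<phi>(4))
  have sq: "A_plus_square_zero X P d z \<longleftrightarrow> S.square_zero"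
    unfolding A_plus_square_zero_def A_ring_def A_plus_def I section_ring_def R R_plus
      S.square_zero_iff
    by (rule S.I.ideal_prod_quotient_zero_iff)
       (auto simp: S.R_plus_def S.R.zero_closed)
  have "S.square_zero \<longleftrightarrow> d dvd g \<or> d dvd (g + 1)" if "ordinary_point X P"
  proof (rule S.square_zero_ordinary_iff)
    obtain g' where g': "has_genus X g'" "gaps X P = {1..g'}"
      using \<open>ordinary_point X P\<close> unfolding ordinary_point_def by blast
    then have "gaps X P = {1..g}" using genus_unique[OF X assms(2)] by blast
    then have H: "H = - {1..g}" using wH by (metis double_compl gaps_def)
    show "n \<in> H \<longleftrightarrow> n = 0 \<or> g < n" for n unfolding H by auto
    show "1 \<le> g" by (rule assms(3))
    show "?q \<le> r" if "1 \<le> r" "r * d \<in> H" for r using that by (rule q_least)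
  qed
  then show ?thesis
    using square_zero_iff_length square_zero_if_weights_large unfolding sq ed_def by blast
qed

end
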